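(* There exist positive constants $c_0,c_1,C_0,C_1,C_2$ (depending only on the distribution of the entries of the sensing vectors) such that the following holds. Let $a_1,\dots,a_m$ be drawn from the sub-Gaussian sampling model, let $\mathcal A(M)=(a_i^\top M a_i)_{i=1}^m$, and suppose $m>c_1 nr$. Then with probability at least $1-C_0\exp(-c_0 m)$ the following holds simultaneously for all positive semidefinite $\Sigma\in\mathbb{R}^{n\times n}$, all $\epsilon_1\ge0$ and all noise vectors $\eta\in\mathbb{R}^m$ with $\|\eta\|_1\le\epsilon_1$: letting $y=\mathcal A(\Sigma)+\eta$, any minimizer $\hat\Sigma$ of $$\min_{M}\ \operatorname{Tr}(M)\quad\text{subject to}\quad M\succeq0,\ \ \|y-\mathcal A(M)\|_1\le\epsilon_1$$ satisfies $$\|\hat\Sigma-\Sigma\|_{\mathrm F}\le C_1\frac{\|\Sigma-\Sigma_r\|_*}{\sqrt r}+C_2\frac{\epsilon_1}{m}.$$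
   Context: Sub-Gaussian sampling model: the sensing vectors $a_1,a_2,\dots\in\mathbb{R}^n$ are i.i.d. copies of a random vector $z=(z_1,\dots,z_n)^\top$ whose entries $z_j$ are i.i.d. sub-Gaussian random variables with $\mathbb{E}[z_j]=0$, $\mathbb{E}[z_j^2]=1$ and $\mu_4:=\mathbb{E}[z_j^4]>1$. $\Sigma_r$ denotes a best rank-$r$ approximation of $\Sigma$ in Frobenius norm. $\|\cdot\|_*$ is the nuclear norm, $\|\cdot\|_{\mathrm F}$ the Frobenius norm, and $\|v\|_1$ the $\ell_1$ norm of a vector. *)

theory Defs
  imports "HOL-Probability.Probability" "Jordan_Normal_Form.DL_Rank"
begin

definition mtrace :: "real mat \<Rightarrow> real" where
  "mtrace A = (\<Sum>i<dim_row A. A $$ (i, i))"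

definition psd_mat :: "nat \<Rightarrow> real mat \<Rightarrow> bool" where
  "psd_mat n A \<longleftrightarrow> A \<in> carrier_mat n n \<and> transpose_mat A = A \<and>
     (\<forall>x \<in> carrier_vec n. 0 \<le> scalar_prod x (mult_mat_vec A x))"

definition frob_norm :: "real mat \<Rightarrow> real" where
  "frob_norm A = sqrt (\<Sum>i<dim_row A. \<Sum>j<dim_col A. (A $$ (i, j))\<^sup>2)"

text \<open>|A| = (A^T A)^(1/2), the unique PSD square root; nuclear norm = trace of |A|
  (= sum of singular values).\<close>
definition mat_abs :: "real mat \<Rightarrow> real mat" where
  "mat_abs A = (THE B. psd_mat (dim_col A) B \<and> B * B = transpose_mat A * A)"

definition nuc_norm :: "real mat \<Rightarrow> real" where
  "nuc_norm A = mtrace (mat_abs A)"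

definition mat_rank :: "real mat \<Rightarrow> nat" where
  "mat_rank A = vec_space.rank (dim_row A) A"

definition best_rank_approx :: "nat \<Rightarrow> real mat \<Rightarrow> real mat \<Rightarrow> bool" where
  "best_rank_approx r S Sr \<longleftrightarrow>
     Sr \<in> carrier_mat (dim_row S) (dim_col S) \<and> mat_rank Sr \<le> r \<and>
     (\<forall>M \<in> carrier_mat (dim_row S) (dim_col S).
        mat_rank M \<le> r \<longrightarrow> frob_norm (S - Sr) \<le> frob_norm (S - M))"

definition l1_norm :: "real vec \<Rightarrow> real" where
  "l1_norm v = (\<Sum>i<dim_vec v. \<bar>vec_index v i\<bar>)"

definition sens_vec :: "(nat \<times> nat \<Rightarrow> real) \<Rightarrow> nat \<Rightarrow> nat \<Rightarrow> real vec" where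
  "sens_vec a n i = vec n (\<lambda>j. a (i, j))"

definition sens_op :: "(nat \<times> nat \<Rightarrow> real) \<Rightarrow> nat \<Rightarrow> nat \<Rightarrow> real mat \<Rightarrow> real vec" where
  "sens_op a m n M = vec m (\<lambda>i. scalar_prod (sens_vec a n i) (mult_mat_vec M (sens_vec a n i)))"

definition is_minimizer ::
  "(nat \<times> nat \<Rightarrow> real) \<Rightarrow> nat \<Rightarrow> nat \<Rightarrow> real vec \<Rightarrow> real \<Rightarrow> real mat \<Rightarrow> bool" where
  "is_minimizer a m n y eps Sh \<longleftrightarrow>
     (psd_mat n Sh \<and> l1_norm (y - sens_op a m n Sh) \<le> eps) \<and>
     (\<forall>M. psd_mat n M \<and> l1_norm (y - sens_op a m n M) \<le> eps \<longrightarrow> mtrace Sh \<le> mtrace M)"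

text \<open>Sub-Gaussian (psi_2 norm finite): E exp(X^2/K^2) \<le> 2 for some K > 0.\<close>
definition sub_gaussian :: "real measure \<Rightarrow> bool" where
  "sub_gaussian D \<longleftrightarrow> (\<exists>K>0. (\<integral>\<^sup>+ x. ennreal (exp (x\<^sup>2 / K\<^sup>2)) \<partial>D) \<le> 2)"

definition entry_distribution :: "real measure \<Rightarrow> bool" where
  "entry_distribution D \<longleftrightarrow> prob_space D \<and> sets D = sets borel \<and> sub_gaussian D \<and>
     integrable D (\<lambda>x. x) \<and> (\<integral>x. x \<partial>D) = 0 \<and>
     integrable D (\<lambda>x. x\<^sup>2) \<and> (\<integral>x. x\<^sup>2 \<partial>D) = 1 \<and>
     integrable D (\<lambda>x. x ^ 4) \<and> (\<integral>x. x ^ 4 \<partial>D) > 1"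

definition sample_space :: "real measure \<Rightarrow> nat \<Rightarrow> nat \<Rightarrow> (nat \<times> nat \<Rightarrow> real) measure" where
  "sample_space D m n = PiM ({..<m} \<times> {..<n}) (\<lambda>_. D)"

definition recovery_event ::
  "nat \<Rightarrow> nat \<Rightarrow> nat \<Rightarrow> real \<Rightarrow> real \<Rightarrow> (nat \<times> nat \<Rightarrow> real) set" where
  "recovery_event m n r C1 C2 = {a.
     \<forall>Sig eps eta Sh Sr.
       psd_mat n Sig \<longrightarrow> 0 \<le> eps \<longrightarrow> eta \<in> carrier_vec m \<longrightarrow> l1_norm eta \<le> eps \<longrightarrow>
       is_minimizer a m n (sens_op a m n Sig + eta) eps Sh \<longrightarrow>
       best_rank_approx r Sig Sr \<longrightarrow>
       frob_norm (Sh - Sig) \<le> C1 * nuc_norm (Sig - Sr) / sqrt (real r) + C2 * eps / real m}"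

end

theory Submission
  imports Defs
begin

text \<open>
  Write \<open>H\<close> for the difference between the minimiser and the true covariance. Since the minimiser has
  the smaller trace and both matrices are positive semidefinite, \<open>H\<close> pairs with every symmetric
  contraction to at most \<open>3 * sqrt r * \<parallel>H\<parallel>\<close> (Frobenius norm) plus twice the nuclear norm of the tail.
  So either the tail dominates and there is nothing to prove, or \<open>H\<close> has nuclear norm of order
  \<open>sqrt r * \<parallel>H\<parallel>\<close>, and it suffices to bound \<open>\<Sum>i. \<bar>a\<^sub>i\<^sup>T H a\<^sub>i\<bar>\<close> from below by a multiple of \<open>m * \<parallel>H\<parallel>\<close>
  uniformly over all such \<open>H\<close>.

  This is Mendelson's small-ball method. Replace the absolute value by its truncation \<open>\<psi>\<close>. The fourth
  moment of \<open>a\<^sup>T H a\<close> is bounded by the square of its second moment, which dominates \<open>\<parallel>H\<parallel>\<^sup>2\<close> because the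
  fourth moment of the entries exceeds \<open>1\<close>; hence \<open>\<psi> (a\<^sup>T H a)\<close> has expectation bounded below.
  The largest deviation of \<open>\<Sum>i. \<psi> (a\<^sub>i\<^sup>T H a\<^sub>i)\<close> below its mean concentrates at rate \<open>exp (- c m)\<close> because
  \<open>\<psi>\<close> is bounded, and symmetrisation and contraction bound its expectation by \<open>sqrt r\<close> times the
  expected operator norm of \<open>\<Sum>i. \<epsilon>\<^sub>i a\<^sub>i a\<^sub>i\<^sup>T\<close>, which a net argument shows to be of order \<open>sqrt (n m)\<close>.
\<close>

section \<open>Quadratic forms and the spectral theorem\<close>

text \<open>The form \<open>a^T H a\<close> is not centred: its second moment contains the squared
  trace of \<open>H\<close>, which may exceed the squared Frobenius norm by a factor
  \<open>n\<close>. Hence \<open>H\<close> is normalised by the second moment, and the Frobenius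
  norm is compared with it in one direction only. The diagonal entries enter that comparison with
  weight \<open>\<mu>4 - 1\<close>; for entries of modulus 1 the matrix diag(1, -1) would give the
  zero form. Truncating costs nothing, because a lower bound for the truncated sum is one for the
  sum of absolute values, and it supplies the bounded differences that the untruncated forms lack.
  All suprema are taken over finite classes, where they are measurable maxima. The bounds do not
  depend on the class, so they pass to a countable dense subset by continuity of the measure, and
  from there to the whole class because the sum is continuous in \<open>H\<close>. The countable
  intersection is the measurable event inside the recovery event. The supremum of the symmetrised
  process has order \<open>sqrt (r n m)\<close>; it must be a small fraction of \<open>m\<close>,
  and this is the condition that \<open>m\<close> exceed a multiple of \<open>n r\<close>.\<close>

definition ip :: "nat \<Rightarrow> (nat \<Rightarrow> real) \<Rightarrow> (nat \<Rightarrow> real) \<Rightarrow> real" where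
  "ip n x y = (\<Sum>i<n. x i * y i)"

text \<open>Vectors and matrices are functions on all of \<open>nat\<close>, of which only the
  entries below \<open>n\<close> count. This avoids carrier conditions, but an equation between
  vectors is available only at indices below \<open>n\<close>; hence the many uses of
  \<open>ip_cong\<close>.\<close>

definition mv :: "nat \<Rightarrow> (nat \<Rightarrow> nat \<Rightarrow> real) \<Rightarrow> (nat \<Rightarrow> real) \<Rightarrow> nat \<Rightarrow> real" where
  "mv n A x = (\<lambda>i. \<Sum>j<n. A i j * x j)"

definition mip :: "nat \<Rightarrow> (nat \<Rightarrow> nat \<Rightarrow> real) \<Rightarrow> (nat \<Rightarrow> nat \<Rightarrow> real) \<Rightarrow> real" where
  "mip n A B = (\<Sum>i<n. \<Sum>j<n. A i j * B i j)"

definition symm_on :: "nat \<Rightarrow> (nat \<Rightarrow> nat \<Rightarrow> real) \<Rightarrow> bool" where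
  "symm_on n A \<longleftrightarrow> (\<forall>i<n. \<forall>j<n. A i j = A j i)"

definition orthonormal :: "nat \<Rightarrow> nat set \<Rightarrow> (nat \<Rightarrow> nat \<Rightarrow> real) \<Rightarrow> bool" where
  "orthonormal n I u \<longleftrightarrow> (\<forall>a\<in>I. \<forall>b\<in>I. ip n (u a) (u b) = (if a = b then 1 else 0))"

lemma ip_commute: "ip n x y = ip n y x"
  by (simp add: ip_def mult.commute)

lemma ip_add_right: "ip n x (\<lambda>i. y i + z i) = ip n x y + ip n x z"
  by (simp add: ip_def algebra_simps sum.distrib)

lemma ip_diff_right: "ip n x (\<lambda>i. y i - z i) = ip n x y - ip n x z"
  by (simp add: ip_def algebra_simps sum_subtractf)

lemma ip_scale_right: "ip n x (\<lambda>i. c * y i) = c * ip n x y"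
  by (simp add: ip_def algebra_simps sum_distrib_left)

lemma ip_sum_right: "ip n x (\<lambda>i. \<Sum>a\<in>I. f a i) = (\<Sum>a\<in>I. ip n x (f a))"
  unfolding ip_def sum_distrib_left by (rule sum.swap)

lemma ip_add_left: "ip n (\<lambda>i. y i + z i) x = ip n y x + ip n z x"
  by (metis ip_commute ip_add_right)

lemma ip_diff_left: "ip n (\<lambda>i. y i - z i) x = ip n y x - ip n z x"
  by (metis ip_commute ip_diff_right)

lemma ip_scale_left: "ip n (\<lambda>i. c * y i) x = c * ip n y x"
  by (metis ip_commute ip_scale_right)

lemma ip_sum_left: "ip n (\<lambda>i. \<Sum>a\<in>I. f a i) x = (\<Sum>a\<in>I. ip n (f a) x)"
  by (subst ip_commute, subst ip_sum_right) (simp add: ip_commute)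

lemmas ip_linear = ip_add_right ip_diff_right ip_scale_right ip_sum_right
  ip_add_left ip_diff_left ip_scale_left ip_sum_left

lemma ip_cong: "(\<And>i. i < n \<Longrightarrow> x i = x' i) \<Longrightarrow> (\<And>i. i < n \<Longrightarrow> y i = y' i) \<Longrightarrow> ip n x y = ip n x' y'"
  by (simp add: ip_def)

lemma ip_self_nonneg: "0 \<le> ip n x x"
  by (simp add: ip_def sum_nonneg)

lemma ip_self_eq_0: "ip n x x = 0 \<longleftrightarrow> (\<forall>i<n. x i = 0)"
  unfolding ip_def by (subst sum_nonneg_eq_0_iff) auto

lemma ip_Cauchy_Schwarz: "(ip n x y)\<^sup>2 \<le> ip n x x * ip n y y"
  using Cauchy_Schwarz_ineq_sum[of x y "{..<n}"] by (simp add: ip_def power2_eq_square)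

lemma ip_le_norms: "\<bar>ip n x y\<bar> \<le> sqrt (ip n x x) * sqrt (ip n y y)"
  using real_sqrt_le_mono[OF ip_Cauchy_Schwarz[of n x y]] by (simp add: real_sqrt_mult)

lemma mv_add: "mv n A (\<lambda>i. x i + y i) = (\<lambda>i. mv n A x i + mv n A y i)"
  by (simp add: mv_def algebra_simps sum.distrib)

lemma mv_diff: "mv n A (\<lambda>i. x i - y i) = (\<lambda>i. mv n A x i - mv n A y i)"
  by (simp add: mv_def algebra_simps sum_subtractf)

lemma mv_scale: "mv n A (\<lambda>i. c * x i) = (\<lambda>i. c * mv n A x i)"
  by (simp add: mv_def algebra_simps sum_distrib_left)

lemma mv_sum: "mv n A (\<lambda>i. \<Sum>a\<in>I. f a i) = (\<lambda>i. \<Sum>a\<in>I. mv n A (f a) i)"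
  unfolding mv_def sum_distrib_left by (rule ext, rule sum.swap)

lemma ip_mv_transpose: "ip n x (mv n A y) = ip n (mv n (\<lambda>i j. A j i) x) y"
proof -
  have "ip n x (mv n A y) = (\<Sum>i<n. \<Sum>j<n. x i * (A i j * y j))"
    by (simp add: ip_def mv_def sum_distrib_left)
  also have "\<dots> = (\<Sum>j<n. \<Sum>i<n. x i * (A i j * y j))" by (rule sum.swap)
  also have "\<dots> = ip n (mv n (\<lambda>i j. A j i) x) y"
    unfolding ip_def mv_def sum_distrib_right by (intro sum.cong refl) (simp add: algebra_simps)
  finally show ?thesis .
qed

lemma ip_mv_symm: "symm_on n A \<Longrightarrow> ip n x (mv n A y) = ip n (mv n A x) y"
  unfolding ip_mv_transpose by (intro ip_cong refl) (simp add: mv_def symm_on_def)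

lemma quadratic_form_add:
  assumes "symm_on n A"
  shows "ip n (\<lambda>i. x i + y i) (mv n A (\<lambda>i. x i + y i)) =
    ip n x (mv n A x) + 2 * ip n x (mv n A y) + ip n y (mv n A y)"
  using ip_mv_symm[OF assms, of y x] ip_commute[of n "mv n A y" x]
  by (simp add: mv_add ip_linear)

section \<open>Orthonormal families: Bessel, completeness, Parseval\<close>

lemma orthonormal_expand:
  assumes "orthonormal n I u" "finite I" "b \<in> I"
  shows "ip n (u b) (\<lambda>i. \<Sum>a\<in>I. c a * u a i) = c b"
proof -
  have "ip n (u b) (\<lambda>i. \<Sum>a\<in>I. c a * u a i) = (\<Sum>a\<in>I. c a * ip n (u b) (u a))"
    by (simp add: ip_linear)
  also have "\<dots> = (\<Sum>a\<in>I. if a = b then c a else 0)"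
    using assms by (intro sum.cong refl) (auto simp: orthonormal_def)
  finally show ?thesis using assms by simp
qed

lemma orthonormal_norm:
  assumes "orthonormal n I u" "finite I"
  shows "ip n (\<lambda>i. \<Sum>a\<in>I. c a * u a i) (\<lambda>i. \<Sum>a\<in>I. c a * u a i) = (\<Sum>a\<in>I. (c a)\<^sup>2)"
proof -
  have "ip n (\<lambda>i. \<Sum>a\<in>I. c a * u a i) (\<lambda>i. \<Sum>a\<in>I. c a * u a i) =
     (\<Sum>b\<in>I. c b * ip n (u b) (\<lambda>i. \<Sum>a\<in>I. c a * u a i))"
    by (subst ip_sum_left) (simp add: ip_scale_left)
  also have "\<dots> = (\<Sum>b\<in>I. c b * c b)"
    using assms by (intro sum.cong refl) (simp add: orthonormal_expand)
  finally show ?thesis by (simp add: power2_eq_square)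
qed

text \<open>Pythagoras, with \<open>p x\<close> the projection of \<open>x\<close> onto the span.
  Nonnegativity of the residual is Bessel's inequality; its vanishing gives completeness.\<close>

lemma residual_norm:
  assumes "orthonormal n I u" "finite I"
  defines "p \<equiv> (\<lambda>x i. \<Sum>a\<in>I. ip n (u a) x * u a i)"
  shows "ip n (\<lambda>i. x i - p x i) (\<lambda>i. x i - p x i) = ip n x x - (\<Sum>a\<in>I. (ip n (u a) x)\<^sup>2)"
proof -
  have 1: "ip n (p x) (p x) = (\<Sum>a\<in>I. (ip n (u a) x)\<^sup>2)"
    unfolding p_def using assms(1,2) by (rule orthonormal_norm)
  have 2: "ip n (p x) x = (\<Sum>a\<in>I. (ip n (u a) x)\<^sup>2)"
    unfolding p_def by (subst ip_sum_left) (simp add: ip_scale_left power2_eq_square)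
  then have 3: "ip n x (p x) = (\<Sum>a\<in>I. (ip n (u a) x)\<^sup>2)" by (simp add: ip_commute)
  show ?thesis
    using 1 2 3 by (simp add: ip_diff_left ip_diff_right)
qed

lemma Bessel:
  assumes "orthonormal n I u" "finite I"
  shows "(\<Sum>a\<in>I. (ip n (u a) x)\<^sup>2) \<le> ip n x x"
  using residual_norm[OF assms, of x]
    ip_self_nonneg[of n "\<lambda>i. x i - (\<Sum>a\<in>I. ip n (u a) x * u a i)"] by linarith

abbreviation unit_fun :: "nat \<Rightarrow> nat \<Rightarrow> real" where
  "unit_fun i \<equiv> (\<lambda>j. if j = i then 1 else 0)"

lemma ip_unit_fun: "i < n \<Longrightarrow> ip n x (unit_fun i) = x i"
  by (simp add: ip_def if_distrib cong: if_cong)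

text \<open>Summing Bessel's inequality over the standard basis gives \<open>n \<le> n\<close>, so it is an equality
  for every standard basis vector.\<close>
lemma orthonormal_complete:
  assumes u: "orthonormal n {..<n} u" and "i < n" "j < n"
  shows "(\<Sum>a<n. u a i * u a j) = (if i = j then 1 else 0)"
proof -
  have le: "(\<Sum>a<n. (u a k)\<^sup>2) \<le> 1" if "k < n" for k
    using Bessel[OF u, of "unit_fun k"] that by (simp add: ip_unit_fun)
  have tot: "(\<Sum>k<n. \<Sum>a<n. (u a k)\<^sup>2) = real n"
  proof -
    have "(\<Sum>k<n. \<Sum>a<n. (u a k)\<^sup>2) = (\<Sum>a<n. ip n (u a) (u a))"
      unfolding ip_def by (subst sum.swap) (simp add: power2_eq_square)
    also have "\<dots> = (\<Sum>a<n. 1)"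
      using u by (intro sum.cong refl) (auto simp: orthonormal_def)
    finally show ?thesis by simp
  qed
  have "(\<Sum>k<n. 1 - (\<Sum>a<n. (u a k)\<^sup>2)) = 0"
    using tot by (simp add: sum_subtractf)
  then have "1 - (\<Sum>a<n. (u a i)\<^sup>2) = 0"
    using le \<open>i < n\<close> by (subst (asm) sum_nonneg_eq_0_iff) auto
  then have "ip n (\<lambda>j. unit_fun i j - (\<Sum>a<n. ip n (u a) (unit_fun i) * u a j))
      (\<lambda>j. unit_fun i j - (\<Sum>a<n. ip n (u a) (unit_fun i) * u a j)) = 0"
    using \<open>i < n\<close> by (subst residual_norm[OF u]) (auto simp: ip_unit_fun)
  then have "unit_fun i j - (\<Sum>a<n. ip n (u a) (unit_fun i) * u a j) = 0"
    using \<open>j < n\<close> unfolding ip_self_eq_0 by blast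
  then show ?thesis using \<open>i < n\<close> by (auto simp: ip_unit_fun split: if_splits)
qed

lemma Parseval:
  assumes "orthonormal n {..<n} u"
  shows "ip n x y = (\<Sum>a<n. ip n (u a) x * ip n (u a) y)"
proof -
  have "(\<Sum>a<n. ip n (u a) x * ip n (u a) y) = (\<Sum>a<n. \<Sum>i<n. \<Sum>j<n. (x i * y j) * (u a i * u a j))"
    unfolding ip_def sum_product by (intro sum.cong refl) (simp add: algebra_simps)
  also have "\<dots> = (\<Sum>i<n. \<Sum>a<n. \<Sum>j<n. (x i * y j) * (u a i * u a j))" by (rule sum.swap)
  also have "\<dots> = (\<Sum>i<n. \<Sum>j<n. \<Sum>a<n. (x i * y j) * (u a i * u a j))"
    by (rule sum.cong[OF refl], rule sum.swap)
  also have "\<dots> = (\<Sum>i<n. \<Sum>j<n. (x i * y j) * (if i = j then 1 else 0))"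
    by (intro sum.cong refl) (simp add: sum_distrib_left[symmetric] orthonormal_complete[OF assms])
  also have "\<dots> = ip n x y" by (simp add: ip_def if_distrib cong: if_cong)
  finally show ?thesis ..
qed

lemma orthonormal_expansion:
  assumes "orthonormal n {..<n} u" "i < n"
  shows "x i = (\<Sum>a<n. ip n (u a) x * u a i)"
  using Parseval[OF assms(1), of "unit_fun i" x] assms(2)
  by (simp add: ip_unit_fun ip_commute[of n "unit_fun i"] mult.commute)

lemma mip_Parseval:
  assumes "orthonormal n {..<n} u"
  shows "mip n A B = (\<Sum>b<n. ip n (mv n A (u b)) (mv n B (u b)))"
proof -
  have "mip n A B = (\<Sum>i<n. ip n (A i) (B i))" by (simp add: mip_def ip_def)
  also have "\<dots> = (\<Sum>i<n. \<Sum>b<n. ip n (u b) (A i) * ip n (u b) (B i))"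
    by (rule sum.cong[OF refl], rule Parseval[OF assms])
  also have "\<dots> = (\<Sum>b<n. \<Sum>i<n. ip n (u b) (A i) * ip n (u b) (B i))" by (rule sum.swap)
  also have "\<dots> = (\<Sum>b<n. ip n (mv n A (u b)) (mv n B (u b)))"
    by (simp add: ip_def mv_def mult.commute)
  finally show ?thesis .
qed

text \<open>Coordinates of both matrices in the basis \<open>u\<close>. Later the index square is
  cut into blocks adapted to a low-rank matrix.\<close>

lemma mip_Parseval2:
  assumes "orthonormal n {..<n} u"
  shows "mip n A B = (\<Sum>b<n. \<Sum>a<n. ip n (u a) (mv n A (u b)) * ip n (u a) (mv n B (u b)))"
  unfolding mip_Parseval[OF assms] by (rule sum.cong[OF refl], rule Parseval[OF assms])

lemma trace_orthonormal:
  assumes "orthonormal n {..<n} u"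
  shows "(\<Sum>i<n. A i i) = (\<Sum>a<n. ip n (u a) (mv n A (u a)))"
proof -
  have "(\<Sum>i<n. A i i) = mip n A (\<lambda>i j. if i = j then 1 else 0)"
    by (simp add: mip_def if_distrib cong: if_cong)
  also have "\<dots> = (\<Sum>a<n. ip n (mv n A (u a)) (mv n (\<lambda>i j. if i = j then 1 else 0) (u a)))"
    by (rule mip_Parseval[OF assms])
  also have "\<dots> = (\<Sum>a<n. ip n (mv n A (u a)) (u a))"
    by (rule sum.cong[OF refl], rule ip_cong)
       (simp_all add: mv_def if_distrib[of "\<lambda>x. x * _"] cong: if_cong)
  finally show ?thesis by (simp add: ip_commute)
qed

section \<open>The spectral theorem by maximising the Rayleigh quotient\<close>

lemma continuous_on_ip:
  assumes "continuous_on S f" "continuous_on S g"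
  shows "continuous_on S (\<lambda>x. ip n (f x) (g x))"
proof -
  have "continuous_on S (\<lambda>x. f x i)" "continuous_on S (\<lambda>x. g x i)" for i
    using assms by (auto intro: continuous_on_product_then_coordinatewise)
  then show ?thesis unfolding ip_def by (intro continuous_intros)
qed

lemma continuous_on_ip_mv:
  assumes "continuous_on S f" "continuous_on S g"
  shows "continuous_on S (\<lambda>x. ip n (f x) (mv n A (g x)))"
proof -
  have "continuous_on S (\<lambda>x. f x i)" "continuous_on S (\<lambda>x. g x i)" for i
    using assms by (auto intro: continuous_on_product_then_coordinatewise)
  then show ?thesis unfolding ip_def mv_def by (intro continuous_intros)
qed

text \<open>Tychonoff for the product topology on \<open>nat \<Rightarrow> real\<close>. It replaces
  compactness of the unit sphere, whose points can be chosen in this box.\<close>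

lemma compact_box_functions: "compact {x :: nat \<Rightarrow> real. \<forall>i. x i \<in> {-1..1}}"
proof -
  have "compactin (product_topology (\<lambda>_. euclidean) UNIV) (PiE UNIV (\<lambda>_::nat. {-1..1::real}))"
    unfolding compactin_PiE by simp
  then show ?thesis by (simp add: euclidean_product_topology PiE_def Pi_def)
qed

text \<open>The squared projections of the \<open>n\<close> standard basis vectors onto the span of
  the family sum to \<open>k < n\<close>, so one of them is shorter than 1. The residual of that
  basis vector is nonzero and can be normalised.\<close>

lemma exists_unit_orthogonal:
  assumes u: "orthonormal n {..<k} u" and "k < n"
  obtains x where "ip n x x = 1" "\<And>a. a < k \<Longrightarrow> ip n (u a) x = 0" "\<And>i. i \<ge> n \<Longrightarrow> x i = 0"
proof -
  have "\<exists>i<n. (\<Sum>a<k. (u a i)\<^sup>2) < 1"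
  proof (rule ccontr)
    assume "\<not> ?thesis"
    then have "(\<Sum>i<n. 1) \<le> (\<Sum>i<n. \<Sum>a<k. (u a i)\<^sup>2)" by (intro sum_mono) auto
    also have "\<dots> = (\<Sum>a<k. ip n (u a) (u a))"
      unfolding ip_def by (subst sum.swap) (simp add: power2_eq_square)
    also have "\<dots> = (\<Sum>a<k. 1)"
      using u by (intro sum.cong refl) (auto simp: orthonormal_def)
    finally show False using \<open>k < n\<close> by simp
  qed
  then obtain i where i: "i < n" "(\<Sum>a<k. (u a i)\<^sup>2) < 1" by blast
  define y where "y = (\<lambda>j. unit_fun i j - (\<Sum>a<k. ip n (u a) (unit_fun i) * u a j))"
  have yy: "ip n y y = 1 - (\<Sum>a<k. (u a i)\<^sup>2)"
    unfolding y_def using i by (subst residual_norm[OF u]) (auto simp: ip_unit_fun)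
  have uy: "ip n (u a) y = 0" if "a < k" for a
    unfolding y_def using that
    by (subst ip_diff_right, subst orthonormal_expand[OF u]) auto
  \<comment> \<open>Setting the entries beyond \<open>n\<close> to 0 puts the vector into the
    compact box.\<close>
  define x where "x = (\<lambda>j. if j < n then (1 / sqrt (ip n y y)) * y j else 0)"
  have x: "ip n z x = (1 / sqrt (ip n y y)) * ip n z y" for z
    unfolding ip_scale_right[symmetric] by (rule ip_cong) (auto simp: x_def)
  have "ip n x x = (1 / sqrt (ip n y y))\<^sup>2 * ip n y y"
    by (simp add: x ip_commute[of n x y] power2_eq_square)
  then have "ip n x x = 1" using yy i by (simp add: power_divide)
  then show thesis using that[of x] x uy by (simp add: x_def)
qed

text \<open>A maximiser of the Rayleigh quotient on the orthogonal complement of the eigenvectors found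
  so far is the next eigenvector.\<close>
lemma symmetric_eigenvectors_upto:
  assumes A: "symm_on n A" and "k \<le> n"
  shows "\<exists>u lam. orthonormal n {..<k} u \<and> (\<forall>a<k. \<forall>i<n. mv n A (u a) i = lam a * u a i)"
  using \<open>k \<le> n\<close>
proof (induction k)
  case 0
  show ?case by (simp add: orthonormal_def)
next
  case (Suc k)
  then obtain u lam where u: "orthonormal n {..<k} u"
    and eig: "\<And>a i. a < k \<Longrightarrow> i < n \<Longrightarrow> mv n A (u a) i = lam a * u a i" by auto
  define S where "S = {x :: nat \<Rightarrow> real. \<forall>i. x i \<in> {-1..1}} \<inter>
     ({x. ip n x x = 1} \<inter> (\<Inter>a\<in>{..<k}. {x. ip n (u a) x = 0}))"
  have "compact S"
    unfolding S_def
    by (intro compact_Int_closed compact_box_functions closed_Int closed_INT ballI closed_Collect_eq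
        continuous_on_ip continuous_on_id continuous_on_const)
  moreover obtain x0 where x0: "ip n x0 x0 = 1" "\<And>a. a < k \<Longrightarrow> ip n (u a) x0 = 0" "\<And>i. i \<ge> n \<Longrightarrow> x0 i = 0"
    using exists_unit_orthogonal[OF u] Suc.prems by auto
  have "x0 i \<in> {-1..1}" for i
  proof (cases "i < n")
    case True
    then have "(x0 i)\<^sup>2 \<le> ip n x0 x0"
      unfolding ip_def power2_eq_square by (intro member_le_sum) auto
    then show ?thesis using x0(1) by (simp add: abs_square_le_1 abs_le_iff)
  qed (use x0 in auto)
  then have "x0 \<in> S" using x0 by (auto simp: S_def)
  ultimately have "\<exists>x\<in>S. \<forall>y\<in>S. ip n y (mv n A y) \<le> ip n x (mv n A x)"
    by (intro continuous_attains_sup continuous_on_ip_mv continuous_on_id) auto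
  then obtain x where x: "x \<in> S" and max: "\<And>y. y \<in> S \<Longrightarrow> ip n y (mv n A y) \<le> ip n x (mv n A x)"
    by blast
  define l where "l = ip n x (mv n A x)"
  have xx: "ip n x x = 1" and ux: "\<And>a. a < k \<Longrightarrow> ip n (u a) x = 0"
    using x by (auto simp: S_def)
  have bound: "ip n y (mv n A y) \<le> l * ip n y y" if uy: "\<And>a. a < k \<Longrightarrow> ip n (u a) y = 0" for y
  proof (cases "ip n y y = 0")
    case True
    then have "\<forall>i<n. y i = 0" by (simp add: ip_self_eq_0)
    then have "ip n y (mv n A y) = 0" by (simp add: ip_def)
    then show ?thesis using True by simp
  next
    case False
    then have pos: "ip n y y > 0" using ip_self_nonneg[of n y] by linarith
    define c where "c = 1 / sqrt (ip n y y)"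
    define z where "z = (\<lambda>i. if i < n then c * y i else 0)"
    have cc: "c * c * ip n y y = 1"
      using pos by (simp add: c_def real_sqrt_mult_self field_simps)
    have iz: "ip n w z = c * ip n w y" for w
      unfolding ip_scale_right[symmetric] by (rule ip_cong) (auto simp: z_def)
    have zz: "ip n z z = 1" using cc by (simp add: iz ip_commute[of n z y])
    have mz: "mv n A z = (\<lambda>i. c * mv n A y i)"
      unfolding mv_scale[symmetric] by (simp add: mv_def z_def)
    have "(z i)\<^sup>2 \<le> 1" for i
    proof (cases "i < n")
      case True
      then have "(z i)\<^sup>2 \<le> ip n z z"
        unfolding ip_def power2_eq_square by (intro member_le_sum) auto
      then show ?thesis using zz by simp
    qed (simp add: z_def)
    then have "z \<in> S" using zz uy by (auto simp: S_def iz abs_square_le_1 abs_le_iff)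
    then have "ip n z (mv n A z) \<le> l" using max by (simp add: l_def)
    moreover have "ip n z (mv n A z) = c * c * ip n y (mv n A y)"
      by (simp add: mz ip_scale_right ip_commute[of n z] iz) (simp add: ip_commute)
    ultimately have "ip n y y * (c * c * ip n y (mv n A y)) \<le> ip n y y * l"
      using pos by simp
    moreover have "ip n y y * (c * c * ip n y (mv n A y)) = (c * c * ip n y y) * ip n y (mv n A y)"
      by (simp only: mult_ac)
    ultimately show ?thesis by (simp add: cc mult.commute)
  qed
  \<comment> \<open>The residual of the eigenvalue equation. It is orthogonal to \<open>x\<close>
    and to the earlier eigenvectors, so \<open>x + t * d\<close> is an admissible competitor for
    every \<open>t\<close>.\<close>
  define d where "d = (\<lambda>i. mv n A x i - l * x i)"
  have ud: "ip n (u a) d = 0" if "a < k" for a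
  proof -
    have "ip n (u a) (mv n A x) = ip n (mv n A (u a)) x" by (rule ip_mv_symm[OF A])
    also have "\<dots> = ip n (\<lambda>i. lam a * u a i) x" using eig[OF that] by (intro ip_cong) auto
    finally show ?thesis using ux[OF that] by (simp add: d_def ip_linear)
  qed
  have xd: "ip n x d = 0" by (simp add: d_def ip_linear xx l_def)
  have dA: "ip n d (mv n A x) = ip n d d"
  proof -
    have "ip n d d = ip n d (mv n A x) - l * ip n d x"
      by (subst (2) d_def) (simp add: ip_linear)
    then show ?thesis using xd by (simp add: ip_commute)
  qed
  have ineq: "2 * t * ip n d d \<le> t\<^sup>2 * (l * ip n d d - ip n d (mv n A d))" for t
  proof -
    have "ip n (\<lambda>i. x i + t * d i) (mv n A (\<lambda>i. x i + t * d i)) \<le>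
        l * ip n (\<lambda>i. x i + t * d i) (\<lambda>i. x i + t * d i)"
      by (rule bound) (simp add: ip_linear ux ud)
    moreover have "ip n (\<lambda>i. x i + t * d i) (mv n A (\<lambda>i. x i + t * d i)) =
        l + 2 * t * ip n d d + t\<^sup>2 * ip n d (mv n A d)"
      using dA ip_mv_symm[OF A, of x d]
      by (subst quadratic_form_add[OF A])
         (simp add: mv_scale ip_linear l_def power2_eq_square ip_commute[of n "mv n A x" d])
    moreover have "ip n (\<lambda>i. x i + t * d i) (\<lambda>i. x i + t * d i) = 1 + t\<^sup>2 * ip n d d"
      using xd by (simp add: ip_linear xx ip_commute[of n d x] power2_eq_square)
    ultimately show ?thesis by (simp add: algebra_simps)
  qed
  have "ip n d d = 0"
  proof (rule ccontr)
    assume "ip n d d \<noteq> 0"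
    then have pos: "ip n d d > 0" using ip_self_nonneg[of n d] by linarith
    \<comment> \<open>The first-order gain \<open>2 * t * ip n d d\<close> beats a quadratic loss
      for small \<open>t\<close>. Adding 1 keeps the denominator positive, and \<open>t\<close> is
      chosen so that the loss is half of the gain.\<close>
    define w where "w = \<bar>l * ip n d d - ip n d (mv n A d)\<bar> + 1"
    have w: "w > 0" by (simp add: w_def)
    define t where "t = ip n d d / w"
    have t: "t > 0" using pos w by (simp add: t_def)
    have "2 * t * ip n d d \<le> t\<^sup>2 * w"
      using ineq[of t] t by (smt (verit) mult_left_mono w_def zero_le_power2)
    also have "t\<^sup>2 * w = t * ip n d d" using w by (simp add: t_def power2_eq_square)
    finally show False using t pos by simp
  qed
  then have dz: "\<And>i. i < n \<Longrightarrow> mv n A x i = l * x i" by (simp add: ip_self_eq_0 d_def)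
  have xu: "\<And>a. a < k \<Longrightarrow> ip n x (u a) = 0" using ux by (simp add: ip_commute)
  define u' where "u' = u(k := x)"
  have "orthonormal n {..<Suc k} u'"
    unfolding orthonormal_def
  proof (intro ballI)
    fix a b assume ab: "a \<in> {..<Suc k}" "b \<in> {..<Suc k}"
    show "ip n (u' a) (u' b) = (if a = b then 1 else 0)"
      using ab u ux xu xx by (auto simp: u'_def orthonormal_def less_Suc_eq)
  qed
  moreover have "\<forall>a<Suc k. \<forall>i<n. mv n A (u' a) i = (lam(k := l)) a * u' a i"
    using dz eig by (auto simp: u'_def less_Suc_eq)
  ultimately show ?case by blast
qed

lemma symmetric_eigenbasis:
  assumes "symm_on n A"
  obtains u lam where "orthonormal n {..<n} u" "\<And>a i. a < n \<Longrightarrow> i < n \<Longrightarrow> mv n A (u a) i = lam a * u a i"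
  using symmetric_eigenvectors_upto[OF assms order_refl] by blast

section \<open>The nuclear norm\<close>

lemma mat_eq_on_basis:
  assumes "orthonormal n {..<n} y" "\<And>a i. a < n \<Longrightarrow> i < n \<Longrightarrow> mv n A (y a) i = mv n B (y a) i"
    and "i < n" "j < n"
  shows "A i j = B i j"
proof -
  have "M i j = (\<Sum>a<n. mv n M (y a) i * y a j)" for M :: "nat \<Rightarrow> nat \<Rightarrow> real"
    using orthonormal_expansion[OF assms(1,4), of "M i"] by (simp add: ip_def mv_def mult.commute)
  from this[of A] this[of B] show ?thesis using assms(2,3) by simp
qed

text \<open>Factor \<open>C\<^sup>2 - \<mu>\<close> as
  \<open>(C + sqrt \<mu>) (C - sqrt \<mu>)\<close>. The vector \<open>z = (C - sqrt \<mu>) y\<close>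
  would be an eigenvector of \<open>C\<close> for \<open>- sqrt \<mu>\<close>, so it vanishes for
  positive \<open>\<mu>\<close> by semidefiniteness. This yields uniqueness of the positive
  semidefinite root.\<close>

lemma psd_square_root_eigenvector:
  assumes C: "symm_on n C" "\<And>x. 0 \<le> ip n x (mv n C x)"
    and sq: "\<And>i. i < n \<Longrightarrow> mv n C (mv n C y) i = \<mu> * y i" and "0 \<le> \<mu>" and "i < n"
  shows "mv n C y i = sqrt \<mu> * y i"
proof (cases "\<mu> = 0")
  case True
  have "ip n (mv n C y) (mv n C y) = ip n y (mv n C (mv n C y))"
    by (simp add: ip_mv_symm[OF C(1)])
  also have "\<dots> = 0" using sq True by (simp add: ip_def)
  finally show ?thesis using True \<open>i < n\<close> by (simp add: ip_self_eq_0)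
next
  case False
  define z where "z = (\<lambda>i. mv n C y i - sqrt \<mu> * y i)"
  have "mv n C z i = - sqrt \<mu> * z i" if "i < n" for i
  proof -
    have "mv n C z i = \<mu> * y i - sqrt \<mu> * mv n C y i"
      unfolding z_def using sq[OF that] by (simp add: mv_diff mv_scale)
    moreover have "\<mu> * y i = sqrt \<mu> * (sqrt \<mu> * y i)"
      using \<open>0 \<le> \<mu>\<close> by (simp flip: mult.assoc)
    ultimately show ?thesis by (simp add: z_def algebra_simps)
  qed
  then have "ip n z (mv n C z) = ip n z (\<lambda>i. - sqrt \<mu> * z i)" by (intro ip_cong) auto
  then have "0 \<le> - sqrt \<mu> * ip n z z" using C(2)[of z] by (simp only: ip_scale_right)
  moreover have "sqrt \<mu> > 0" using False \<open>0 \<le> \<mu>\<close> by simp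
  ultimately have "ip n z z \<le> 0" by (simp add: mult_le_0_iff)
  then have "ip n z z = 0" using ip_self_nonneg[of n z] by linarith
  then show ?thesis using \<open>i < n\<close> by (simp add: ip_self_eq_0 z_def)
qed

section \<open>Matrices of type \<open>real mat\<close> and the operator
  \<open>mat_abs\<close>\<close>

abbreviation entries :: "real mat \<Rightarrow> nat \<Rightarrow> nat \<Rightarrow> real" where
  "entries A \<equiv> (\<lambda>i j. A $$ (i, j))"

lemma scalar_prod_mult_mat_vec:
  assumes "A \<in> carrier_mat n n"
  shows "scalar_prod (vec n x) (mult_mat_vec A (vec n x)) = ip n x (mv n (entries A) x)"
proof -
  have "scalar_prod (vec n x) (mult_mat_vec A (vec n x)) = (\<Sum>i<n. x i * (\<Sum>j<n. A $$ (i, j) * x j))"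
    using assms by (auto simp: scalar_prod_def lessThan_atLeast0 intro!: sum.cong)
  then show ?thesis by (simp add: ip_def mv_def)
qed

lemma psd_mat_entries:
  "psd_mat n A \<longleftrightarrow> A \<in> carrier_mat n n \<and> symm_on n (entries A) \<and> (\<forall>x. 0 \<le> ip n x (mv n (entries A) x))"
proof (cases "A \<in> carrier_mat n n")
  case True
  have "transpose_mat A = A \<longleftrightarrow> symm_on n (entries A)"
  proof
    assume "transpose_mat A = A"
    then show "symm_on n (entries A)"
      using True unfolding symm_on_def by (metis carrier_matD index_transpose_mat(1))
  next
    assume "symm_on n (entries A)"
    then show "transpose_mat A = A" using True by (intro eq_matI) (auto simp: symm_on_def)
  qed
  moreover have "(\<forall>x \<in> carrier_vec n. 0 \<le> scalar_prod x (mult_mat_vec A x)) \<longleftrightarrow>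
      (\<forall>x. 0 \<le> ip n x (mv n (entries A) x))" (is "?L \<longleftrightarrow> ?R")
  proof
    assume ?L
    then have "0 \<le> scalar_prod (vec n x) (mult_mat_vec A (vec n x))" for x by simp
    then show ?R using scalar_prod_mult_mat_vec[OF True] by simp
  next
    assume R: ?R
    show ?L
    proof
      fix x :: "real vec" assume "x \<in> carrier_vec n"
      then have "x = vec n (vec_index x)" by auto
      then show "0 \<le> scalar_prod x (mult_mat_vec A x)"
        using R scalar_prod_mult_mat_vec[OF True, of "vec_index x"] by metis
    qed
  qed
  ultimately show ?thesis using True by (simp add: psd_mat_def)
qed (simp add: psd_mat_def)

lemma mult_entries:
  assumes "A \<in> carrier_mat n n" "B \<in> carrier_mat n n" "i < n" "j < n"
  shows "(A * B) $$ (i, j) = (\<Sum>k<n. A $$ (i, k) * B $$ (k, j))"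
  using assms by (auto simp: scalar_prod_def lessThan_atLeast0 intro!: sum.cong)

lemma mv_mult_entries:
  assumes "A \<in> carrier_mat n n" "B \<in> carrier_mat n n" "i < n"
  shows "mv n (entries (A * B)) x i = mv n (entries A) (mv n (entries B) x) i"
proof -
  have "mv n (entries (A * B)) x i = (\<Sum>j<n. \<Sum>k<n. A $$ (i, k) * (B $$ (k, j) * x j))"
    unfolding mv_def using assms
    by (intro sum.cong refl)
       (simp add: mult_entries[OF assms(1-3)] sum_distrib_right mult.assoc del: index_mult_mat)
  also have "\<dots> = (\<Sum>k<n. \<Sum>j<n. A $$ (i, k) * (B $$ (k, j) * x j))" by (rule sum.swap)
  finally show ?thesis by (simp add: mv_def sum_distrib_left)
qed

text \<open>The \<open>y a\<close> are right singular vectors of \<open>N\<close> and the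
  \<open>\<mu> a\<close> its singular values, obtained from the spectral theorem for
  \<open>transpose_mat N * N\<close>. Because \<open>mat_abs\<close> is a definite description,
  existence of the root \<open>B\<close> has to be accompanied by uniqueness.\<close>

lemma mat_abs_eigenbasis:
  assumes N: "N \<in> carrier_mat n n"
  obtains y \<mu> where "orthonormal n {..<n} y" "\<And>a. a < n \<Longrightarrow> 0 \<le> \<mu> a" "mat_abs N \<in> carrier_mat n n"
    "\<And>a i. a < n \<Longrightarrow> i < n \<Longrightarrow> mv n (entries (mat_abs N)) (y a) i = \<mu> a * y a i"
    "\<And>a. a < n \<Longrightarrow> ip n (mv n (entries N) (y a)) (mv n (entries N) (y a)) = (\<mu> a)\<^sup>2"
proof -
  define G where "G = transpose_mat N * N"
  have NT: "transpose_mat N \<in> carrier_mat n n" using N by simp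
  have G: "G \<in> carrier_mat n n" using N by (simp add: G_def)
  have Gmv: "mv n (entries G) x i = mv n (\<lambda>i j. N $$ (j, i)) (mv n (entries N) x) i" if "i < n" for x i
    unfolding G_def mv_mult_entries[OF NT N that] using N that
    by (auto simp: mv_def intro!: sum.cong)
  have Gq: "ip n x (mv n (entries G) x) = ip n (mv n (entries N) x) (mv n (entries N) x)" for x
  proof -
    have "ip n x (mv n (entries G) x) = ip n x (mv n (\<lambda>i j. N $$ (j, i)) (mv n (entries N) x))"
      using Gmv by (intro ip_cong) auto
    then show ?thesis by (simp add: ip_mv_transpose)
  qed
  have "transpose_mat G = G"
    unfolding G_def using N by (simp add: transpose_mult[of _ n n _ n])
  then have "psd_mat n G"
    unfolding psd_mat_entries[of n G] using G Gq ip_self_nonneg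
    by (auto simp: symm_on_def) (metis G carrier_matD index_transpose_mat(1))
  then have Gs: "symm_on n (entries G)" by (simp add: psd_mat_entries)
  obtain y lam where y: "orthonormal n {..<n} y"
    and eig: "\<And>a i. a < n \<Longrightarrow> i < n \<Longrightarrow> mv n (entries G) (y a) i = lam a * y a i"
    using symmetric_eigenbasis[OF Gs] by blast
  have lam: "ip n (mv n (entries N) (y a)) (mv n (entries N) (y a)) = lam a" if "a < n" for a
  proof -
    have "ip n (y a) (mv n (entries G) (y a)) = ip n (y a) (\<lambda>i. lam a * y a i)"
      using eig[OF that] by (intro ip_cong) auto
    then show ?thesis using y that by (simp add: Gq ip_scale_right orthonormal_def)
  qed
  then have lam0: "0 \<le> lam a" if "a < n" for a using that ip_self_nonneg by metis
  define B where "B = mat n n (\<lambda>(i, j). \<Sum>a<n. sqrt (lam a) * y a i * y a j)"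
  have B: "B \<in> carrier_mat n n" by (simp add: B_def)
  have Bmv: "mv n (entries B) x i = (\<Sum>a<n. (sqrt (lam a) * ip n (y a) x) * y a i)" if "i < n" for x i
  proof -
    have "mv n (entries B) x i = (\<Sum>j<n. \<Sum>a<n. sqrt (lam a) * y a i * (y a j * x j))"
      unfolding mv_def using that
      by (intro sum.cong refl) (simp add: B_def sum_distrib_right mult.assoc)
    also have "\<dots> = (\<Sum>a<n. \<Sum>j<n. sqrt (lam a) * y a i * (y a j * x j))" by (rule sum.swap)
    also have "\<dots> = (\<Sum>a<n. (sqrt (lam a) * ip n (y a) x) * y a i)"
      unfolding ip_def sum_distrib_left sum_distrib_right by (intro sum.cong refl) (simp add: mult_ac)
    finally show ?thesis .
  qed
  have Beig: "mv n (entries B) (y a) i = sqrt (lam a) * y a i" if "a < n" "i < n" for a i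
  proof -
    have "mv n (entries B) (y a) i = (\<Sum>b<n. if b = a then sqrt (lam b) * y b i else 0)"
      unfolding Bmv[OF that(2)] using y that by (intro sum.cong refl) (auto simp: orthonormal_def)
    then show ?thesis using that by simp
  qed
  have Bpsd: "psd_mat n B"
    unfolding psd_mat_entries
  proof (intro conjI allI B)
    show "symm_on n (entries B)"
      unfolding symm_on_def by (auto simp: B_def intro!: sum.cong)
    fix x
    have "ip n x (mv n (entries B) x) = ip n x (\<lambda>i. \<Sum>a<n. (sqrt (lam a) * ip n (y a) x) * y a i)"
      using Bmv by (intro ip_cong) auto
    also have "\<dots> = (\<Sum>a<n. sqrt (lam a) * (ip n (y a) x)\<^sup>2)"
      unfolding ip_sum_right ip_scale_right
      by (intro sum.cong refl) (simp add: ip_commute[of n x "y _"] power2_eq_square mult.assoc)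
    also have "\<dots> \<ge> 0" using lam0 by (intro sum_nonneg) auto
    finally show "0 \<le> ip n x (mv n (entries B) x)" .
  qed
  have BB: "B * B = G"
  proof (rule eq_matI)
    fix i j assume ij: "i < dim_row G" "j < dim_col G"
    have "mv n (entries (B * B)) (y a) k = mv n (entries G) (y a) k" if "a < n" "k < n" for a k
    proof -
      have "mv n (entries B) (mv n (entries B) (y a)) k = mv n (entries B) (\<lambda>i. sqrt (lam a) * y a i) k"
        unfolding mv_def[of n "entries B" "mv _ _ _"] mv_def[of n "entries B" "\<lambda>i. _ * y a i"]
        using Beig[OF that(1)] by (intro sum.cong) auto
      then show ?thesis
        using that Beig lam0[of a] eig by (simp add: mv_mult_entries[OF B B] mv_scale)
    qed
    then show "(B * B) $$ (i, j) = G $$ (i, j)"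
      using mat_eq_on_basis[OF y, of "entries (B * B)" "entries G" i j] ij G by auto
  qed (use B G in auto)
  \<comment> \<open>Any other root has the same eigenvalues on the basis \<open>y\<close>, hence the
    same entries.\<close>
  have uniq: "C = B" if C: "psd_mat n C" "C * C = G" for C
  proof -
    have Cc: "C \<in> carrier_mat n n" using C by (simp add: psd_mat_def)
    have "mv n (entries C) (y a) i = sqrt (lam a) * y a i" if "a < n" "i < n" for a i
    proof (rule psd_square_root_eigenvector[OF _ _ _ lam0[OF that(1)] that(2)])
      show "symm_on n (entries C)" "0 \<le> ip n x (mv n (entries C) x)" for x
        using C(1) by (simp_all add: psd_mat_entries)
      show "mv n (entries C) (mv n (entries C) (y a)) k = lam a * y a k" if "k < n" for k
        using eig[OF \<open>a < n\<close> that] by (simp add: C(2)[symmetric] mv_mult_entries[OF Cc Cc that])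
    qed
    then show "C = B"
      using mat_eq_on_basis[OF y, of "entries C" "entries B"] Beig Cc B by (intro eq_matI) auto
  qed
  have "mat_abs N = B"
  proof -
    have "mat_abs N = (THE C. psd_mat n C \<and> C * C = G)" using N by (simp add: mat_abs_def G_def)
    also have "\<dots> = B" by (rule the_equality) (use Bpsd BB uniq in blast)+
    finally show ?thesis .
  qed
  then show thesis
    using that[of y "\<lambda>a. sqrt (lam a)"] y lam0 lam Beig B by simp
qed

text \<open>One half of trace duality. Each quadratic form is expanded in the singular basis
  \<open>y\<close>; for a fixed singular vector, Cauchy-Schwarz over \<open>I\<close> followed by
  Bessel for \<open>N y j\<close> and for \<open>y j\<close> leaves at most the singular value
  \<open>\<mu> j\<close>.\<close>

lemma sum_quadratic_le_nuc_norm: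
  assumes N: "N \<in> carrier_mat n n" and u: "orthonormal n I u" "finite I"
  shows "(\<Sum>a\<in>I. ip n (u a) (mv n (entries N) (u a))) \<le> nuc_norm N"
proof -
  obtain y \<mu> where y: "orthonormal n {..<n} y" and mu0: "\<And>a. a < n \<Longrightarrow> 0 \<le> \<mu> a"
    and abs: "mat_abs N \<in> carrier_mat n n"
    and eig: "\<And>a i. a < n \<Longrightarrow> i < n \<Longrightarrow> mv n (entries (mat_abs N)) (y a) i = \<mu> a * y a i"
    and norm: "\<And>a. a < n \<Longrightarrow> ip n (mv n (entries N) (y a)) (mv n (entries N) (y a)) = (\<mu> a)\<^sup>2"
    by (rule mat_abs_eigenbasis[OF N], rule that)
  have nuc: "nuc_norm N = (\<Sum>j<n. \<mu> j)"
  proof -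
    have "nuc_norm N = (\<Sum>i<n. entries (mat_abs N) i i)"
      using abs by (simp add: nuc_norm_def mtrace_def)
    also have "\<dots> = (\<Sum>j<n. ip n (y j) (mv n (entries (mat_abs N)) (y j)))"
      by (rule trace_orthonormal[OF y])
    also have "\<dots> = (\<Sum>j<n. ip n (y j) (\<lambda>i. \<mu> j * y j i))"
      using eig by (intro sum.cong refl ip_cong) auto
    also have "\<dots> = (\<Sum>j<n. \<mu> j)"
      using y by (intro sum.cong refl) (auto simp: ip_scale_right orthonormal_def)
    finally show ?thesis .
  qed
  have "(\<Sum>a\<in>I. ip n (u a) (mv n (entries N) (u a))) =
      (\<Sum>a\<in>I. \<Sum>j<n. ip n (u a) (mv n (entries N) (y j)) * ip n (u a) (y j))"
  proof (rule sum.cong[OF refl])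
    fix a
    have "ip n (u a) (mv n (entries N) (u a)) = ip n (mv n (\<lambda>i j. N $$ (j, i)) (u a)) (u a)"
      by (rule ip_mv_transpose)
    also have "\<dots> = (\<Sum>j<n. ip n (y j) (mv n (\<lambda>i j. N $$ (j, i)) (u a)) * ip n (y j) (u a))"
      by (rule Parseval[OF y])
    also have "\<dots> = (\<Sum>j<n. ip n (u a) (mv n (entries N) (y j)) * ip n (u a) (y j))"
    proof (rule sum.cong[OF refl])
      fix j
      have "ip n (y j) (mv n (\<lambda>i j. N $$ (j, i)) (u a)) = ip n (u a) (mv n (entries N) (y j))"
        using ip_mv_transpose[of n "u a" "entries N" "y j"] by (simp only: ip_commute)
      then show "ip n (y j) (mv n (\<lambda>i j. N $$ (j, i)) (u a)) * ip n (y j) (u a) =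
          ip n (u a) (mv n (entries N) (y j)) * ip n (u a) (y j)"
        by (simp only: ip_commute[of n "y j" "u a"])
    qed
    finally show "ip n (u a) (mv n (entries N) (u a)) =
       (\<Sum>j<n. ip n (u a) (mv n (entries N) (y j)) * ip n (u a) (y j))" .
  qed
  also have "\<dots> = (\<Sum>j<n. \<Sum>a\<in>I. ip n (u a) (mv n (entries N) (y j)) * ip n (u a) (y j))"
    by (rule sum.swap)
  also have "\<dots> \<le> (\<Sum>j<n. \<mu> j)"
  proof (rule sum_mono)
    fix j assume j: "j \<in> {..<n}"
    let ?s = "\<Sum>a\<in>I. ip n (u a) (mv n (entries N) (y j)) * ip n (u a) (y j)"
    have "?s\<^sup>2 \<le> (\<Sum>a\<in>I. (ip n (u a) (mv n (entries N) (y j)))\<^sup>2) * (\<Sum>a\<in>I. (ip n (u a) (y j))\<^sup>2)"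
      by (rule Cauchy_Schwarz_ineq_sum)
    also have "\<dots> \<le> (\<mu> j)\<^sup>2 * 1"
      using Bessel[OF u, of "mv n (entries N) (y j)"] Bessel[OF u, of "y j"] norm[of j] j y
      by (intro mult_mono) (auto simp: orthonormal_def sum_nonneg)
    finally have "?s\<^sup>2 \<le> (\<mu> j)\<^sup>2" by simp
    then show "?s \<le> \<mu> j" using mu0[of j] j by (auto intro: power2_le_imp_le)
  qed
  finally show ?thesis by (simp add: nuc)
qed

text \<open>Polarisation: the difference of the form at \<open>x + y\<close> and
  \<open>x - y\<close> is four times the bilinear form, and the parallelogram law bounds the two
  values together.\<close>

lemma quadratic_form_bound_bilinear:
  assumes W: "symm_on n W" and M: "\<And>x. \<bar>ip n x (mv n W x)\<bar> \<le> M * ip n x x"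
  shows "\<bar>ip n x (mv n W y)\<bar> \<le> M * (sqrt (ip n x x) * sqrt (ip n y y))"
proof (cases "ip n x x = 0 \<or> ip n y y = 0")
  case True
  then have "(\<forall>i<n. x i = 0) \<or> (\<forall>i<n. y i = 0)" by (simp add: ip_self_eq_0)
  then have "ip n x (mv n W y) = 0" by (auto simp: ip_def mv_def)
  then show ?thesis using True by auto
next
  case False
  have half: "2 * \<bar>ip n x (mv n W y)\<bar> \<le> M * (ip n x x + ip n y y)" for x y
  proof -
    have "\<bar>ip n (\<lambda>i. x i + y i) (mv n W (\<lambda>i. x i + y i))\<bar> \<le> M * (ip n x x + 2 * ip n x y + ip n y y)"
      using M[of "\<lambda>i. x i + y i"] by (simp add: ip_linear ip_commute[of n y x] algebra_simps)
    moreover have "\<bar>ip n (\<lambda>i. x i + (-1) * y i) (mv n W (\<lambda>i. x i + (-1) * y i))\<bar> \<le>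
        M * (ip n x x - 2 * ip n x y + ip n y y)"
      using M[of "\<lambda>i. x i + (-1) * y i"]
      unfolding ip_add_left ip_add_right ip_scale_left ip_scale_right
      by (simp add: ip_commute[of n y x] algebra_simps)
    moreover have "ip n (\<lambda>i. x i + y i) (mv n W (\<lambda>i. x i + y i)) -
        ip n (\<lambda>i. x i + (-1) * y i) (mv n W (\<lambda>i. x i + (-1) * y i)) = 4 * ip n x (mv n W y)"
      unfolding quadratic_form_add[OF W] mv_scale ip_scale_right ip_scale_left by simp
    ultimately show ?thesis by (simp add: abs_if algebra_simps split: if_splits)
  qed
  define s where "s = sqrt (ip n x x)"
  define t where "t = sqrt (ip n y y)"
  have st: "s > 0" "t > 0"
    using False ip_self_nonneg[of n x] ip_self_nonneg[of n y] by (auto simp: s_def t_def)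
  have sq: "ip n x x = s * s" "ip n y y = t * t"
    using ip_self_nonneg by (simp_all add: s_def t_def)
  \<comment> \<open>At unit vectors the sum of squared norms in \<open>half\<close> equals 2;
    homogeneity then restores the product of the norms.\<close>
  have "2 * \<bar>ip n (\<lambda>i. (1/s) * x i) (mv n W (\<lambda>i. (1/t) * y i))\<bar> \<le> M * 2"
    using half[of "\<lambda>i. (1/s) * x i" "\<lambda>i. (1/t) * y i"] st
    unfolding ip_scale_left ip_scale_right by (simp add: sq)
  then have "\<bar>(1/s) * ((1/t) * ip n x (mv n W y))\<bar> \<le> M"
    unfolding mv_scale ip_scale_left ip_scale_right by simp
  then have "\<bar>ip n x (mv n W y)\<bar> / (s * t) \<le> M" using st by (simp add: abs_mult)
  then show ?thesis using st by (simp add: s_def[symmetric] t_def[symmetric] field_simps)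
qed

text \<open>Trace duality for the compression of \<open>S\<close> to the span of the
  \<open>u a\<close>. Writing \<open>S\<close> as the sum of \<open>\<mu> j\<close> times the
  projection onto \<open>y j\<close>, the left side becomes a combination of quadratic forms of
  \<open>W\<close> with nonnegative coefficients. For a positive semidefinite block the nuclear norm
  is the trace, so the trace comparison of the minimiser can be used.\<close>

lemma psd_contraction_le_trace:
  assumes S: "symm_on n S" "\<And>x. 0 \<le> ip n x (mv n S x)"
    and W: "\<And>x. \<bar>ip n x (mv n W x)\<bar> \<le> ip n x x"
    and u: "orthonormal n I u" "finite I"
  shows "\<bar>\<Sum>a\<in>I. \<Sum>b\<in>I. ip n (u a) (mv n W (u b)) * ip n (u a) (mv n S (u b))\<bar> \<le>
    (\<Sum>a\<in>I. ip n (u a) (mv n S (u a)))"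
proof -
  obtain y \<mu> where y: "orthonormal n {..<n} y"
    and eig: "\<And>a i. a < n \<Longrightarrow> i < n \<Longrightarrow> mv n S (y a) i = \<mu> a * y a i"
    using symmetric_eigenbasis[OF S(1)] by blast
  have Sy: "ip n (y j) (mv n S q) = \<mu> j * ip n (y j) q" if "j < n" for j q
  proof -
    have "ip n (y j) (mv n S q) = ip n (\<lambda>i. \<mu> j * y j i) q"
      unfolding ip_mv_symm[OF S(1)] using eig[OF that] by (intro ip_cong) auto
    then show ?thesis by (simp add: ip_scale_left)
  qed
  have mu0: "0 \<le> \<mu> j" if "j < n" for j
    using S(2)[of "y j"] Sy[OF that, of "y j"] y that by (simp add: orthonormal_def)
  have S_eq: "ip n p (mv n S q) = (\<Sum>j<n. \<mu> j * (ip n (y j) p * ip n (y j) q))" for p q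
    unfolding Parseval[OF y, of p "mv n S q"] using Sy by (intro sum.cong refl) (simp add: algebra_simps)
  \<comment> \<open>The projection of the eigenvector \<open>y j\<close> onto the span of the
    \<open>u a\<close>.\<close>
  define q where "q = (\<lambda>j i. \<Sum>a\<in>I. ip n (y j) (u a) * u a i)"
  have qq: "ip n (q j) (q j) = (\<Sum>a\<in>I. (ip n (y j) (u a))\<^sup>2)" for j
    unfolding q_def by (rule orthonormal_norm[OF u])
  have qW: "ip n (q j) (mv n W (q j)) =
      (\<Sum>a\<in>I. \<Sum>b\<in>I. ip n (u a) (mv n W (u b)) * (ip n (y j) (u a) * ip n (y j) (u b)))" for j
    unfolding q_def mv_sum mv_scale ip_sum_left ip_sum_right ip_scale_left ip_scale_right sum_distrib_left
    by (intro sum.cong refl) (simp add: algebra_simps)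
  have "(\<Sum>a\<in>I. \<Sum>b\<in>I. ip n (u a) (mv n W (u b)) * ip n (u a) (mv n S (u b))) =
      (\<Sum>a\<in>I. \<Sum>b\<in>I. \<Sum>j<n. \<mu> j * (ip n (u a) (mv n W (u b)) * (ip n (y j) (u a) * ip n (y j) (u b))))"
    unfolding S_eq sum_distrib_left by (intro sum.cong refl) (simp add: algebra_simps)
  also have "\<dots> = (\<Sum>a\<in>I. \<Sum>j<n. \<Sum>b\<in>I. \<mu> j * (ip n (u a) (mv n W (u b)) * (ip n (y j) (u a) * ip n (y j) (u b))))"
    by (rule sum.cong[OF refl], rule sum.swap)
  also have "\<dots> = (\<Sum>j<n. \<Sum>a\<in>I. \<Sum>b\<in>I. \<mu> j * (ip n (u a) (mv n W (u b)) * (ip n (y j) (u a) * ip n (y j) (u b))))"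
    by (rule sum.swap)
  also have "\<dots> = (\<Sum>j<n. \<mu> j * ip n (q j) (mv n W (q j)))"
    by (simp add: qW sum_distrib_left)
  finally have 1: "(\<Sum>a\<in>I. \<Sum>b\<in>I. ip n (u a) (mv n W (u b)) * ip n (u a) (mv n S (u b))) =
      (\<Sum>j<n. \<mu> j * ip n (q j) (mv n W (q j)))" .
  have "\<bar>\<Sum>j<n. \<mu> j * ip n (q j) (mv n W (q j))\<bar> \<le> (\<Sum>j<n. \<bar>\<mu> j * ip n (q j) (mv n W (q j))\<bar>)"
    by (rule sum_abs)
  also have "\<dots> \<le> (\<Sum>j<n. \<mu> j * ip n (q j) (q j))"
    using mu0 W by (intro sum_mono) (auto simp: abs_mult intro!: mult_left_mono)
  also have "\<dots> = (\<Sum>j<n. \<Sum>a\<in>I. \<mu> j * (ip n (y j) (u a) * ip n (y j) (u a)))"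
    by (simp add: qq sum_distrib_left power2_eq_square)
  also have "\<dots> = (\<Sum>a\<in>I. ip n (u a) (mv n S (u a)))"
    unfolding S_eq by (rule sum.swap)
  finally show ?thesis unfolding 1 .
qed

section \<open>The error of the minimiser\<close>

text \<open>An eigenbasis of \<open>S\<close> times its transpose. Eigenvectors with eigenvalue 0
  are annihilated by the transpose; the others lie in the column space, so there are at most rank
  many of them.\<close>

lemma low_rank_left_kernel_basis:
  assumes S: "S \<in> carrier_mat n n" and r: "mat_rank S \<le> r"
  obtains u A where "orthonormal n {..<n} u" "A \<subseteq> {..<n}" "card A \<le> r"
    "\<And>a i. a \<in> {..<n} - A \<Longrightarrow> i < n \<Longrightarrow> mv n (\<lambda>i j. S $$ (j, i)) (u a) i = 0"
proof -
  interpret vec_space "TYPE(real)" n .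
  define ST where "ST = (\<lambda>i j. S $$ (j, i))"
  define G where "G = (\<lambda>i j. \<Sum>k<n. S $$ (i, k) * S $$ (j, k))"
  have Gmv: "mv n G x i = mv n (entries S) (mv n ST x) i" for x i
  proof -
    have "mv n G x i = (\<Sum>j<n. \<Sum>k<n. S $$ (i, k) * (S $$ (j, k) * x j))"
      by (simp add: mv_def G_def sum_distrib_right mult.assoc)
    also have "\<dots> = (\<Sum>k<n. \<Sum>j<n. S $$ (i, k) * (S $$ (j, k) * x j))" by (rule sum.swap)
    finally show ?thesis by (simp add: mv_def ST_def sum_distrib_left)
  qed
  have "symm_on n G" by (auto simp: symm_on_def G_def mult.commute)
  then obtain u lam where u: "orthonormal n {..<n} u"
    and eig: "\<And>a i. a < n \<Longrightarrow> i < n \<Longrightarrow> mv n G (u a) i = lam a * u a i"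
    using symmetric_eigenbasis by blast
  define A where "A = {a \<in> {..<n}. lam a \<noteq> 0}"
  have kernel: "mv n ST (u a) i = 0" if "a \<in> {..<n} - A" "i < n" for a i
  proof -
    have "ip n (mv n ST (u a)) (mv n ST (u a)) = ip n (u a) (mv n (entries S) (mv n ST (u a)))"
      unfolding ip_mv_transpose[of n "u a" "entries S"] by (simp add: ST_def)
    also have "\<dots> = ip n (u a) (mv n G (u a))" by (simp add: ip_def Gmv)
    also have "\<dots> = 0" using eig[of a] that by (auto simp: ip_def A_def)
    finally show ?thesis using that by (simp add: ip_self_eq_0)
  qed
  define f where "f = (\<lambda>a. vec n (u a))"
  have cols: "set (cols S) \<subseteq> carrier_vec n" using cols_dim[of S] S by auto
  have in_span: "f a \<in> span (set (cols S))" if "a \<in> A" for a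
  proof -
    have an: "a < n" and l: "lam a \<noteq> 0" using that by (auto simp: A_def)
    \<comment> \<open>The coefficients with \<open>u a = S w\<close>: apply \<open>S\<close> and use
      that \<open>u a\<close> is an eigenvector of \<open>G\<close>. \<open>part\<close> puts the
      partial sums of this combination of columns into the span, column by column.\<close>
    define w where "w = (\<lambda>j. mv n ST (u a) j / lam a)"
    have part: "vec n (\<lambda>i. \<Sum>j<k. S $$ (i, j) * w j) \<in> span (set (cols S))" if "k \<le> n" for k
      using that
    proof (induction k)
      case 0
      have "vec n (\<lambda>i. \<Sum>j<0. S $$ (i, j) * w j) = 0\<^sub>v n" by auto
      moreover have "0\<^sub>v n \<in> span (set (cols S))"
        using submodule.zero_closed[OF span_is_submodule[OF cols]] by simp
      ultimately show ?case by simp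
    next
      case (Suc k)
      have "col S k \<in> span (set (cols S))"
        using Suc.prems S cols by (intro span_mem) (auto simp: cols_def)
      then have "w k \<cdot>\<^sub>v col S k \<in> span (set (cols S))" using cols by (intro smult_in_span) auto
      then have "vec n (\<lambda>i. \<Sum>j<k. S $$ (i, j) * w j) + w k \<cdot>\<^sub>v col S k \<in> span (set (cols S))"
        using Suc cols by (intro span_add1) auto
      moreover have "vec n (\<lambda>i. \<Sum>j<k. S $$ (i, j) * w j) + w k \<cdot>\<^sub>v col S k =
          vec n (\<lambda>i. \<Sum>j<Suc k. S $$ (i, j) * w j)"
        using Suc.prems S by (intro eq_vecI) auto
      ultimately show ?case by simp
    qed
    have "f a = vec n (\<lambda>i. \<Sum>j<n. S $$ (i, j) * w j)"
    proof (rule eq_vecI)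
      fix i assume "i < dim_vec (vec n (\<lambda>i. \<Sum>j<n. S $$ (i, j) * w j))"
      then have i: "i < n" by simp
      have "(\<Sum>j<n. S $$ (i, j) * w j) = mv n G (u a) i / lam a"
        unfolding Gmv mv_def[of n "entries S"] sum_divide_distrib by (simp add: w_def)
      then show "f a $ i = vec n (\<lambda>i. \<Sum>j<n. S $$ (i, j) * w j) $ i"
        using eig[OF an i] l i by (simp add: f_def)
    qed (simp add: f_def)
    then show ?thesis using part[of n] by simp
  qed
  have ipf: "ip n (u b) (\<lambda>i. f a $ i) = (if a = b then 1 else 0)" if "a \<in> A" "b \<in> A" for a b
  proof -
    have "ip n (u b) (\<lambda>i. f a $ i) = ip n (u b) (u a)" by (rule ip_cong) (auto simp: f_def)
    then show ?thesis using u that by (auto simp: orthonormal_def A_def)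
  qed
  have inj: "inj_on f A"
  proof (rule inj_onI)
    fix a b assume ab: "a \<in> A" "b \<in> A" "f a = f b"
    then show "a = b" using ipf[of a b] ipf[of b b] by (auto split: if_splits)
  qed
  have finA: "finite A" by (simp add: A_def)
  have li: "lin_indpt (f ` A)"
  proof (rule finite_lin_indpt2)
    show "finite (f ` A)" "f ` A \<subseteq> carrier_vec n" using finA by (auto simp: f_def)
    fix c :: "real vec \<Rightarrow> real" assume lc: "lincomb c (f ` A) = 0\<^sub>v n"
    show "\<forall>v\<in>f ` A. c v = 0"
    proof
      fix v assume "v \<in> f ` A"
      then obtain b where b: "b \<in> A" "v = f b" by blast
      \<comment> \<open>Pairing the vanishing combination with \<open>u b\<close> isolates the
        coefficient of \<open>f b\<close>.\<close>
      have "0 = ip n (u b) (\<lambda>i. lincomb c (f ` A) $ i)" using lc by (simp add: ip_def)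
      also have "\<dots> = ip n (u b) (\<lambda>i. \<Sum>a\<in>A. c (f a) * f a $ i)"
      proof (rule ip_cong)
        fix i assume "i < n"
        then have "lincomb c (f ` A) $ i = (\<Sum>x\<in>f ` A. c x * x $ i)"
          by (intro lincomb_index) (auto simp: f_def)
        then show "lincomb c (f ` A) $ i = (\<Sum>a\<in>A. c (f a) * f a $ i)"
          by (simp add: sum.reindex[OF inj])
      qed simp
      also have "\<dots> = (\<Sum>a\<in>A. c (f a) * ip n (u b) (\<lambda>i. f a $ i))"
        unfolding ip_sum_right ip_scale_right ..
      also have "\<dots> = (\<Sum>a\<in>A. if a = b then c (f a) else 0)"
        using b by (intro sum.cong refl) (simp add: ipf)
      finally show "c v = 0" using b finA by simp
    qed
  qed
  have sub: "subspace class_ring (span (set (cols S))) V" using cols by (rule span_is_subspace)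
  have "\<not> module.lin_dep class_ring (vs (span (set (cols S)))) (f ` A)"
    using span_li_not_depend(2)[of "f ` A" "span (set (cols S))"] in_span li span_is_submodule[OF cols]
    by auto
  then have "card (f ` A) \<le> vectorspace.dim class_ring (vs (span (set (cols S))))"
    using in_span
    by (intro vectorspace.li_le_dim(2)[OF subspace_is_vs[OF sub] fin_dim_span_cols[OF S]]) auto
  then have "card A \<le> rank S" by (simp add: card_image[OF inj] rank_def)
  then have "card A \<le> r" using r S by (simp add: mat_rank_def)
  moreover have "A \<subseteq> {..<n}" by (auto simp: A_def)
  ultimately show thesis using that[of u A] u kernel by (simp add: ST_def)
qed

lemma sum_product_le_sqrt:
  fixes w h :: "'a \<Rightarrow> real"
  assumes "(\<Sum>p\<in>P. (w p)\<^sup>2) \<le> c" "(\<Sum>p\<in>P. (h p)\<^sup>2) \<le> d"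
  shows "(\<Sum>p\<in>P. w p * h p) \<le> sqrt c * sqrt d"
proof -
  have "(\<Sum>p\<in>P. w p * h p)\<^sup>2 \<le> (\<Sum>p\<in>P. (w p)\<^sup>2) * (\<Sum>p\<in>P. (h p)\<^sup>2)" by (rule Cauchy_Schwarz_ineq_sum)
  also have "\<dots> \<le> c * d"
    using assms order_trans[OF sum_nonneg assms(1)] by (intro mult_mono) (auto simp: sum_nonneg)
  finally have "\<bar>\<Sum>p\<in>P. w p * h p\<bar> \<le> sqrt (c * d)" using real_le_rsqrt by fastforce
  then show ?thesis by (simp add: real_sqrt_mult)
qed

text \<open>The trace comparison turns the part of \<open>H\<close> outside the tangent space at a rank \<open>r\<close> matrix
  into the tail of \<open>Sig\<close> plus a term already controlled by the Frobenius norm of \<open>H\<close>.\<close>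
lemma trace_descent_dual_bound:
  fixes Sig Sh :: "nat \<Rightarrow> nat \<Rightarrow> real"
  defines "H \<equiv> (\<lambda>i j. Sh i j - Sig i j)"
  assumes Sig: "symm_on n Sig" "\<And>x. 0 \<le> ip n x (mv n Sig x)"
    and Sh: "symm_on n Sh" "\<And>x. 0 \<le> ip n x (mv n Sh x)"
    and tr: "(\<Sum>i<n. Sh i i) \<le> (\<Sum>i<n. Sig i i)"
    and u: "orthonormal n {..<n} u" and A: "A \<subseteq> {..<n}" "card A \<le> r"
    and W: "symm_on n W" "\<And>x. \<bar>ip n x (mv n W x)\<bar> \<le> ip n x x"
  shows "mip n W H \<le> 3 * sqrt (real r) * sqrt (mip n H H) +
    2 * (\<Sum>a\<in>{..<n} - A. ip n (u a) (mv n Sig (u a)))"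
proof -
  define J where "J = {..<n} - A"
  define w where "w = (\<lambda>(a, b). ip n (u a) (mv n W (u b)))"
  define h where "h = (\<lambda>(a, b). ip n (u a) (mv n H (u b)))"
  have finA: "finite A" using A finite_subset by blast
  have mvH: "mv n H x = (\<lambda>i. mv n Sh x i - mv n Sig x i)" for x
    by (simp add: mv_def H_def algebra_simps sum_subtractf)
  have hH: "ip n p (mv n H q) = ip n p (mv n Sh q) - ip n p (mv n Sig q)" for p q
    by (simp add: mvH ip_diff_right)
  have mip_eq: "mip n M N = (\<Sum>(a, b)\<in>{..<n} \<times> {..<n}. ip n (u a) (mv n M (u b)) * ip n (u a) (mv n N (u b)))" for M N
    unfolding mip_Parseval2[OF u] by (subst sum.swap) (simp add: sum.cartesian_product)
  have h2: "(\<Sum>p\<in>P. (h p)\<^sup>2) \<le> mip n H H" if "P \<subseteq> {..<n} \<times> {..<n}" for P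
  proof -
    have "(\<Sum>p\<in>P. (h p)\<^sup>2) \<le> (\<Sum>p\<in>{..<n} \<times> {..<n}. (h p)\<^sup>2)"
      using that by (intro sum_mono2) auto
    then show ?thesis unfolding mip_eq h_def by (simp add: case_prod_unfold power2_eq_square)
  qed
  \<comment> \<open>A contraction has columns of norm at most 1: with \<open>q\<close> the squared
    norm of \<open>W (u b)\<close>, testing the bilinear bound at \<open>x = W (u b)\<close> gives
    \<open>q \<le> sqrt q\<close>.\<close>
  have wu: "(\<Sum>a<n. (w (a, b))\<^sup>2) \<le> 1" if "b < n" for b
  proof -
    have Wu: "\<bar>ip n x (mv n W (u b))\<bar> \<le> sqrt (ip n x x)" for x
      using quadratic_form_bound_bilinear[OF W(1), of 1 x "u b"] W(2) u that by (simp add: orthonormal_def)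
    let ?q = "ip n (mv n W (u b)) (mv n W (u b))"
    have q0: "0 \<le> ?q" by (rule ip_self_nonneg)
    have "\<bar>?q\<bar> \<le> sqrt ?q" by (rule Wu)
    then have "?q * ?q \<le> 1 * ?q"
      using q0 abs_le_square_iff[of ?q "sqrt ?q"] by (simp add: power2_eq_square)
    then have "?q \<le> 1" using q0 by (cases "?q = 0") (auto simp: mult_le_cancel_right)
    then show ?thesis using Bessel[OF u, of "mv n W (u b)"] by (simp add: w_def)
  qed
  have wsym: "w (a, b) = w (b, a)" for a b
    unfolding w_def by (simp add: ip_mv_symm[OF W(1), of "u a"] ip_commute)
  have w1: "(\<Sum>p\<in>A \<times> {..<n}. (w p)\<^sup>2) \<le> real r"
  proof -
    have "(\<Sum>p\<in>A \<times> {..<n}. (w p)\<^sup>2) = (\<Sum>a\<in>A. \<Sum>b<n. (w (a, b))\<^sup>2)" by (simp add: sum.cartesian_product)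
    also have "\<dots> \<le> (\<Sum>a\<in>A. 1)" using A wu by (intro sum_mono) (auto simp: wsym)
    also have "\<dots> \<le> real r" using A by simp
    finally show ?thesis .
  qed
  have w2: "(\<Sum>p\<in>J \<times> A. (w p)\<^sup>2) \<le> real r"
  proof -
    have "(\<Sum>p\<in>J \<times> A. (w p)\<^sup>2) = (\<Sum>b\<in>A. \<Sum>a\<in>J. (w (a, b))\<^sup>2)"
      by (subst sum.swap) (simp add: sum.cartesian_product)
    also have "\<dots> \<le> (\<Sum>b\<in>A. \<Sum>a<n. (w (a, b))\<^sup>2)"
      by (intro sum_mono sum_mono2) (auto simp: J_def)
    also have "\<dots> \<le> (\<Sum>b\<in>A. 1)" using A wu by (intro sum_mono) auto
    also have "\<dots> \<le> real r" using A by simp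
    finally show ?thesis .
  qed
  \<comment> \<open>The first two blocks are the tangent directions. There \<open>W\<close> has at
    most \<open>card A\<close> rows or columns, so its squared Frobenius norm is at most
    \<open>r\<close>; on \<open>J \<times> J\<close> only the traces of \<open>Sh\<close> and
    \<open>Sig\<close> are available.\<close>
  have split: "{..<n} \<times> {..<n} = (A \<times> {..<n} \<union> J \<times> A) \<union> J \<times> J"
    using A by (auto simp: J_def)
  have "mip n W H = (\<Sum>p\<in>{..<n} \<times> {..<n}. w p * h p)"
    unfolding mip_eq by (simp add: w_def h_def case_prod_unfold)
  also have "\<dots> = (\<Sum>p\<in>A \<times> {..<n}. w p * h p) + (\<Sum>p\<in>J \<times> A. w p * h p) + (\<Sum>p\<in>J \<times> J. w p * h p)"
    unfolding split using finA
    by (subst sum.union_disjoint, (auto simp: J_def)[3], subst sum.union_disjoint) (auto simp: J_def)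
  finally have mip_split: "mip n W H =
     (\<Sum>p\<in>A \<times> {..<n}. w p * h p) + (\<Sum>p\<in>J \<times> A. w p * h p) + (\<Sum>p\<in>J \<times> J. w p * h p)" .
  have t1: "(\<Sum>p\<in>A \<times> {..<n}. w p * h p) \<le> sqrt (real r) * sqrt (mip n H H)"
    using A by (intro sum_product_le_sqrt w1 h2) auto
  have t2: "(\<Sum>p\<in>J \<times> A. w p * h p) \<le> sqrt (real r) * sqrt (mip n H H)"
    using A by (intro sum_product_le_sqrt w2 h2) (auto simp: J_def)
  have uJ: "orthonormal n J u" using u by (auto simp: orthonormal_def J_def)
  have finJ: "finite J" by (simp add: J_def)
  have "(\<Sum>p\<in>J \<times> J. w p * h p) =
      (\<Sum>a\<in>J. \<Sum>b\<in>J. ip n (u a) (mv n W (u b)) * ip n (u a) (mv n Sh (u b))) -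
      (\<Sum>a\<in>J. \<Sum>b\<in>J. ip n (u a) (mv n W (u b)) * ip n (u a) (mv n Sig (u b)))"
    by (simp add: sum.cartesian_product sum_subtractf[symmetric] w_def h_def hH right_diff_distrib
        case_prod_unfold)
  then have t3: "(\<Sum>p\<in>J \<times> J. w p * h p) \<le>
      (\<Sum>a\<in>J. ip n (u a) (mv n Sh (u a))) + (\<Sum>a\<in>J. ip n (u a) (mv n Sig (u a)))"
    using psd_contraction_le_trace[OF Sh W(2) uJ finJ] psd_contraction_le_trace[OF Sig W(2) uJ finJ]
    by linarith
  have trace_split: "(\<Sum>i<n. M i i) = (\<Sum>a\<in>J. ip n (u a) (mv n M (u a))) + (\<Sum>a\<in>A. ip n (u a) (mv n M (u a)))" for M
    unfolding trace_orthonormal[OF u] J_def using A by (simp add: sum.subset_diff)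
  \<comment> \<open>The trace comparison lets the \<open>J\<close>-trace of \<open>Sh\<close> exceed
    that of \<open>Sig\<close> by at most this sum. It is the third contribution of size
    \<open>sqrt r * \<parallel>H\<parallel>\<close>, after the two tangent blocks, whence the factor
    3; the factor 2 counts the \<open>J\<close>-trace of \<open>Sig\<close> once for itself and once
    through \<open>Sh\<close>.\<close>
  have t4: "- (\<Sum>a\<in>A. ip n (u a) (mv n H (u a))) \<le> sqrt (real r) * sqrt (mip n H H)"
  proof -
    have "(\<Sum>a\<in>A. (- 1) * h (a, a)) \<le> sqrt (real r) * sqrt (mip n H H)"
    proof (rule sum_product_le_sqrt)
      show "(\<Sum>a\<in>A. (- 1)\<^sup>2) \<le> real r" using A by simp
      have "(\<Sum>a\<in>A. (h (a, a))\<^sup>2) = (\<Sum>p\<in>(\<lambda>a. (a, a)) ` A. (h p)\<^sup>2)"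
        by (subst sum.reindex) (auto intro: inj_onI)
      also have "\<dots> \<le> mip n H H" using A by (intro h2) auto
      finally show "(\<Sum>a\<in>A. (h (a, a))\<^sup>2) \<le> mip n H H" .
    qed
    then show ?thesis by (simp add: h_def sum_negf)
  qed
  have "(\<Sum>a\<in>A. ip n (u a) (mv n H (u a))) =
      (\<Sum>a\<in>A. ip n (u a) (mv n Sh (u a))) - (\<Sum>a\<in>A. ip n (u a) (mv n Sig (u a)))"
    by (simp add: hH sum_subtractf)
  then have "(\<Sum>a\<in>J. ip n (u a) (mv n Sh (u a))) \<le>
      (\<Sum>a\<in>J. ip n (u a) (mv n Sig (u a))) + sqrt (real r) * sqrt (mip n H H)"
    using tr t4 trace_split[of Sh] trace_split[of Sig] by linarith
  then show ?thesis using mip_split t1 t2 t3 by (simp add: J_def)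
qed

text \<open>With the basis adapted to \<open>Sr\<close>, the transpose of \<open>Sr\<close> kills
  every \<open>u a\<close> outside \<open>A\<close>. On these vectors \<open>Sig\<close> may
  therefore be replaced by \<open>Sig - Sr\<close>, and trace duality turns the remaining sum into
  the nuclear norm of the tail.\<close>

lemma minimizer_error_dual_bound:
  assumes Sig: "psd_mat n Sig" and Sh: "psd_mat n Sh" and tr: "mtrace Sh \<le> mtrace Sig"
    and Sr: "Sr \<in> carrier_mat n n" "mat_rank Sr \<le> r"
    and W: "symm_on n W" "\<And>x. \<bar>ip n x (mv n W x)\<bar> \<le> ip n x x"
  shows "mip n W (entries (Sh - Sig)) \<le>
    3 * sqrt (real r) * frob_norm (Sh - Sig) + 2 * nuc_norm (Sig - Sr)"
proof -
  have c: "Sig \<in> carrier_mat n n" "Sh \<in> carrier_mat n n"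
    using Sig Sh by (auto simp: psd_mat_def)
  obtain u A where u: "orthonormal n {..<n} u" and A: "A \<subseteq> {..<n}" "card A \<le> r"
    and ker: "\<And>a i. a \<in> {..<n} - A \<Longrightarrow> i < n \<Longrightarrow> mv n (\<lambda>i j. Sr $$ (j, i)) (u a) i = 0"
    by (rule low_rank_left_kernel_basis[OF Sr], rule that)
  define H where "H = (\<lambda>i j. entries Sh i j - entries Sig i j)"
  have H: "\<And>i j. i < n \<Longrightarrow> j < n \<Longrightarrow> entries (Sh - Sig) i j = H i j" using c by (simp add: H_def)
  have frob: "frob_norm (Sh - Sig) = sqrt (mip n H H)"
    using c by (simp add: frob_norm_def mip_def H_def power2_eq_square)
  have mipW: "mip n W (entries (Sh - Sig)) = mip n W H"
    unfolding mip_def using H by (intro sum.cong refl) auto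
  have "mip n W H \<le> 3 * sqrt (real r) * sqrt (mip n H H) +
    2 * (\<Sum>a\<in>{..<n} - A. ip n (u a) (mv n (entries Sig) (u a)))"
    unfolding H_def
    using Sig Sh tr c u A W
    by (intro trace_descent_dual_bound) (auto simp: psd_mat_entries mtrace_def)
  moreover have "(\<Sum>a\<in>{..<n} - A. ip n (u a) (mv n (entries Sig) (u a))) =
      (\<Sum>a\<in>{..<n} - A. ip n (u a) (mv n (entries (Sig - Sr)) (u a)))"
  proof (rule sum.cong[OF refl])
    fix a assume a: "a \<in> {..<n} - A"
    have "ip n (u a) (mv n (entries (Sig - Sr)) (u a)) =
        ip n (u a) (\<lambda>i. mv n (entries Sig) (u a) i - mv n (entries Sr) (u a) i)"
      using c Sr by (intro ip_cong) (auto simp: mv_def left_diff_distrib sum_subtractf)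
    also have "\<dots> = ip n (u a) (mv n (entries Sig) (u a)) - ip n (mv n (\<lambda>i j. Sr $$ (j, i)) (u a)) (u a)"
      by (simp only: ip_diff_right ip_mv_transpose[of n "u a" "entries Sr"])
    also have "ip n (mv n (\<lambda>i j. Sr $$ (j, i)) (u a)) (u a) = 0"
      using ker[OF a] by (simp add: ip_def)
    finally show "ip n (u a) (mv n (entries Sig) (u a)) = ip n (u a) (mv n (entries (Sig - Sr)) (u a))"
      by simp
  qed
  moreover have "\<dots> \<le> nuc_norm (Sig - Sr)"
    using c Sr u by (intro sum_quadratic_le_nuc_norm) (auto simp: orthonormal_def)
  ultimately show ?thesis by (simp add: mipW frob)
qed

text \<open>Trace duality for the empty orthonormal family.\<close>

lemma nuc_norm_nonneg:
  assumes "N \<in> carrier_mat n n"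
  shows "0 \<le> nuc_norm N"
  using sum_quadratic_le_nuc_norm[OF assms, of "{}" "\<lambda>_ _. 0"] by (simp add: orthonormal_def)

section \<open>Concentration and symmetrisation on product spaces\<close>

abbreviation iid :: "'a measure \<Rightarrow> nat \<Rightarrow> (nat \<Rightarrow> 'a) measure" where
  "iid Q m \<equiv> PiM {..<m} (\<lambda>_. Q)"

lemma prob_space_iid: "prob_space Q \<Longrightarrow> prob_space (iid Q m)"
  by (rule prob_space_PiM)

lemma distr_iid_Suc:
  assumes "prob_space Q"
  shows "distr (Q \<Otimes>\<^sub>M iid Q m) (iid Q (Suc m)) (\<lambda>(y, w). w(m := y)) = iid Q (Suc m)"
  using distr_pair_PiM_eq_PiM[of "{..<m}" "\<lambda>_. Q" m] assms by (simp add: lessThan_Suc)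

lemma measurable_iid_update:
  "(\<lambda>(y, w). w(m := y)) \<in> Q \<Otimes>\<^sub>M iid Q m \<rightarrow>\<^sub>M iid Q (Suc m)"
  unfolding lessThan_Suc by measurable

lemma iid_update_in_space:
  "y \<in> space Q \<Longrightarrow> w \<in> space (iid Q m) \<Longrightarrow> w(m := y) \<in> space (iid Q (Suc m))"
  using measurable_space[OF measurable_iid_update, of "(y, w)"] by (auto simp: space_pair_measure)

text \<open>Fubini with the last sample split off. Both orders are recorded because
  \<open>integral_Max_sum_mono\<close> first alters the last summand with the others fixed, then the
  others with the last fixed.\<close>

lemma iid_Suc_integral:
  fixes f :: "_ \<Rightarrow> real"
  assumes Q: "prob_space Q" and f: "integrable (iid Q (Suc m)) f"
  shows "integrable (Q \<Otimes>\<^sub>M iid Q m) (\<lambda>(y, w). f (w(m := y)))" (is ?A)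
    and "(\<integral>w. f w \<partial>iid Q (Suc m)) = (\<integral>y. \<integral>w. f (w(m := y)) \<partial>iid Q m \<partial>Q)" (is ?B)
    and "(\<integral>w. f w \<partial>iid Q (Suc m)) = (\<integral>w. \<integral>y. f (w(m := y)) \<partial>Q \<partial>iid Q m)" (is ?C)
    and "integrable Q (\<lambda>y. \<integral>w. f (w(m := y)) \<partial>iid Q m)" (is ?D)
    and "integrable (iid Q m) (\<lambda>w. \<integral>y. f (w(m := y)) \<partial>Q)" (is ?E)
proof -
  interpret Q: prob_space Q by fact
  interpret P: prob_space "iid Q m" by (rule prob_space_iid[OF Q])
  interpret pair_sigma_finite Q "iid Q m" ..
  have f': "integrable (distr (Q \<Otimes>\<^sub>M iid Q m) (iid Q (Suc m)) (\<lambda>(y, w). w(m := y))) f"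
    using f by (simp only: distr_iid_Suc[OF Q])
  show A: ?A
    using integrable_distr[OF measurable_iid_update f'] by (simp add: case_prod_unfold)
  have eq: "(\<integral>w. f w \<partial>iid Q (Suc m)) = (\<integral>z. (case z of (y, w) \<Rightarrow> f (w(m := y))) \<partial>(Q \<Otimes>\<^sub>M iid Q m))"
    using integral_distr[OF measurable_iid_update[of m Q], of f] f
    unfolding distr_iid_Suc[OF Q] by (simp add: case_prod_unfold)
  show ?B unfolding eq using integral_fst[OF A] by simp
  show ?C unfolding eq using integral_snd[OF A] by simp
  show ?D using integrable_fst[OF A] by simp
  show ?E using integrable_snd[OF A] by simp
qed

lemma iid_Suc_nn_integral:
  assumes Q: "prob_space Q" and f[measurable]: "f \<in> borel_measurable (iid Q (Suc m))"
  shows "(\<integral>\<^sup>+w. f w \<partial>iid Q (Suc m)) = (\<integral>\<^sup>+y. \<integral>\<^sup>+w. f (w(m := y)) \<partial>iid Q m \<partial>Q)"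
    and "(\<integral>\<^sup>+w. f w \<partial>iid Q (Suc m)) = (\<integral>\<^sup>+w. \<integral>\<^sup>+y. f (w(m := y)) \<partial>Q \<partial>iid Q m)"
proof -
  interpret Q: prob_space Q by fact
  interpret product_sigma_finite "\<lambda>_. Q" ..
  show "(\<integral>\<^sup>+w. f w \<partial>iid Q (Suc m)) = (\<integral>\<^sup>+y. \<integral>\<^sup>+w. f (w(m := y)) \<partial>iid Q m \<partial>Q)"
    using f unfolding lessThan_Suc by (intro product_nn_integral_insert_rev) auto
  show "(\<integral>\<^sup>+w. f w \<partial>iid Q (Suc m)) = (\<integral>\<^sup>+w. \<integral>\<^sup>+y. f (w(m := y)) \<partial>Q \<partial>iid Q m)"
    using f unfolding lessThan_Suc by (intro product_nn_integral_insert) auto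
qed

lemma measurable_iid_slice:
  assumes f: "f \<in> borel_measurable (iid Q (Suc m))" and y: "y \<in> space Q"
  shows "(\<lambda>w. f (w(m := y))) \<in> borel_measurable (iid Q m)"
  using measurable_comp[OF measurable_comp[OF measurable_Pair1'[OF y] measurable_iid_update] f]
  by (simp add: comp_def)

text \<open>An oscillation of at most \<open>c\<close> places \<open>g\<close> in the interval of
  length \<open>c\<close> above its infimum, which is the setting of Hoeffding's lemma.\<close>

lemma (in prob_space) Hoeffding_mgf:
  fixes g :: "'a \<Rightarrow> real"
  assumes [measurable]: "g \<in> borel_measurable M" and "0 < l" and "0 \<le> c"
    and range: "\<And>y z. y \<in> space M \<Longrightarrow> z \<in> space M \<Longrightarrow> g y - g z \<le> c"
  shows "(\<integral>\<^sup>+y. ennreal (exp (l * (g y - expectation g))) \<partial>M) \<le> ennreal (exp (l\<^sup>2 * c\<^sup>2 / 8))"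
proof -
  define a where "a = (INF y\<in>space M. g y)"
  obtain z0 where z0: "z0 \<in> space M" using not_empty by blast
  have bdd: "bdd_below (g ` space M)"
    using range[OF z0] by (auto intro!: bdd_belowI[of _ "g z0 - c"]) (smt (verit))
  have "g y \<in> {a..a + c}" if "y \<in> space M" for y
  proof -
    have "a \<le> g y" unfolding a_def using bdd that by (rule cINF_lower)
    moreover have "g y - c \<le> a"
      unfolding a_def using z0 range[OF that] by (intro cINF_greatest) (auto simp: algebra_simps)
    ultimately show ?thesis by simp
  qed
  then interpret interval_bounded_random_variable M g a "a + c"
    by unfold_locales auto
  show ?thesis using Hoeffdings_lemma_nn_integral[OF \<open>0 < l\<close>] by simp
qed

text \<open>Induction over the samples in place of a martingale. Given the last sample, the
  remaining function has the same bounded differences; its conditional mean, as a function of that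
  sample, oscillates by at most \<open>c\<close>. The two exponential bounds multiply.\<close>

lemma McDiarmid_mgf:
  fixes f :: "(nat \<Rightarrow> 'a) \<Rightarrow> real"
  assumes Q: "prob_space Q" and l: "0 < l" and c: "0 \<le> c"
    and f: "f \<in> borel_measurable (iid Q m)"
    and bdd: "\<And>w. w \<in> space (iid Q m) \<Longrightarrow> \<bar>f w\<bar> \<le> K"
    and diff: "\<And>w i y z. w \<in> space (iid Q m) \<Longrightarrow> i < m \<Longrightarrow> y \<in> space Q \<Longrightarrow> z \<in> space Q \<Longrightarrow>
      f (w(i := y)) - f (w(i := z)) \<le> c"
  shows "(\<integral>\<^sup>+w. ennreal (exp (l * (f w - (\<integral>w. f w \<partial>iid Q m)))) \<partial>iid Q m) \<le>
    ennreal (exp (l\<^sup>2 * (real m * c\<^sup>2) / 8))"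
  using f bdd diff
proof (induction m arbitrary: f)
  case 0
  interpret Q: prob_space Q by fact
  interpret product_sigma_finite "\<lambda>_. Q" ..
  interpret P: prob_space "PiM {} (\<lambda>_::nat. Q)" by (rule prob_space_PiM) auto
  have "(\<integral>w. f w \<partial>iid Q 0) = (\<integral>w. f (\<lambda>_. undefined) \<partial>iid Q 0)"
    by (intro Bochner_Integration.integral_cong refl) (simp add: space_PiM)
  then have "(\<integral>w. f w \<partial>iid Q 0) = f (\<lambda>_. undefined)" by (simp add: P.prob_space)
  then show ?case by (simp add: nn_integral_empty)
next
  case (Suc m)
  interpret Q: prob_space Q by fact
  interpret P: prob_space "iid Q m" by (rule prob_space_iid[OF Q])
  interpret P': prob_space "iid Q (Suc m)" by (rule prob_space_iid[OF Q])
  note f [measurable] = Suc.prems(1) and bdd = Suc.prems(2) and diff = Suc.prems(3)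
  have int: "integrable (iid Q (Suc m)) f"
    using bdd f by (intro P'.integrable_const_bound[of _ K]) auto
  \<comment> \<open>The conditional mean given the last sample.\<close>
  define g where "g = (\<lambda>y. \<integral>w. f (w(m := y)) \<partial>iid Q m)"
  have gi: "integrable Q g" and mu: "(\<integral>w. f w \<partial>iid Q (Suc m)) = (\<integral>y. g y \<partial>Q)"
    unfolding g_def using iid_Suc_integral[OF Q int] by auto
  have slice: "(\<lambda>w. f (w(m := y))) \<in> borel_measurable (iid Q m)" if "y \<in> space Q" for y
    using measurable_iid_slice[OF f that] .
  have slice_int: "integrable (iid Q m) (\<lambda>w. f (w(m := y)))" if "y \<in> space Q" for y
    using slice[OF that] bdd iid_update_in_space[OF that]
    by (intro P.integrable_const_bound[of _ K]) auto
  have range: "g y - g z \<le> c" if "y \<in> space Q" "z \<in> space Q" for y z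
  proof -
    have "g y - g z = (\<integral>w. f (w(m := y)) - f (w(m := z)) \<partial>iid Q m)"
      unfolding g_def using slice_int that by simp
    also have "\<dots> \<le> (\<integral>w. c \<partial>iid Q m)"
    proof (rule integral_mono)
      fix w assume w: "w \<in> space (iid Q m)"
      have "w(m := z) \<in> space (iid Q (Suc m))" using that(2) w by (rule iid_update_in_space)
      from diff[OF this lessI that] show "f (w(m := y)) - f (w(m := z)) \<le> c"
        by (simp only: fun_upd_upd)
    qed (use slice_int that in auto)
    finally show ?thesis by (simp add: P.prob_space)
  qed
  define \<mu> where "\<mu> = (\<integral>y. g y \<partial>Q)"
  have "(\<integral>\<^sup>+w. ennreal (exp (l * (f w - \<mu>))) \<partial>iid Q (Suc m)) =
      (\<integral>\<^sup>+y. \<integral>\<^sup>+w. ennreal (exp (l * (f (w(m := y)) - \<mu>))) \<partial>iid Q m \<partial>Q)"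
    by (intro iid_Suc_nn_integral(1)[OF Q]) measurable
  also have "\<dots> \<le> (\<integral>\<^sup>+y. ennreal (exp (l * (g y - \<mu>))) * ennreal (exp (l\<^sup>2 * (real m * c\<^sup>2) / 8)) \<partial>Q)"
  proof (rule nn_integral_mono)
    fix y assume y: "y \<in> space Q"
    note slice[OF y, measurable]
    have "(\<integral>\<^sup>+w. ennreal (exp (l * (f (w(m := y)) - \<mu>))) \<partial>iid Q m) =
        (\<integral>\<^sup>+w. ennreal (exp (l * (g y - \<mu>))) * ennreal (exp (l * (f (w(m := y)) - g y))) \<partial>iid Q m)"
      by (intro nn_integral_cong) (simp add: ennreal_mult[symmetric] exp_add[symmetric] algebra_simps)
    also have "\<dots> = ennreal (exp (l * (g y - \<mu>))) * (\<integral>\<^sup>+w. ennreal (exp (l * (f (w(m := y)) - g y))) \<partial>iid Q m)"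
      by (intro nn_integral_cmult) measurable
    also have "(\<integral>\<^sup>+w. ennreal (exp (l * (f (w(m := y)) - g y))) \<partial>iid Q m) \<le>
        ennreal (exp (l\<^sup>2 * (real m * c\<^sup>2) / 8))"
      unfolding g_def
    proof (rule Suc.IH[OF slice[OF y]])
      show "\<bar>f (w(m := y))\<bar> \<le> K" if "w \<in> space (iid Q m)" for w
        using bdd iid_update_in_space[OF y that] by blast
      show "f ((w(i := u))(m := y)) - f ((w(i := v))(m := y)) \<le> c"
        if "w \<in> space (iid Q m)" "i < m" "u \<in> space Q" "v \<in> space Q" for w i u v
        using diff[OF iid_update_in_space[OF y that(1)] less_SucI[OF that(2)] that(3,4)] that(2)
        by (simp only: fun_upd_twist[of m i] less_not_refl2[OF that(2)] not_False_eq_True)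
    qed
    finally show "(\<integral>\<^sup>+w. ennreal (exp (l * (f (w(m := y)) - \<mu>))) \<partial>iid Q m) \<le>
        ennreal (exp (l * (g y - \<mu>))) * ennreal (exp (l\<^sup>2 * (real m * c\<^sup>2) / 8))"
      by (simp add: mult_left_mono)
  qed
  also have "\<dots> = (\<integral>\<^sup>+y. ennreal (exp (l * (g y - \<mu>))) \<partial>Q) * ennreal (exp (l\<^sup>2 * (real m * c\<^sup>2) / 8))"
    using borel_measurable_integrable[OF gi, measurable] by (intro nn_integral_multc) measurable
  also have "\<dots> \<le> ennreal (exp (l\<^sup>2 * c\<^sup>2 / 8)) * ennreal (exp (l\<^sup>2 * (real m * c\<^sup>2) / 8))"
    using gi range l c unfolding \<mu>_def by (intro mult_right_mono Q.Hoeffding_mgf) auto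
  also have "\<dots> = ennreal (exp (l\<^sup>2 * (real (Suc m) * c\<^sup>2) / 8))"
    by (simp add: ennreal_mult[symmetric] exp_add[symmetric] algebra_simps add_divide_distrib)
  finally show ?case unfolding mu \<mu>_def .
qed

lemma McDiarmid:
  fixes f :: "(nat \<Rightarrow> 'a) \<Rightarrow> real"
  assumes Q: "prob_space Q" and c: "0 < c" and m: "0 < m" and t: "0 < t"
    and f: "f \<in> borel_measurable (iid Q m)"
    and bdd: "\<And>w. w \<in> space (iid Q m) \<Longrightarrow> \<bar>f w\<bar> \<le> K"
    and diff: "\<And>w i y z. w \<in> space (iid Q m) \<Longrightarrow> i < m \<Longrightarrow> y \<in> space Q \<Longrightarrow> z \<in> space Q \<Longrightarrow>
      f (w(i := y)) - f (w(i := z)) \<le> c"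
  shows "measure (iid Q m) {w \<in> space (iid Q m). f w \<ge> (\<integral>w. f w \<partial>iid Q m) + t * real m} \<le>
    exp (- 2 * t\<^sup>2 * real m / c\<^sup>2)"
proof -
  interpret P: prob_space "iid Q m" by (rule prob_space_iid[OF Q])
  define \<mu> where "\<mu> = (\<integral>w. f w \<partial>iid Q m)"
  \<comment> \<open>The minimiser of the Chernoff exponent
    \<open>- l * (t * m) + l\<^sup>2 * (m * c\<^sup>2) / 8\<close>.\<close>
  define l where "l = 4 * t / c\<^sup>2"
  have l: "0 < l" using t c by (simp add: l_def)
  let ?A = "{w \<in> space (iid Q m). f w - \<mu> \<ge> t * real m}"
  have "emeasure (iid Q m) ?A \<le> ennreal (exp (- l * (t * real m))) *
      (\<integral>\<^sup>+w. ennreal (exp (l * (f w - \<mu>))) * indicator (space (iid Q m)) w \<partial>iid Q m)"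
    using f by (intro Chernoff_ineq_nn_integral_ge l) auto
  also have "(\<integral>\<^sup>+w. ennreal (exp (l * (f w - \<mu>))) * indicator (space (iid Q m)) w \<partial>iid Q m) =
      (\<integral>\<^sup>+w. ennreal (exp (l * (f w - \<mu>))) \<partial>iid Q m)"
    by (intro nn_integral_cong) auto
  also have "ennreal (exp (- l * (t * real m))) * \<dots> \<le>
      ennreal (exp (- l * (t * real m))) * ennreal (exp (l\<^sup>2 * (real m * c\<^sup>2) / 8))"
    using c unfolding \<mu>_def by (intro mult_left_mono McDiarmid_mgf[OF Q l _ f bdd diff]) auto
  also have "\<dots> = ennreal (exp (- l * (t * real m) + l\<^sup>2 * (real m * c\<^sup>2) / 8))"
    by (simp add: ennreal_mult[symmetric] exp_add[symmetric])
  also have "- l * (t * real m) + l\<^sup>2 * (real m * c\<^sup>2) / 8 = - 2 * t\<^sup>2 * real m / c\<^sup>2"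
    using c by (simp add: l_def field_simps power2_eq_square)
  finally have "measure (iid Q m) ?A \<le> exp (- 2 * t\<^sup>2 * real m / c\<^sup>2)"
    by (simp add: P.emeasure_eq_measure)
  moreover have "{w \<in> space (iid Q m). f w \<ge> \<mu> + t * real m} = ?A" by auto
  ultimately show ?thesis by (simp add: \<mu>_def)
qed

section \<open>Symmetrisation and contraction for maxima over finite classes\<close>

lemma integrable_Max:
  fixes h :: "'i \<Rightarrow> 'a \<Rightarrow> real"
  assumes "finite F" "F \<noteq> {}" "\<And>H. H \<in> F \<Longrightarrow> integrable M (h H)"
  shows "integrable M (\<lambda>x. Max ((\<lambda>H. h H x) ` F))"
  using assms by (induction F rule: finite_ne_induct) auto

lemma integrable_iid_component:
  fixes h :: "'a \<Rightarrow> real"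
  assumes Q: "prob_space Q" and "integrable Q h" "i < m"
  shows "integrable (iid Q m) (\<lambda>w. h (w i))"
proof -
  interpret Q: prob_space Q by fact
  interpret product_prob_space "\<lambda>_. Q" "{..<m}" ..
  have "distr (iid Q m) Q (\<lambda>w. w i) = Q" using PiM_component[of i] assms by simp
  then show ?thesis
    using assms integrable_distr[of "\<lambda>w. w i" "iid Q m" Q h] by auto
qed

text \<open>Replaces the summands one sample at a time. The offset \<open>g\<close> is arbitrary
  because it absorbs the contribution of all the other samples when one of them is
  exchanged.\<close>

lemma integral_Max_sum_mono:
  fixes a b :: "'i \<Rightarrow> 'a \<Rightarrow> real"
  assumes Q: "prob_space Q" and F: "finite F" "F \<noteq> {}"
    and a: "\<And>H. H \<in> F \<Longrightarrow> integrable Q (a H)" and b: "\<And>H. H \<in> F \<Longrightarrow> integrable Q (b H)"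
    and step: "\<And>g. (\<integral>y. Max ((\<lambda>H. g H + a H y) ` F) \<partial>Q) \<le> (\<integral>y. Max ((\<lambda>H. g H + b H y) ` F) \<partial>Q)"
  shows "(\<integral>w. Max ((\<lambda>H. g H + (\<Sum>i<m. a H (w i))) ` F) \<partial>iid Q m) \<le>
    (\<integral>w. Max ((\<lambda>H. g H + (\<Sum>i<m. b H (w i))) ` F) \<partial>iid Q m)"
proof (induction m arbitrary: g)
  case 0
  show ?case by simp
next
  case (Suc m)
  interpret Q: prob_space Q by fact
  interpret P: prob_space "iid Q m" by (rule prob_space_iid[OF Q])
  interpret P': prob_space "iid Q (Suc m)" by (rule prob_space_iid[OF Q])
  have upd: "(\<Sum>i<m. h H ((w(m := y)) i)) = (\<Sum>i<m. h H (w i))" for h :: "'i \<Rightarrow> 'a \<Rightarrow> real" and H w y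
    by (intro sum.cong) auto
  have int: "integrable (iid Q (Suc m)) (\<lambda>w. Max ((\<lambda>H. g H + (\<Sum>i<m. h H (w i)) + k H (w m)) ` F))"
    if "\<And>H. H \<in> F \<Longrightarrow> integrable Q (h H)" "\<And>H. H \<in> F \<Longrightarrow> integrable Q (k H)" for h k
    using that by (intro integrable_Max F Bochner_Integration.integrable_add
        Bochner_Integration.integrable_sum integrable_iid_component[OF Q]) auto
  have "(\<integral>w. Max ((\<lambda>H. g H + (\<Sum>i<Suc m. a H (w i))) ` F) \<partial>iid Q (Suc m)) =
      (\<integral>w. Max ((\<lambda>H. g H + (\<Sum>i<m. a H (w i)) + a H (w m)) ` F) \<partial>iid Q (Suc m))"
    by (simp add: add.assoc)
  also have "\<dots> = (\<integral>w. \<integral>y. Max ((\<lambda>H. g H + (\<Sum>i<m. a H (w i)) + a H y) ` F) \<partial>Q \<partial>iid Q m)"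
    by (subst iid_Suc_integral(3)[OF Q int]) (simp_all add: a upd)
  also have "\<dots> \<le> (\<integral>w. \<integral>y. Max ((\<lambda>H. g H + (\<Sum>i<m. a H (w i)) + b H y) ` F) \<partial>Q \<partial>iid Q m)"
  proof (rule integral_mono)
    show "integrable (iid Q m) (\<lambda>w. \<integral>y. Max ((\<lambda>H. g H + (\<Sum>i<m. a H (w i)) + a H y) ` F) \<partial>Q)"
      using iid_Suc_integral(5)[OF Q int[of a a]] a by (simp add: upd)
    show "integrable (iid Q m) (\<lambda>w. \<integral>y. Max ((\<lambda>H. g H + (\<Sum>i<m. a H (w i)) + b H y) ` F) \<partial>Q)"
      using iid_Suc_integral(5)[OF Q int[of a b]] a b by (simp add: upd)
  qed (rule step)
  also have "\<dots> = (\<integral>w. Max ((\<lambda>H. g H + (\<Sum>i<m. a H (w i)) + b H (w m)) ` F) \<partial>iid Q (Suc m))"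
    by (subst iid_Suc_integral(3)[OF Q int]) (simp_all add: a b upd)
  also have "\<dots> = (\<integral>y. \<integral>w. Max ((\<lambda>H. (g H + b H y) + (\<Sum>i<m. a H (w i))) ` F) \<partial>iid Q m \<partial>Q)"
    by (subst iid_Suc_integral(2)[OF Q int]) (simp_all add: a b upd ac_simps)
  also have "\<dots> \<le> (\<integral>y. \<integral>w. Max ((\<lambda>H. (g H + b H y) + (\<Sum>i<m. b H (w i))) ` F) \<partial>iid Q m \<partial>Q)"
  proof (rule integral_mono)
    show "integrable Q (\<lambda>y. \<integral>w. Max ((\<lambda>H. (g H + b H y) + (\<Sum>i<m. a H (w i))) ` F) \<partial>iid Q m)"
      using iid_Suc_integral(4)[OF Q int[of a b]] a b by (simp add: upd ac_simps)
    show "integrable Q (\<lambda>y. \<integral>w. Max ((\<lambda>H. (g H + b H y) + (\<Sum>i<m. b H (w i))) ` F) \<partial>iid Q m)"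
      using iid_Suc_integral(4)[OF Q int[of b b]] b by (simp add: upd ac_simps)
  qed (rule Suc.IH)
  also have "\<dots> = (\<integral>w. Max ((\<lambda>H. g H + (\<Sum>i<m. b H (w i)) + b H (w m)) ` F) \<partial>iid Q (Suc m))"
    by (subst iid_Suc_integral(2)[OF Q int]) (simp_all add: b upd ac_simps)
  finally show ?case by (simp add: add.assoc)
qed

text \<open>At the two maximisers only the increment of \<open>p\<close> between them enters, so \<open>p\<close> may be replaced by
  any \<open>q\<close> with larger increments.\<close>
lemma Max_contraction:
  fixes g p q :: "'i \<Rightarrow> real"
  assumes F: "finite F" "F \<noteq> {}" and lip: "\<And>H K. H \<in> F \<Longrightarrow> K \<in> F \<Longrightarrow> \<bar>p H - p K\<bar> \<le> \<bar>q H - q K\<bar>"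
  shows "Max ((\<lambda>H. g H + p H) ` F) + Max ((\<lambda>H. g H - p H) ` F) \<le>
    Max ((\<lambda>H. g H + q H) ` F) + Max ((\<lambda>H. g H - q H) ` F)"
proof -
  have "Max ((\<lambda>H. g H + p H) ` F) \<in> (\<lambda>H. g H + p H) ` F" "Max ((\<lambda>H. g H - p H) ` F) \<in> (\<lambda>H. g H - p H) ` F"
    using F by (intro Max_in; simp)+
  then obtain H K where H: "H \<in> F" "Max ((\<lambda>H. g H + p H) ` F) = g H + p H"
    and K: "K \<in> F" "Max ((\<lambda>H. g H - p H) ` F) = g K - p K" by auto
  have "g J + q J \<le> Max ((\<lambda>H. g H + q H) ` F)" "g J - q J \<le> Max ((\<lambda>H. g H - q H) ` F)" if "J \<in> F" for J
    using F that by (auto intro!: Max_ge)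
  from this[OF H(1)] this[OF K(1)] lip[OF H(1) K(1)] show ?thesis
    unfolding H(2) K(2) by linarith
qed

text \<open>The centred term is the average of \<open>g + 2 * E \<psi>\<close> and
  \<open>g - 2 * \<psi>\<close>. Moving the expectation outside the first maximum symmetrises a
  single sample without a ghost copy, and the resulting pair of maxima is the one that
  \<open>Max_contraction\<close> treats.\<close>

lemma (in prob_space) Max_symmetrize_contract:
  fixes f :: "'i \<Rightarrow> 'a \<Rightarrow> real" and \<psi> :: "real \<Rightarrow> real"
  assumes F: "finite F" "F \<noteq> {}"
    and f: "\<And>H. H \<in> F \<Longrightarrow> integrable M (f H)" and \<psi>f: "\<And>H. H \<in> F \<Longrightarrow> integrable M (\<lambda>x. \<psi> (f H x))"
    and lip: "\<And>s t. \<bar>\<psi> s - \<psi> t\<bar> \<le> \<bar>s - t\<bar>"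
  shows "(\<integral>x. Max ((\<lambda>H. g H + ((\<integral>x. \<psi> (f H x) \<partial>M) - \<psi> (f H x))) ` F) \<partial>M) \<le>
    (\<integral>x. (Max ((\<lambda>H. g H + 2 * f H x) ` F) + Max ((\<lambda>H. g H - 2 * f H x) ` F)) / 2 \<partial>M)"
proof -
  let ?P = "\<lambda>x. Max ((\<lambda>H. g H + 2 * \<psi> (f H x)) ` F)" and ?N = "\<lambda>x. Max ((\<lambda>H. g H - 2 * \<psi> (f H x)) ` F)"
  have PN: "integrable M ?P" "integrable M ?N"
    using F f \<psi>f by (auto intro!: integrable_Max)
  have fPN: "integrable M (\<lambda>x. Max ((\<lambda>H. g H + 2 * f H x) ` F))"
    "integrable M (\<lambda>x. Max ((\<lambda>H. g H - 2 * f H x) ` F))"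
    using F f by (auto intro!: integrable_Max)
  have "(\<integral>x. Max ((\<lambda>H. g H + ((\<integral>x. \<psi> (f H x) \<partial>M) - \<psi> (f H x))) ` F) \<partial>M) \<le>
      (\<integral>x. ((\<integral>x. ?P x \<partial>M) + ?N x) / 2 \<partial>M)"
  proof (rule integral_mono)
    show "integrable M (\<lambda>x. Max ((\<lambda>H. g H + ((\<integral>x. \<psi> (f H x) \<partial>M) - \<psi> (f H x))) ` F))"
      using F f \<psi>f by (auto intro!: integrable_Max)
    show "integrable M (\<lambda>x. ((\<integral>x. ?P x \<partial>M) + ?N x) / 2)" using PN by auto
    fix x
    show "Max ((\<lambda>H. g H + ((\<integral>x. \<psi> (f H x) \<partial>M) - \<psi> (f H x))) ` F) \<le> ((\<integral>x. ?P x \<partial>M) + ?N x) / 2"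
    proof (subst Max_le_iff, use F in simp, use F in simp, rule ballI)
      fix v assume "v \<in> (\<lambda>H. g H + ((\<integral>x. \<psi> (f H x) \<partial>M) - \<psi> (f H x))) ` F"
      then obtain H where H: "H \<in> F" "v = g H + ((\<integral>x. \<psi> (f H x) \<partial>M) - \<psi> (f H x))" by blast
      \<comment> \<open>Jensen: the mean for one fixed \<open>H\<close> is at most the mean of the
        maximum.\<close>
      have "(\<integral>x. g H + 2 * \<psi> (f H x) \<partial>M) \<le> (\<integral>x. ?P x \<partial>M)"
        using F H \<psi>f PN by (intro integral_mono) (auto intro!: Max_ge)
      then have "g H + 2 * (\<integral>x. \<psi> (f H x) \<partial>M) \<le> (\<integral>x. ?P x \<partial>M)"
        using H \<psi>f by (simp add: prob_space)
      moreover have "g H - 2 * \<psi> (f H x) \<le> ?N x" using F H by (auto intro!: Max_ge)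
      ultimately show "v \<le> ((\<integral>x. ?P x \<partial>M) + ?N x) / 2" unfolding H(2) by argo
    qed
  qed
  also have "\<dots> = (\<integral>x. (?P x + ?N x) / 2 \<partial>M)" using PN by (simp add: prob_space)
  also have "\<dots> \<le> (\<integral>x. (Max ((\<lambda>H. g H + 2 * f H x) ` F) + Max ((\<lambda>H. g H - 2 * f H x) ` F)) / 2 \<partial>M)"
  proof (rule integral_mono)
    fix x
    have "\<bar>2 * \<psi> s - 2 * \<psi> t\<bar> \<le> \<bar>2 * s - 2 * t\<bar>" for s t
      using lip[of s t] by linarith
    then have "?P x + ?N x \<le> Max ((\<lambda>H. g H + 2 * f H x) ` F) + Max ((\<lambda>H. g H - 2 * f H x) ` F)"
      by (intro Max_contraction F)
    then show "(?P x + ?N x) / 2 \<le> (Max ((\<lambda>H. g H + 2 * f H x) ` F) + Max ((\<lambda>H. g H - 2 * f H x) ` F)) / 2"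
      by (rule divide_right_mono) simp
  qed (use PN fPN in auto)
  finally show ?thesis .
qed

section \<open>Sub-Gaussian linear forms\<close>

text \<open>The linear term integrates to 0 for a centred variable, which leaves the exponential
  moment of the square.\<close>

lemma exp_le_add_exp_square:
  fixes y :: real
  shows "exp y \<le> y + exp (y\<^sup>2)"
proof -
  consider "\<bar>y\<bar> \<le> 1" | "y > 1" | "y < -1" by linarith
  then show ?thesis
  proof cases
    case 1
    have "exp y \<le> 1 + y + y\<^sup>2"
    proof (cases "0 \<le> y")
      case True
      then show ?thesis using 1 by (intro exp_bound) auto
    next
      case False
      have "1 / (1 - y + y\<^sup>2 / 2) \<le> 1 + y + y\<^sup>2"
      proof -
        have "0 \<le> y\<^sup>2 * (1 - y + y\<^sup>2) / 2" using False by (intro divide_nonneg_pos mult_nonneg_nonneg) auto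
        moreover have "(1 + y + y\<^sup>2) * (1 - y + y\<^sup>2 / 2) = 1 + y\<^sup>2 * (1 - y + y\<^sup>2) / 2"
          by (simp add: field_simps power2_eq_square)
        ultimately have "1 \<le> (1 + y + y\<^sup>2) * (1 - y + y\<^sup>2 / 2)" by linarith
        moreover have "0 < 1 - y + y\<^sup>2 / 2" using False by (smt (verit) zero_le_power2 divide_nonneg_pos)
        ultimately show ?thesis by (simp add: divide_le_eq)
      qed
      moreover have "exp y \<le> 1 / (1 - y + y\<^sup>2 / 2)"
      proof -
        have "1 - y + y\<^sup>2 / 2 \<le> exp (- y)"
          using exp_lower_Taylor_quadratic[of "- y"] False by simp
        moreover have "0 < 1 - y + y\<^sup>2 / 2" using False by (smt (verit) zero_le_power2 divide_nonneg_pos)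
        ultimately have "1 / exp (- y) \<le> 1 / (1 - y + y\<^sup>2 / 2)" by (intro divide_left_mono) auto
        then show ?thesis by (simp add: exp_minus field_simps)
      qed
      ultimately show ?thesis by linarith
    qed
    also have "\<dots> \<le> y + exp (y\<^sup>2)" using exp_ge_add_one_self[of "y\<^sup>2"] by linarith
    finally show ?thesis .
  next
    case 2
    then have "y \<le> y\<^sup>2" by (simp add: power2_eq_square)
    then have "exp y \<le> exp (y\<^sup>2)" by simp
    then show ?thesis using 2 by linarith
  next
    case 3
    then have "- y \<le> y\<^sup>2" using mult_left_mono[of 1 "- y" "- y"] by (simp add: power2_eq_square)
    then have "1 \<le> y + exp (y\<^sup>2)" using exp_ge_add_one_self[of "y\<^sup>2"] by linarith
    moreover have "exp y \<le> 1" using 3 by simp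
    ultimately show ?thesis by linarith
  qed
qed

text \<open>Convexity between 0 and \<open>u\<close>: only a fraction \<open>\<theta>\<close> of the
  exponential moment is spent.\<close>

lemma exp_mult_le_interpolate:
  fixes u \<theta> :: real
  assumes "0 \<le> \<theta>" "\<theta> \<le> 1"
  shows "exp (\<theta> * u) \<le> 1 - \<theta> + \<theta> * exp u"
  using convex_onD[OF convex_on_exp[of 1], of \<theta> 0 u] assms by simp

text \<open>Two regimes of \<open>\<theta> = t\<^sup>2 * K\<^sup>2\<close>. For
  \<open>\<theta> \<le> 1\<close> centring removes the linear term. For \<open>\<theta> > 1\<close>
  one uses \<open>2 * t * x \<le> \<theta> + x\<^sup>2 / K\<^sup>2\<close>, and the resulting factor
  \<open>3/2\<close> is below \<open>exp (\<theta> / 2)\<close>.\<close>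

lemma subgaussian_mgf:
  assumes D: "entry_distribution D"
    and K: "0 < K" "(\<integral>\<^sup>+ x. ennreal (exp (x\<^sup>2 / K\<^sup>2)) \<partial>D) \<le> 2"
  shows "(\<integral>\<^sup>+ x. ennreal (exp (t * x)) \<partial>D) \<le> ennreal (exp (t\<^sup>2 * K\<^sup>2))"
proof -
  interpret prob_space D using D by (simp add: entry_distribution_def)
  have sets [measurable_cong]: "sets D = sets borel" and x: "integrable D (\<lambda>x. x)" "(\<integral>x. x \<partial>D) = 0"
    using D by (auto simp: entry_distribution_def)
  define w where "w = (\<lambda>x. exp (x\<^sup>2 / K\<^sup>2))"
  have w: "integrable D w"
  proof (rule integrableI_nonneg)
    have "(\<integral>\<^sup>+ x. ennreal (w x) \<partial>D) \<le> 2" using K by (simp add: w_def)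
    then show "(\<integral>\<^sup>+ x. ennreal (w x) \<partial>D) < \<infinity>" by (simp add: le_less_trans)
  qed (auto simp: w_def)
  have w2: "(\<integral>x. w x \<partial>D) \<le> 2"
  proof -
    have "ennreal (\<integral>x. w x \<partial>D) = (\<integral>\<^sup>+ x. ennreal (w x) \<partial>D)"
      using w by (intro nn_integral_eq_integral[symmetric]) (auto simp: w_def)
    also have "\<dots> \<le> ennreal 2" using K by (simp add: w_def)
    finally show ?thesis by (subst (asm) ennreal_le_iff) simp_all
  qed
  have bound: "(\<integral>\<^sup>+ x. ennreal (exp (t * x)) \<partial>D) \<le> ennreal B"
    if "integrable D h" "\<And>x. exp (t * x) \<le> h x" "(\<integral>x. h x \<partial>D) \<le> B" for h B
  proof -
    have "(\<integral>\<^sup>+ x. ennreal (exp (t * x)) \<partial>D) \<le> (\<integral>\<^sup>+ x. ennreal (h x) \<partial>D)"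
      using that by (intro nn_integral_mono ennreal_leI) auto
    also have "\<dots> = ennreal (\<integral>x. h x \<partial>D)"
      using that by (intro nn_integral_eq_integral AE_I2) (auto intro: order_trans[OF exp_ge_zero])
    also have "\<dots> \<le> ennreal B" using that by (intro ennreal_leI)
    finally show ?thesis .
  qed
  define \<theta> where "\<theta> = t\<^sup>2 * K\<^sup>2"
  have \<theta>0: "0 \<le> \<theta>" by (simp add: \<theta>_def)
  have sq: "(t * x)\<^sup>2 = \<theta> * (x\<^sup>2 / K\<^sup>2)" for x
    using K by (simp add: \<theta>_def field_simps power_mult_distrib)
  show ?thesis
  proof (cases "\<theta> \<le> 1")
    case True
    show ?thesis
    proof (rule bound[of "\<lambda>x. t * x + (1 - \<theta>) + \<theta> * w x"])
      show "integrable D (\<lambda>x. t * x + (1 - \<theta>) + \<theta> * w x)" using x w by simp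
      fix x
      show "exp (t * x) \<le> t * x + (1 - \<theta>) + \<theta> * w x"
        using exp_le_add_exp_square[of "t * x"] exp_mult_le_interpolate[OF \<theta>0 True, of "x\<^sup>2 / K\<^sup>2"]
        by (simp add: sq w_def)
    next
      have "(\<integral>x. t * x + (1 - \<theta>) + \<theta> * w x \<partial>D) = 1 - \<theta> + \<theta> * (\<integral>x. w x \<partial>D)"
        using x w by (simp add: prob_space)
      also have "\<dots> \<le> 1 - \<theta> + \<theta> * 2" using w2 \<theta>0 by (intro add_left_mono mult_left_mono)
      also have "\<dots> \<le> exp \<theta>" using exp_ge_add_one_self[of \<theta>] by linarith
      finally show "(\<integral>x. t * x + (1 - \<theta>) + \<theta> * w x \<partial>D) \<le> exp (t\<^sup>2 * K\<^sup>2)" by (simp add: \<theta>_def)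
    qed
  next
    case False
    show ?thesis
    proof (rule bound[of "\<lambda>x. exp (\<theta> / 2) * (1 / 2 + 1 / 2 * w x)"])
      show "integrable D (\<lambda>x. exp (\<theta> / 2) * (1 / 2 + 1 / 2 * w x))" using w by simp
      fix x
      have "2 * (t * x) \<le> \<theta> + x\<^sup>2 / K\<^sup>2"
        using sum_squares_bound[of "t * K" "x / K"] K by (simp add: \<theta>_def power_mult_distrib power_divide)
      then have "exp (t * x) \<le> exp (\<theta> / 2 + 1 / 2 * (x\<^sup>2 / K\<^sup>2))" by simp
      also have "\<dots> \<le> exp (\<theta> / 2) * (1 / 2 + 1 / 2 * w x)"
        unfolding exp_add using exp_mult_le_interpolate[of "1 / 2" "x\<^sup>2 / K\<^sup>2"]
        by (intro mult_left_mono) (auto simp: w_def)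
      finally show "exp (t * x) \<le> exp (\<theta> / 2) * (1 / 2 + 1 / 2 * w x)" .
    next
      have "(\<integral>x. exp (\<theta> / 2) * (1 / 2 + 1 / 2 * w x) \<partial>D) = exp (\<theta> / 2) * (1 / 2 + 1 / 2 * (\<integral>x. w x \<partial>D))"
        using w by (simp add: prob_space)
      also have "\<dots> \<le> exp (\<theta> / 2) * exp (\<theta> / 2)"
      proof (rule mult_left_mono)
        show "1 / 2 + 1 / 2 * (\<integral>x. w x \<partial>D) \<le> exp (\<theta> / 2)"
          using w2 False exp_ge_add_one_self[of "\<theta> / 2"] by linarith
      qed simp
      also have "\<dots> = exp \<theta>" by (simp add: exp_add[symmetric])
      finally show "(\<integral>x. exp (\<theta> / 2) * (1 / 2 + 1 / 2 * w x) \<partial>D) \<le> exp (t\<^sup>2 * K\<^sup>2)" by (simp add: \<theta>_def)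
    qed
  qed
qed

lemma measurable_ip_iid [measurable]:
  assumes "sets D = sets borel"
  shows "(\<lambda>x. ip n u x) \<in> borel_measurable (iid D n)"
proof -
  have "(\<lambda>x. x i) \<in> borel_measurable (iid D n)" if "i < n" for i
    using that measurable_component_singleton[of i "{..<n}" "\<lambda>_. D"] assms
    by (auto cong: measurable_cong_sets)
  then show ?thesis unfolding ip_def by (intro borel_measurable_sum borel_measurable_times) auto
qed

lemma subgaussian_linear_mgf:
  assumes D: "entry_distribution D"
    and K: "0 < K" "(\<integral>\<^sup>+ x. ennreal (exp (x\<^sup>2 / K\<^sup>2)) \<partial>D) \<le> 2"
  shows "(\<integral>\<^sup>+ x. ennreal (exp (t * ip n u x)) \<partial>iid D n) \<le> ennreal (exp (t\<^sup>2 * K\<^sup>2 * ip n u u))"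
proof -
  interpret D: prob_space D using D by (simp add: entry_distribution_def)
  interpret product_sigma_finite "\<lambda>_. D" ..
  have [measurable_cong]: "sets D = sets borel" using D by (simp add: entry_distribution_def)
  have "(\<integral>\<^sup>+ x. ennreal (exp (t * ip n u x)) \<partial>iid D n) =
      (\<integral>\<^sup>+ x. (\<Prod>i<n. ennreal (exp ((t * u i) * x i))) \<partial>iid D n)"
    by (intro nn_integral_cong)
       (simp add: prod_ennreal exp_sum[symmetric] ip_def sum_distrib_left mult.assoc)
  also have "\<dots> = (\<Prod>i<n. \<integral>\<^sup>+ x. ennreal (exp ((t * u i) * x)) \<partial>D)"
    by (intro product_nn_integral_prod) auto
  also have "\<dots> \<le> (\<Prod>i<n. ennreal (exp ((t * u i)\<^sup>2 * K\<^sup>2)))"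
  proof -
    have prod_le: "(\<Prod>i<n. f i) \<le> (\<Prod>i<n. g i)" if "\<And>i. f i \<le> g i" for f g :: "nat \<Rightarrow> ennreal"
      by (induction n) (auto intro!: mult_mono that)
    show ?thesis by (rule prod_le, rule subgaussian_mgf[OF D K])
  qed
  also have "\<dots> = ennreal (exp (t\<^sup>2 * K\<^sup>2 * ip n u u))"
    by (simp add: prod_ennreal exp_sum[symmetric] ip_def sum_distrib_left power2_eq_square mult_ac)
  finally show ?thesis .
qed

text \<open>A discrete substitute for the Gaussian linearisation of \<open>exp (v\<^sup>2)\<close>: the term with
  \<open>k = \<lfloor>2 \<bar>v\<bar>\<rfloor>\<close> alone dominates the left-hand side.\<close>
lemma exp_square_le_suminf:
  fixes v :: real
  shows "ennreal (exp (v\<^sup>2)) \<le>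
    (\<Sum>k. ennreal (exp (1/4 - (real k)\<^sup>2 / 4)) * (ennreal (exp (real k * v)) + ennreal (exp (- real k * v))))"
proof -
  define k where "k = nat \<lfloor>2 * \<bar>v\<bar>\<rfloor>"
  have k: "real k \<le> 2 * \<bar>v\<bar>" "2 * \<bar>v\<bar> < real k + 1"
    unfolding k_def by (simp_all add: of_nat_nat)
  have "(\<bar>v\<bar> - real k / 2)\<^sup>2 \<le> (1/2)\<^sup>2" using k by (intro power_mono) auto
  then have "v\<^sup>2 \<le> (1/4 - (real k)\<^sup>2 / 4) + real k * \<bar>v\<bar>"
  proof -
    have "(\<bar>v\<bar> - real k / 2)\<^sup>2 = v\<^sup>2 - real k * \<bar>v\<bar> + (real k)\<^sup>2 / 4"
      by (simp add: power2_diff power_divide)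
    moreover have "(1/2)\<^sup>2 = (1/4 :: real)" by (simp add: power_divide)
    ultimately show ?thesis using \<open>(\<bar>v\<bar> - real k / 2)\<^sup>2 \<le> (1/2)\<^sup>2\<close> by linarith
  qed
  then have "exp (v\<^sup>2) \<le> exp (1/4 - (real k)\<^sup>2 / 4) * exp (real k * \<bar>v\<bar>)" by (simp add: exp_add[symmetric])
  also have "\<dots> \<le> exp (1/4 - (real k)\<^sup>2 / 4) * (exp (real k * v) + exp (- real k * v))"
    by (intro mult_left_mono) (auto simp: abs_if)
  finally have "ennreal (exp (v\<^sup>2)) \<le>
      ennreal (exp (1/4 - (real k)\<^sup>2 / 4)) * (ennreal (exp (real k * v)) + ennreal (exp (- real k * v)))"
    by (simp add: ennreal_mult[symmetric] ennreal_plus[symmetric] ennreal_leI del: ennreal_plus)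
  also have "\<dots> = (\<Sum>k\<in>{k}. ennreal (exp (1/4 - (real k)\<^sup>2 / 4)) * (ennreal (exp (real k * v)) + ennreal (exp (- real k * v))))"
    by simp
  also have "\<dots> \<le> (\<Sum>k. ennreal (exp (1/4 - (real k)\<^sup>2 / 4)) * (ennreal (exp (real k * v)) + ennreal (exp (- real k * v))))"
    by (rule sum_le_suminf) auto
  finally show ?thesis .
qed

text \<open>Integrating the discrete linearisation term by term, the weight
  \<open>exp (- k\<^sup>2 / 4)\<close> meets a moment generating function of size
  \<open>exp (k\<^sup>2 / 8)\<close>, and the series is dominated by a geometric one. Neither
  constant depends on the dimension.\<close>

lemma subgaussian_linear_square_mgf:
  assumes D: "entry_distribution D"
  obtains s C where "0 < s" "0 < C"
    "\<And>n u. ip n u u \<le> 1 \<Longrightarrow> (\<integral>\<^sup>+ x. ennreal (exp (s * (ip n u x)\<^sup>2)) \<partial>iid D n) \<le> ennreal C"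
proof -
  obtain K where K: "0 < K" "(\<integral>\<^sup>+ x. ennreal (exp (x\<^sup>2 / K\<^sup>2)) \<partial>D) \<le> 2"
    using D by (auto simp: entry_distribution_def sub_gaussian_def)
  have sets: "sets D = sets borel" using D by (simp add: entry_distribution_def)
  \<comment> \<open>Makes the growth of the generating function, \<open>exp (k\<^sup>2 / 8)\<close>,
    consume half of the Gaussian decay. The other half is at most \<open>r ^ k\<close>, since
    \<open>k \<le> k\<^sup>2\<close>.\<close>
  define s where "s = 1 / (8 * K\<^sup>2)"
  define r where "r = exp (- 1 / 8 :: real)"
  define C where "C = (\<Sum>k. 2 * exp (1/4) * r ^ k)"
  have sm: "summable (\<lambda>k. 2 * exp (1/4) * r ^ k)"
    by (intro summable_mult summable_geometric) (simp add: r_def)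
  have "0 < C" unfolding C_def by (rule suminf_pos[OF sm]) (simp add: r_def)
  have s: "0 < s" using K by (simp add: s_def)
  have "(\<integral>\<^sup>+ x. ennreal (exp (s * (ip n u x)\<^sup>2)) \<partial>iid D n) \<le> ennreal C" if u: "ip n u u \<le> 1" for n u
  proof -
    note [measurable] = measurable_ip_iid[OF sets]
    define c where "c = sqrt s"
    have c2: "c\<^sup>2 = s" using s by (simp add: c_def)
    let ?e = "\<lambda>k::nat. ennreal (exp (1/4 - (real k)\<^sup>2 / 4))"
    have mgf: "(\<integral>\<^sup>+ x. ennreal (exp (t * (c * ip n u x))) \<partial>iid D n) \<le> ennreal (exp (t\<^sup>2 / 8))" for t
    proof -
      have "(\<integral>\<^sup>+ x. ennreal (exp ((t * c) * ip n u x)) \<partial>iid D n) \<le> ennreal (exp ((t * c)\<^sup>2 * K\<^sup>2 * ip n u u))"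
        by (rule subgaussian_linear_mgf[OF D K])
      also have "(t * c)\<^sup>2 * K\<^sup>2 * ip n u u \<le> t\<^sup>2 / 8"
        using u K mult_left_mono[OF u, of "t\<^sup>2 / 8"]
        by (simp add: power_mult_distrib c2 s_def field_simps)
      finally show ?thesis by (simp add: mult.assoc ennreal_leI)
    qed
    have "(\<integral>\<^sup>+ x. ennreal (exp (s * (ip n u x)\<^sup>2)) \<partial>iid D n) \<le>
       (\<integral>\<^sup>+ x. (\<Sum>k. ?e k * (ennreal (exp (real k * (c * ip n u x))) + ennreal (exp (- real k * (c * ip n u x))))) \<partial>iid D n)"
      using exp_square_le_suminf[of "c * ip n u _"] by (intro nn_integral_mono) (simp add: power_mult_distrib c2)
    also have "\<dots> = (\<Sum>k. \<integral>\<^sup>+ x. ?e k * (ennreal (exp (real k * (c * ip n u x))) + ennreal (exp (- real k * (c * ip n u x)))) \<partial>iid D n)"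
      by (intro nn_integral_suminf) measurable
    also have "\<dots> \<le> (\<Sum>k. ennreal (2 * exp (1/4) * r ^ k))"
    proof (intro suminf_le)
      fix k :: nat
      have "(\<integral>\<^sup>+ x. ?e k * (ennreal (exp (real k * (c * ip n u x))) + ennreal (exp (- real k * (c * ip n u x)))) \<partial>iid D n)
         = ?e k * ((\<integral>\<^sup>+ x. ennreal (exp (real k * (c * ip n u x))) \<partial>iid D n) +
            (\<integral>\<^sup>+ x. ennreal (exp (- real k * (c * ip n u x))) \<partial>iid D n))"
        by (subst nn_integral_cmult, measurable, subst nn_integral_add) measurable
      also have "\<dots> \<le> ?e k * (ennreal (exp ((real k)\<^sup>2 / 8)) + ennreal (exp ((real k)\<^sup>2 / 8)))"
        using mgf[of "real k"] mgf[of "- real k"] by (intro mult_left_mono add_mono) auto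
      also have "\<dots> = ennreal (2 * exp (1/4) * exp (- (real k)\<^sup>2 / 8))"
        by (simp add: ennreal_mult[symmetric] ennreal_plus[symmetric] exp_add[symmetric] exp_diff field_simps
            del: ennreal_plus)
      also have "\<dots> \<le> ennreal (2 * exp (1/4) * r ^ k)"
      proof (intro ennreal_leI mult_left_mono)
        have "real k \<le> (real k)\<^sup>2" by (cases k) (auto simp: power2_eq_square)
        then show "exp (- (real k)\<^sup>2 / 8) \<le> r ^ k" by (simp add: r_def exp_of_nat_mult[symmetric])
      qed simp
      finally show "(\<integral>\<^sup>+ x. ?e k * (ennreal (exp (real k * (c * ip n u x))) + ennreal (exp (- real k * (c * ip n u x)))) \<partial>iid D n)
         \<le> ennreal (2 * exp (1/4) * r ^ k)" .
    qed auto
    also have "\<dots> = ennreal C"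
      unfolding C_def by (rule suminf_ennreal2[OF _ sm]) (simp add: r_def)
    finally show ?thesis .
  qed
  then show thesis using that[OF s \<open>0 < C\<close>] by blast
qed

text \<open>After normalising \<open>u\<close>, apply \<open>z\<^sup>2 / 2 \<le> exp z\<close> to
  \<open>z = s * (ip n v x)\<^sup>2\<close>.\<close>

lemma subgaussian_linear_fourth_moment:
  assumes D: "entry_distribution D"
  obtains C where "0 < C"
    "\<And>n u. (\<integral>\<^sup>+ x. ennreal ((ip n u x) ^ 4) \<partial>iid D n) \<le> ennreal (C * (ip n u u)\<^sup>2)"
proof -
  obtain s C where s: "0 < s" and C: "0 < C"
    and sq: "\<And>n u. ip n u u \<le> 1 \<Longrightarrow> (\<integral>\<^sup>+ x. ennreal (exp (s * (ip n u x)\<^sup>2)) \<partial>iid D n) \<le> ennreal C"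
    using subgaussian_linear_square_mgf[OF D] by blast
  have sets: "sets D = sets borel" using D by (simp add: entry_distribution_def)
  have "(\<integral>\<^sup>+ x. ennreal ((ip n u x) ^ 4) \<partial>iid D n) \<le> ennreal (2 / s\<^sup>2 * C * (ip n u u)\<^sup>2)" for n u
  proof (cases "ip n u u = 0")
    case True
    then have "ip n u x = 0" for x by (simp add: ip_self_eq_0) (simp add: ip_def)
    then show ?thesis by simp
  next
    case False
    note [measurable] = measurable_ip_iid[OF sets]
    define N where "N = sqrt (ip n u u)"
    have N: "0 < N" using False ip_self_nonneg[of n u] by (simp add: N_def)
    have NN: "N * N = ip n u u" using ip_self_nonneg[of n u] by (simp add: N_def)
    define v where "v = (\<lambda>i. (1 / N) * u i)"
    have v: "ip n v v = 1" using N unfolding v_def ip_scale_left ip_scale_right NN[symmetric] by simp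
    have vx: "ip n v x = ip n u x / N" for x unfolding v_def ip_scale_left by simp
    have pt: "(ip n u x) ^ 4 \<le> N ^ 4 * (2 / s\<^sup>2) * exp (s * (ip n v x)\<^sup>2)" for x
    proof -
      have "(s * (ip n v x)\<^sup>2)\<^sup>2 / 2 \<le> exp (s * (ip n v x)\<^sup>2)"
      proof -
        have "0 \<le> s * (ip n v x)\<^sup>2" using s by simp
        then show ?thesis using exp_lower_Taylor_quadratic[of "s * (ip n v x)\<^sup>2"] by linarith
      qed
      then have "s\<^sup>2 * (ip n v x) ^ 4 \<le> 2 * exp (s * (ip n v x)\<^sup>2)"
        by (simp add: power_mult_distrib)
      then have "(ip n v x) ^ 4 \<le> 2 / s\<^sup>2 * exp (s * (ip n v x)\<^sup>2)" using s by (simp add: field_simps)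
      then have "N ^ 4 * (ip n v x) ^ 4 \<le> N ^ 4 * (2 / s\<^sup>2 * exp (s * (ip n v x)\<^sup>2))"
        using N by (intro mult_left_mono) auto
      moreover have "N ^ 4 * (ip n v x) ^ 4 = (ip n u x) ^ 4" using N by (simp add: vx power_divide)
      ultimately show ?thesis by (simp add: mult.assoc)
    qed
    have "(\<integral>\<^sup>+ x. ennreal ((ip n u x) ^ 4) \<partial>iid D n) \<le>
        (\<integral>\<^sup>+ x. ennreal (N ^ 4 * (2 / s\<^sup>2)) * ennreal (exp (s * (ip n v x)\<^sup>2)) \<partial>iid D n)"
      using pt N s by (intro nn_integral_mono) (simp add: ennreal_mult[symmetric] ennreal_leI)
    also have "\<dots> = ennreal (N ^ 4 * (2 / s\<^sup>2)) * (\<integral>\<^sup>+ x. ennreal (exp (s * (ip n v x)\<^sup>2)) \<partial>iid D n)"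
      by (intro nn_integral_cmult) measurable
    also have "\<dots> \<le> ennreal (N ^ 4 * (2 / s\<^sup>2)) * ennreal C"
      using v by (intro mult_left_mono sq) auto
    also have "\<dots> = ennreal (2 / s\<^sup>2 * C * (ip n u u)\<^sup>2)"
      using N C by (simp add: ennreal_mult[symmetric] NN[symmetric] power2_eq_square power4_eq_xxxx mult_ac)
    finally show ?thesis .
  qed
  then show thesis using that[of "2 / s\<^sup>2 * C"] s C by simp
qed

text \<open>Averaging over a sign cancels the first-order term. The factor \<open>z\<^sup>2\<close>
  of the second-order term is absorbed by an exponential at rate \<open>s1\<close>, which is
  possible because \<open>s\<close> uses at most half of that rate.\<close>

lemma cosh_le_quadratic_exp:
  fixes s s1 z :: real
  assumes "0 < s1" "\<bar>s\<bar> \<le> s1 / 2" "0 \<le> z"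
  shows "(exp (s * z) + exp (- s * z)) / 2 \<le> 1 + 4 * (s / s1)\<^sup>2 * exp (s1 * z)"
proof -
  have taylor: "exp x \<le> 1 + x + x\<^sup>2 / 2 * exp \<bar>x\<bar>" for x :: real
  proof -
    obtain t where t: "\<bar>t\<bar> \<le> \<bar>x\<bar>" "exp x = (\<Sum>m<2. x ^ m / fact m) + exp t / fact 2 * x\<^sup>2"
      using Maclaurin_exp_le[of x 2] by blast
    have "exp t \<le> exp \<bar>x\<bar>" using t(1) by simp
    then have "exp t * x\<^sup>2 \<le> exp \<bar>x\<bar> * x\<^sup>2" by (intro mult_right_mono) auto
    then show ?thesis unfolding t(2) by (simp add: numeral_2_eq_2 algebra_simps)
  qed
  define w where "w = s1 * z"
  have w: "0 \<le> w" using assms by (simp add: w_def)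
  have sz: "\<bar>s * z\<bar> \<le> w / 2" using assms mult_right_mono[OF assms(2,3)] by (simp add: w_def abs_mult)
  have "(exp (s * z) + exp (- s * z)) / 2 \<le> 1 + (s * z)\<^sup>2 / 2 * exp \<bar>s * z\<bar>"
    using taylor[of "s * z"] taylor[of "- (s * z)"] by simp
  also have "\<dots> \<le> 1 + (s * z)\<^sup>2 / 2 * exp (w / 2)"
    using sz by (intro add_left_mono mult_left_mono) auto
  also have "(s * z)\<^sup>2 / 2 = 4 * (s / s1)\<^sup>2 * ((w / 2)\<^sup>2 / 2)"
    using assms by (simp add: w_def field_simps power2_eq_square)
  also have "1 + 4 * (s / s1)\<^sup>2 * ((w / 2)\<^sup>2 / 2) * exp (w / 2) \<le> 1 + 4 * (s / s1)\<^sup>2 * exp (w / 2) * exp (w / 2)"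
    using exp_lower_Taylor_quadratic[of "w / 2"] w
    by (intro add_left_mono mult_right_mono mult_left_mono) auto
  also have "\<dots> = 1 + 4 * (s / s1)\<^sup>2 * exp (s1 * z)" by (simp add: w_def mult.assoc exp_add[symmetric])
  finally show ?thesis .
qed

section \<open>Signed Gram matrices\<close>

text \<open>Divided by \<open>4 * sqrt n\<close>, these are the points of a grid inside the unit
  ball, of mesh \<open>1 / (4 * sqrt n)\<close>, so that rounding each coordinate moves a vector by
  at most \<open>1/4\<close> in norm. The explicit grid makes covering and cardinality elementary
  counts.\<close>

definition lattice_points :: "nat \<Rightarrow> (nat \<Rightarrow> int) set" where
  "lattice_points n = {z \<in> PiE {..<n} (\<lambda>_. {- int (4 * n)..int (4 * n)}). (\<Sum>i<n. (z i)\<^sup>2) \<le> 16 * int n}"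

definition ball_net :: "nat \<Rightarrow> (nat \<Rightarrow> real) set" where
  "ball_net n = (\<lambda>z i. of_int (z i) / (4 * sqrt (real n))) ` lattice_points n"

lemma finite_lattice_points: "finite (lattice_points n)"
proof (rule finite_subset)
  show "lattice_points n \<subseteq> PiE {..<n} (\<lambda>_. {- int (4 * n)..int (4 * n)})"
    by (auto simp: lattice_points_def)
qed (simp add: finite_PiE)

lemma sum_half_powers: "(\<Sum>k\<in>{- int R..int R}. (1/2::real) ^ nat \<bar>k\<bar>) = 3 - 2 * (1/2) ^ R"
proof (induction R)
  case (Suc R)
  have "{- int (Suc R)..int (Suc R)} = insert (- int (Suc R)) (insert (int (Suc R)) {- int R..int R})"
    by auto
  then show ?case using Suc by (simp add: nat_add_distrib)
qed simp

text \<open>Each admissible lattice point has weight at least \<open>1\<close> under the product weight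
  \<open>2 ^ (16 n) * (\<Prod>i. 2 ^ (- \<bar>z i\<bar>))\<close>, whose total mass factorises.\<close>
lemma card_ball_net: "real (card (ball_net n)) \<le> exp (18 * real n)"
proof -
  let ?P = "PiE {..<n} (\<lambda>_. {- int (4 * n)..int (4 * n)})"
  have ge: "1 \<le> 2 ^ (16 * n) * (\<Prod>i<n. (1/2::real) ^ nat \<bar>z i\<bar>)" if "z \<in> lattice_points n" for z
  proof -
    have "\<bar>k\<bar> \<le> k\<^sup>2" for k :: int
    proof (cases "k = 0")
      case False
      then have "\<bar>k\<bar> * 1 \<le> \<bar>k\<bar> * \<bar>k\<bar>" by (intro mult_left_mono) auto
      then show ?thesis by (simp add: power2_eq_square)
    qed simp
    then have "(\<Sum>i<n. \<bar>z i\<bar>) \<le> (\<Sum>i<n. (z i)\<^sup>2)" by (intro sum_mono)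
    also have "\<dots> \<le> 16 * int n" using that by (simp add: lattice_points_def)
    finally have "int (\<Sum>i<n. nat \<bar>z i\<bar>) \<le> int (16 * n)" by simp
    then have le: "(\<Sum>i<n. nat \<bar>z i\<bar>) \<le> 16 * n" by (simp only: of_nat_le_iff)
    have "(\<Prod>i<n. (1/2::real) ^ nat \<bar>z i\<bar>) = (1/2) ^ (\<Sum>i<n. nat \<bar>z i\<bar>)" by (simp add: power_sum)
    also have "\<dots> \<ge> (1/2) ^ (16 * n)" using le by (intro power_decreasing) auto
    finally have "(1/2::real) ^ (16 * n) \<le> (\<Prod>i<n. (1/2) ^ nat \<bar>z i\<bar>)" .
    then have "2 ^ (16 * n) * (1/2::real) ^ (16 * n) \<le> 2 ^ (16 * n) * (\<Prod>i<n. (1/2) ^ nat \<bar>z i\<bar>)"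
      by (intro mult_left_mono) auto
    then show ?thesis by (simp add: power_mult_distrib[symmetric])
  qed
  have "real (card (ball_net n)) \<le> real (card (lattice_points n))"
    unfolding ball_net_def using card_image_le[OF finite_lattice_points] by simp
  also have "\<dots> = (\<Sum>z\<in>lattice_points n. 1)" by simp
  also have "\<dots> \<le> (\<Sum>z\<in>lattice_points n. 2 ^ (16 * n) * (\<Prod>i<n. (1/2::real) ^ nat \<bar>z i\<bar>))"
    by (intro sum_mono ge)
  also have "\<dots> \<le> (\<Sum>z\<in>?P. 2 ^ (16 * n) * (\<Prod>i<n. (1/2::real) ^ nat \<bar>z i\<bar>))"
  proof (rule sum_mono2)
    show "finite ?P" by (intro finite_PiE) auto
    show "lattice_points n \<subseteq> ?P" unfolding lattice_points_def by (rule Collect_restrict)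
  qed (intro mult_nonneg_nonneg prod_nonneg; simp)
  also have "\<dots> = 2 ^ (16 * n) * (\<Prod>i<n. \<Sum>k\<in>{- int (4 * n)..int (4 * n)}. (1/2::real) ^ nat \<bar>k\<bar>)"
    unfolding sum_distrib_left[symmetric] by (subst prod_sum_PiE) simp_all
  also have "\<dots> = 2 ^ (16 * n) * (3 - 2 * (1/2) ^ (4 * n)) ^ n"
    by (subst sum_half_powers) simp
  also have "\<dots> \<le> 2 ^ (16 * n) * (2 ^ 2) ^ n"
  proof -
    have "(1/2::real) ^ (4 * n) \<le> 1" by (rule power_le_one) auto
    moreover have "0 \<le> (1/2::real) ^ (4 * n)" by simp
    ultimately have "0 \<le> 3 - 2 * (1/2::real) ^ (4 * n)" "3 - 2 * (1/2::real) ^ (4 * n) \<le> 4" by linarith+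
    then show ?thesis by (intro mult_left_mono power_mono) auto
  qed
  also have "\<dots> = (2::real) ^ (18 * n)" by (simp only: power_mult[symmetric] power_add[symmetric]) simp
  also have "\<dots> \<le> exp 1 ^ (18 * n)"
    using exp_ge_add_one_self[of 1] by (intro power_mono) auto
  also have "\<dots> = exp (18 * real n)" by (simp add: exp_of_nat_mult[symmetric])
  finally show ?thesis .
qed

lemma ball_net_covers:
  assumes n: "0 < n" and u: "ip n u u \<le> 1"
  obtains v where "v \<in> ball_net n" "ip n v v \<le> 1" "ip n (\<lambda>i. u i - v i) (\<lambda>i. u i - v i) \<le> 1 / 16"
proof -
  define t where "t = (\<lambda>i. 4 * sqrt (real n) * u i)"
  \<comment> \<open>Rounding towards 0 keeps the norm from growing, so the rounded vector stays in
    the ball. Beyond \<open>n\<close> the value is \<open>undefined\<close>, as \<open>PiE\<close>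
    demands.\<close>
  define z where "z = (\<lambda>i. if i < n then (if 0 \<le> t i then \<lfloor>t i\<rfloor> else \<lceil>t i\<rceil>) else undefined)"
  define v where "v = (\<lambda>i. of_int (z i) / (4 * sqrt (real n)))"
  have q: "0 < 4 * sqrt (real n)" using n by simp
  have z1: "\<bar>of_int (z i)\<bar> \<le> \<bar>t i\<bar>" and z2: "\<bar>t i - of_int (z i)\<bar> \<le> 1" if "i < n" for i
  proof -
    show "\<bar>of_int (z i)\<bar> \<le> \<bar>t i\<bar>"
    proof (cases "0 \<le> t i")
      case True
      then have "0 \<le> \<lfloor>t i\<rfloor>" by simp
      then show ?thesis using that True of_int_floor_le[of "t i"] by (simp add: z_def)
    next
      case False
      then have "\<lceil>t i\<rceil> \<le> 0" by simp
      then show ?thesis using that False le_of_int_ceiling[of "t i"] by (simp add: z_def)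
    qed
    show "\<bar>t i - of_int (z i)\<bar> \<le> 1"
      using that by (auto simp: z_def abs_le_iff) linarith+
  qed
  have t2: "(\<Sum>i<n. (t i)\<^sup>2) = 16 * real n * ip n u u"
  proof -
    have "(t i)\<^sup>2 = 16 * real n * (u i * u i)" for i
      unfolding t_def power_mult_distrib by (simp add: power2_eq_square[of "u i"])
    then show ?thesis by (simp add: ip_def sum_distrib_left)
  qed
  have zz: "(\<Sum>i<n. (of_int (z i))\<^sup>2) \<le> 16 * real n * ip n u u"
    unfolding t2[symmetric] using z1 by (intro sum_mono) (simp add: abs_le_square_iff)
  also have "\<dots> \<le> 16 * real n * 1" using u by (intro mult_left_mono) auto
  finally have zzn: "(\<Sum>i<n. (of_int (z i))\<^sup>2) \<le> 16 * real n" by simp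
  then have "real_of_int (\<Sum>i<n. (z i)\<^sup>2) \<le> real_of_int (16 * int n)" by simp
  then have zint: "(\<Sum>i<n. (z i)\<^sup>2) \<le> 16 * int n" by (simp only: of_int_le_iff)
  have zi: "\<bar>z i\<bar> \<le> int (4 * n)" if "i < n" for i
  proof -
    have "(z i)\<^sup>2 \<le> (\<Sum>i<n. (z i)\<^sup>2)" using that by (intro member_le_sum) auto
    also note zint
    also have "16 * int n \<le> (int (4 * n))\<^sup>2" using n by (simp add: power2_eq_square)
    finally show ?thesis using abs_le_square_iff[of "z i" "int (4 * n)"] by simp
  qed
  have "z \<in> lattice_points n"
    unfolding lattice_points_def using zint zi by (auto simp: PiE_iff extensional_def z_def abs_le_iff minus_le_iff)
  then have "v \<in> ball_net n" unfolding ball_net_def v_def by blast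
  moreover have "ip n v v \<le> 1"
  proof -
    have "ip n v v = (\<Sum>i<n. (of_int (z i))\<^sup>2) / (16 * real n)"
      by (simp add: ip_def v_def sum_divide_distrib power2_eq_square)
    then show ?thesis using zzn n by simp
  qed
  moreover have "ip n (\<lambda>i. u i - v i) (\<lambda>i. u i - v i) \<le> 1 / 16"
  proof -
    have "(u i - v i)\<^sup>2 \<le> 1 / (16 * real n)" if "i < n" for i
    proof -
      have "u i - v i = (t i - of_int (z i)) / (4 * sqrt (real n))" using n by (simp add: t_def v_def field_simps)
      then have "(u i - v i)\<^sup>2 = (t i - of_int (z i))\<^sup>2 / (16 * real n)"
        by (simp add: power_divide power_mult_distrib)
      also have "\<dots> \<le> 1 / (16 * real n)" using z2[OF that] by (intro divide_right_mono) (auto simp: abs_square_le_1)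
      finally show ?thesis .
    qed
    then have "ip n (\<lambda>i. u i - v i) (\<lambda>i. u i - v i) \<le> (\<Sum>i<n. 1 / (16 * real n))"
      unfolding ip_def power2_eq_square[symmetric] by (intro sum_mono) auto
    also have "\<dots> = 1 / 16" using n by simp
    finally show ?thesis .
  qed
  ultimately show thesis by (rule that)
qed

text \<open>Let \<open>y\<close> be a unit eigenvector for the eigenvalue of largest modulus
  \<open>L\<close>, and \<open>v\<close> a net point within \<open>1/4\<close>. The forms at
  \<open>y\<close> and \<open>v\<close> differ by the bilinear form at \<open>y - v\<close> and
  \<open>y + v\<close>, that is by at most \<open>L / 2\<close>, so the net sees at least
  \<open>L / 2\<close>.\<close>

lemma ball_net_quadratic_bound:
  assumes n: "0 < n" and B: "symm_on n B"
    and net: "\<And>v. v \<in> ball_net n \<Longrightarrow> \<bar>ip n v (mv n B v)\<bar> \<le> \<beta>"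
  shows "\<bar>ip n x (mv n B x)\<bar> \<le> 2 * \<beta> * ip n x x"
proof -
  obtain u lam where u: "orthonormal n {..<n} u"
    and eig: "\<And>a i. a < n \<Longrightarrow> i < n \<Longrightarrow> mv n B (u a) i = lam a * u a i"
    using symmetric_eigenbasis[OF B] by blast
  have Bu: "ip n (u a) (mv n B x) = lam a * ip n (u a) x" if "a < n" for a x
  proof -
    have "ip n (u a) (mv n B x) = ip n (\<lambda>i. lam a * u a i) x"
      unfolding ip_mv_symm[OF B] using eig[OF that] by (intro ip_cong) auto
    then show ?thesis by (simp add: ip_scale_left)
  qed
  define L where "L = Max ((\<lambda>a. \<bar>lam a\<bar>) ` {..<n})"
  have fin: "finite ((\<lambda>a. \<bar>lam a\<bar>) ` {..<n})" "(\<lambda>a. \<bar>lam a\<bar>) ` {..<n} \<noteq> {}" using n by auto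
  have Lge: "\<bar>lam a\<bar> \<le> L" if "a < n" for a unfolding L_def using that by (intro Max_ge) auto
  obtain a0 where a0: "a0 < n" "\<bar>lam a0\<bar> = L" using Max_in[OF fin] unfolding L_def by auto
  have Lb: "\<bar>ip n x (mv n B x)\<bar> \<le> L * ip n x x" for x
  proof -
    have "ip n x (mv n B x) = (\<Sum>a<n. lam a * (ip n (u a) x)\<^sup>2)"
      unfolding Parseval[OF u, of x "mv n B x"]
      by (intro sum.cong refl) (simp add: Bu power2_eq_square mult_ac)
    also have "\<bar>\<dots>\<bar> \<le> (\<Sum>a<n. \<bar>lam a * (ip n (u a) x)\<^sup>2\<bar>)" by (rule sum_abs)
    also have "\<dots> \<le> (\<Sum>a<n. L * (ip n (u a) x)\<^sup>2)"
      using Lge by (intro sum_mono) (auto simp: abs_mult intro!: mult_right_mono)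
    also have "\<dots> = L * ip n x x"
      unfolding Parseval[OF u, of x x] by (simp add: sum_distrib_left power2_eq_square)
    finally show ?thesis .
  qed
  let ?y = "u a0"
  have yy: "ip n ?y ?y = 1" using u a0 by (auto simp: orthonormal_def)
  obtain v where v: "v \<in> ball_net n" "ip n v v \<le> 1" "ip n (\<lambda>i. ?y i - v i) (\<lambda>i. ?y i - v i) \<le> 1 / 16"
    using ball_net_covers[OF n, of ?y] yy by auto
  have "ip n (\<lambda>i. ?y i - v i) (mv n B (\<lambda>i. ?y i + v i)) = ip n ?y (mv n B ?y) - ip n v (mv n B v)"
    using ip_mv_symm[OF B, of ?y v] by (simp add: mv_add ip_linear ip_commute)
  moreover have "\<bar>ip n (\<lambda>i. ?y i - v i) (mv n B (\<lambda>i. ?y i + v i))\<bar> \<le>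
      L * (sqrt (ip n (\<lambda>i. ?y i - v i) (\<lambda>i. ?y i - v i)) * sqrt (ip n (\<lambda>i. ?y i + v i) (\<lambda>i. ?y i + v i)))"
    by (rule quadratic_form_bound_bilinear[OF B Lb])
  moreover have "\<dots> \<le> L * (1 / 4 * 2)"
  proof -
    have L0: "0 \<le> L" using a0 by auto
    have "sqrt (ip n (\<lambda>i. ?y i - v i) (\<lambda>i. ?y i - v i)) \<le> sqrt (1 / 16)"
      using v(3) by (rule real_sqrt_le_mono)
    then have s1: "sqrt (ip n (\<lambda>i. ?y i - v i) (\<lambda>i. ?y i - v i)) \<le> 1 / 4"
      by (simp add: real_sqrt_divide)
    have "\<bar>ip n ?y v\<bar> \<le> sqrt (ip n ?y ?y) * sqrt (ip n v v)" by (rule ip_le_norms)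
    also have "\<dots> \<le> 1" using v(2) yy by simp
    finally have "ip n ?y v \<le> 1" by simp
    then have "ip n (\<lambda>i. ?y i + v i) (\<lambda>i. ?y i + v i) \<le> 4"
      using v(2) yy by (simp add: ip_linear ip_commute[of n v ?y])
    then have "sqrt (ip n (\<lambda>i. ?y i + v i) (\<lambda>i. ?y i + v i)) \<le> sqrt 4" by (rule real_sqrt_le_mono)
    then have s2: "sqrt (ip n (\<lambda>i. ?y i + v i) (\<lambda>i. ?y i + v i)) \<le> 2" by simp
    show ?thesis using s1 s2 L0 ip_self_nonneg by (intro mult_left_mono mult_mono) auto
  qed
  moreover have "\<bar>ip n ?y (mv n B ?y)\<bar> = L" using Bu[OF a0(1), of ?y] yy a0 by simp
  ultimately have "L \<le> 2 * \<beta>" using net[OF v(1)] by linarith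
  then show ?thesis using Lb[of x] mult_right_mono[OF _ ip_self_nonneg[of n x]] by (meson order_trans)
qed

text \<open>For symmetric \<open>H\<close> this says that the nuclear norm is at most
  \<open>\<kappa>\<close>. The dual form is what the error analysis produces, and it can be paired
  directly with a random symmetric matrix.\<close>

definition dual_bounded :: "nat \<Rightarrow> real \<Rightarrow> (nat \<Rightarrow> nat \<Rightarrow> real) \<Rightarrow> bool" where
  "dual_bounded n \<kappa> H \<longleftrightarrow>
    (\<forall>W. symm_on n W \<longrightarrow> (\<forall>x. \<bar>ip n x (mv n W x)\<bar> \<le> ip n x x) \<longrightarrow> mip n W H \<le> \<kappa>)"

lemma dual_bounded_le:
  assumes H: "dual_bounded n \<kappa> H" and B: "symm_on n B" and "0 < \<beta>"
    and bound: "\<And>x. \<bar>ip n x (mv n B x)\<bar> \<le> \<beta> * ip n x x"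
  shows "mip n B H \<le> \<kappa> * \<beta>"
proof -
  define W where "W = (\<lambda>i j. (1 / \<beta>) * B i j)"
  have mvW: "mv n W x = (\<lambda>i. (1 / \<beta>) * mv n B x i)" for x
    unfolding mv_def W_def by (simp add: sum_divide_distrib)
  have "symm_on n W" using B by (auto simp: symm_on_def W_def)
  moreover have "\<bar>ip n x (mv n W x)\<bar> \<le> ip n x x" for x
    unfolding mvW ip_scale_right using bound[of x] \<open>0 < \<beta>\<close> by (simp add: abs_mult field_simps)
  ultimately have "mip n W H \<le> \<kappa>" using H by (auto simp: dual_bounded_def)
  moreover have "mip n W H = mip n B H / \<beta>"
    by (simp add: mip_def W_def sum_divide_distrib)
  ultimately show ?thesis using \<open>0 < \<beta>\<close> by (simp add: field_simps)
qed

definition signed_gram :: "nat \<Rightarrow> (nat \<Rightarrow> (nat \<Rightarrow> real) \<times> real) \<Rightarrow> nat \<Rightarrow> nat \<Rightarrow> real" where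
  "signed_gram m w = (\<lambda>j k. \<Sum>i<m. snd (w i) * (fst (w i) j * fst (w i) k))"

lemma symm_signed_gram: "symm_on n (signed_gram m w)"
  by (simp add: symm_on_def signed_gram_def mult.commute)

lemma signed_gram_quadratic: "ip n v (mv n (signed_gram m w) v) = (\<Sum>i<m. snd (w i) * (ip n v (fst (w i)))\<^sup>2)"
proof -
  have "ip n v (mv n (signed_gram m w) v) =
      (\<Sum>j<n. \<Sum>k<n. \<Sum>i<m. snd (w i) * ((v j * fst (w i) j) * (v k * fst (w i) k)))"
    unfolding ip_def mv_def signed_gram_def sum_distrib_left sum_distrib_right
    by (intro sum.cong refl) (simp add: mult_ac)
  also have "\<dots> = (\<Sum>j<n. \<Sum>i<m. \<Sum>k<n. snd (w i) * ((v j * fst (w i) j) * (v k * fst (w i) k)))"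
    by (rule sum.cong[OF refl], rule sum.swap)
  also have "\<dots> = (\<Sum>i<m. \<Sum>j<n. \<Sum>k<n. snd (w i) * ((v j * fst (w i) j) * (v k * fst (w i) k)))"
    by (rule sum.swap)
  also have "\<dots> = (\<Sum>i<m. snd (w i) * (ip n v (fst (w i)))\<^sup>2)"
  proof -
    have "(ip n v x)\<^sup>2 = (\<Sum>j<n. \<Sum>k<n. (v j * x j) * (v k * x k))" for x
      by (simp only: ip_def power2_eq_square sum_product)
    then show ?thesis by (simp only: sum_distrib_left)
  qed
  finally show ?thesis .
qed

lemma mip_signed_gram: "mip n (signed_gram m w) H = (\<Sum>i<m. snd (w i) * ip n (fst (w i)) (mv n H (fst (w i))))"
proof -
  have "mip n (signed_gram m w) H = (\<Sum>j<n. \<Sum>k<n. \<Sum>i<m. snd (w i) * (fst (w i) j * (H j k * fst (w i) k)))"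
    unfolding mip_def signed_gram_def sum_distrib_right by (intro sum.cong refl) (simp add: mult_ac)
  also have "\<dots> = (\<Sum>j<n. \<Sum>i<m. \<Sum>k<n. snd (w i) * (fst (w i) j * (H j k * fst (w i) k)))"
    by (rule sum.cong[OF refl], rule sum.swap)
  also have "\<dots> = (\<Sum>i<m. \<Sum>j<n. \<Sum>k<n. snd (w i) * (fst (w i) j * (H j k * fst (w i) k)))"
    by (rule sum.swap)
  also have "\<dots> = (\<Sum>i<m. snd (w i) * ip n (fst (w i)) (mv n H (fst (w i))))"
    unfolding ip_def mv_def sum_distrib_left ..
  finally show ?thesis .
qed

text \<open>Soft maximum over the net: \<open>b \<le> L + exp (b - L)\<close> replaces the maximum by a sum of
  exponentials, which is linear and hence easy to integrate.\<close>
lemma signed_sum_le_softmax: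
  fixes w :: "nat \<Rightarrow> (nat \<Rightarrow> real) \<times> real" and m :: nat
  assumes n: "0 < n" and H: "dual_bounded n \<kappa> H" and "0 \<le> \<kappa>" and s: "0 < s" and L: "0 < L"
  defines "q \<equiv> (\<lambda>v. \<Sum>i<m. snd (w i) * (ip n v (fst (w i)))\<^sup>2)"
  shows "(\<Sum>i<m. snd (w i) * ip n (fst (w i)) (mv n H (fst (w i)))) \<le>
    \<kappa> * (2 / s * (L + (\<Sum>v\<in>ball_net n. exp (s * q v - L) + exp (- s * q v - L))))"
proof -
  define E where "E = (\<Sum>v\<in>ball_net n. exp (s * q v - L) + exp (- s * q v - L))"
  have fin: "finite (ball_net n)" by (simp add: ball_net_def finite_lattice_points)
  have E0: "0 \<le> E" unfolding E_def by (intro sum_nonneg) (simp add: add_nonneg_nonneg)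
  have "\<bar>q v\<bar> \<le> (L + E) / s" if "v \<in> ball_net n" for v
  proof -
    have le: "exp (s * q v - L) + exp (- s * q v - L) \<le> E"
      unfolding E_def using that fin
      by (intro member_le_sum[of v _ "\<lambda>v. exp (s * q v - L) + exp (- s * q v - L)"]) (auto simp: add_nonneg_nonneg)
    have "s * q v - L + 1 \<le> exp (s * q v - L)" "- s * q v - L + 1 \<le> exp (- s * q v - L)"
      using exp_ge_add_one_self by (smt (verit))+
    then have "s * q v \<le> L + E" "- (s * q v) \<le> L + E"
      using le exp_ge_zero[of "s * q v - L"] exp_ge_zero[of "- s * q v - L"] by linarith+
    then have "\<bar>s * q v\<bar> \<le> L + E" by (simp add: abs_le_iff)
    then show ?thesis using s by (simp add: abs_mult field_simps)
  qed
  \<comment> \<open>The factor 2 is the loss in passing from the net to all vectors.\<close>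
  then have "\<bar>ip n x (mv n (signed_gram m w) x)\<bar> \<le> (2 / s * (L + E)) * ip n x x" for x
    using ball_net_quadratic_bound[OF n symm_signed_gram, of m w "(L + E) / s" x]
    by (simp add: signed_gram_quadratic q_def)
  then have "mip n (signed_gram m w) H \<le> \<kappa> * (2 / s * (L + E))"
    using s L E0 by (intro dual_bounded_le[OF H symm_signed_gram]) auto
  then show ?thesis by (simp add: mip_signed_gram E_def)
qed

section \<open>Random signs and the expected supremum\<close>

definition rademacher :: "real measure" where
  "rademacher = measure_pmf (pmf_of_set {1, -1})"

lemma prob_space_rademacher: "prob_space rademacher"
  unfolding rademacher_def by (rule prob_space_measure_pmf)

text \<open>The sigma-algebra of \<open>rademacher\<close> is the full power set, so borel
  measurability of the sign is derived separately.\<close>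

lemma measurable_snd_rademacher: "snd \<in> borel_measurable (M \<Otimes>\<^sub>M rademacher)"
proof -
  have "(\<lambda>x. x) \<in> rademacher \<rightarrow>\<^sub>M borel" by (simp add: rademacher_def)
  then show ?thesis by (rule measurable_compose[OF measurable_snd])
qed

lemma nn_integral_rademacher:
  assumes f: "f \<in> borel_measurable (M \<Otimes>\<^sub>M rademacher)"
  shows "(\<integral>\<^sup>+ z. f z \<partial>(M \<Otimes>\<^sub>M rademacher)) = (\<integral>\<^sup>+ x. (f (x, 1) + f (x, -1)) / 2 \<partial>M)"
proof -
  interpret R: prob_space rademacher by (rule prob_space_rademacher)
  have "(\<integral>\<^sup>+ e. g e \<partial>rademacher) = (g 1 + g (-1)) / 2" for g :: "real \<Rightarrow> ennreal"
    unfolding rademacher_def by (subst nn_integral_pmf_of_set) auto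
  then show ?thesis using R.nn_integral_fst[OF f] by simp
qed

lemma integrable_rademacher:
  fixes f :: "_ \<Rightarrow> real"
  assumes f [measurable]: "f \<in> borel_measurable (M \<Otimes>\<^sub>M rademacher)"
    and "integrable M (\<lambda>x. f (x, 1))" "integrable M (\<lambda>x. f (x, -1))"
  shows "integrable (M \<Otimes>\<^sub>M rademacher) f"
proof (rule integrableI_bounded[OF f])
  have "(\<integral>\<^sup>+ z. ennreal (norm (f z)) \<partial>(M \<Otimes>\<^sub>M rademacher)) =
      (\<integral>\<^sup>+ x. (ennreal (norm (f (x, 1))) + ennreal (norm (f (x, -1)))) / 2 \<partial>M)"
    by (intro nn_integral_rademacher) measurable
  also have "\<dots> \<le> (\<integral>\<^sup>+ x. ennreal (norm (f (x, 1))) + ennreal (norm (f (x, -1))) \<partial>M)"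
    by (intro nn_integral_mono) (simp add: divide_le_posI_ennreal mult_2 add_increasing)
  also have "\<dots> = (\<integral>\<^sup>+ x. ennreal (norm (f (x, 1))) \<partial>M) + (\<integral>\<^sup>+ x. ennreal (norm (f (x, -1))) \<partial>M)"
    using assms(2,3) by (intro nn_integral_add) auto
  also have "\<dots> < \<infinity>"
    using assms(2,3) unfolding integrable_iff_bounded by (simp add: less_top[symmetric])
  finally show "(\<integral>\<^sup>+ z. ennreal (norm (f z)) \<partial>(M \<Otimes>\<^sub>M rademacher)) < \<infinity>" .
qed

lemma integral_rademacher:
  fixes f :: "_ \<Rightarrow> real"
  assumes "prob_space M" and f: "integrable (M \<Otimes>\<^sub>M rademacher) f"
  shows "(\<integral>z. f z \<partial>(M \<Otimes>\<^sub>M rademacher)) = (\<integral>x. (f (x, 1) + f (x, -1)) / 2 \<partial>M)"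
proof -
  interpret M: prob_space M by fact
  interpret R: prob_space rademacher by (rule prob_space_rademacher)
  interpret pair_sigma_finite M rademacher ..
  have R: "(\<integral>e. g e \<partial>rademacher) = (g 1 + g (-1)) / 2" for g :: "real \<Rightarrow> real"
    unfolding rademacher_def by (subst integral_pmf_of_set) auto
  show ?thesis using integral_fst'[OF f, symmetric] by (simp only: R)
qed

text \<open>Each sensing vector carries its own sign. The symmetrised sum is then again a sum over
  iid samples, and the one-sample replacement of \<open>integral_Max_sum_mono\<close> applies to
  it.\<close>

abbreviation signed_sample :: "real measure \<Rightarrow> nat \<Rightarrow> ((nat \<Rightarrow> real) \<times> real) measure" where
  "signed_sample D n \<equiv> iid D n \<Otimes>\<^sub>M rademacher"

lemma prob_space_signed_sample: "prob_space D \<Longrightarrow> prob_space (signed_sample D n)"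
  by (intro prob_space_pair prob_space_iid prob_space_rademacher)

lemma ball_net_norm:
  assumes "0 < n" "v \<in> ball_net n"
  shows "ip n v v \<le> 1"
proof -
  obtain z where z: "z \<in> lattice_points n" "v = (\<lambda>i. of_int (z i) / (4 * sqrt (real n)))"
    using assms by (auto simp: ball_net_def)
  have "real_of_int (\<Sum>i<n. (z i)\<^sup>2) \<le> real_of_int (16 * int n)"
    using z(1) unfolding lattice_points_def of_int_le_iff by blast
  then have "(\<Sum>i<n. (of_int (z i))\<^sup>2) \<le> 16 * real n" by simp
  moreover have "ip n v v = (\<Sum>i<n. (of_int (z i))\<^sup>2) / (16 * real n)"
    by (simp add: ip_def z(2) sum_divide_distrib power2_eq_square)
  ultimately show ?thesis using assms by simp
qed

lemma measurable_ip_signed_sample: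
  assumes "sets D = sets borel"
  shows "(\<lambda>z. ip n v (fst z)) \<in> borel_measurable (signed_sample D n)"
  using measurable_compose[OF measurable_fst measurable_ip_iid[OF assms]] .

lemma measurable_signed_square:
  assumes "sets D = sets borel"
  shows "(\<lambda>z. snd z * (ip n v (fst z))\<^sup>2) \<in> borel_measurable (signed_sample D n)"
  by (intro borel_measurable_times measurable_snd_rademacher borel_measurable_power
      measurable_ip_signed_sample[OF assms])

text \<open>The sign averages the exponential to a hyperbolic cosine, so the exponent is quadratic
  in \<open>s\<close> although squares of sub-Gaussian forms are only sub-exponential.\<close>

lemma signed_square_mgf:
  assumes D: "entry_distribution D"
    and s1: "0 < s1" and C: "0 < C"
    and sq: "(\<integral>\<^sup>+ x. ennreal (exp (s1 * (ip n v x)\<^sup>2)) \<partial>iid D n) \<le> ennreal C"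
    and s: "\<bar>s\<bar> \<le> s1 / 2"
  shows "(\<integral>\<^sup>+ z. ennreal (exp (s * (snd z * (ip n v (fst z))\<^sup>2))) \<partial>signed_sample D n) \<le>
    ennreal (exp (4 * C * (s / s1)\<^sup>2))"
proof -
  have sets: "sets D = sets borel" using D by (simp add: entry_distribution_def)
  interpret D: prob_space D using D by (simp add: entry_distribution_def)
  interpret P: prob_space "iid D n" by (rule prob_space_iid) (rule D.prob_space_axioms)
  note [measurable] = measurable_ip_iid[OF sets] measurable_signed_square[OF sets]
  have "(\<integral>\<^sup>+ z. ennreal (exp (s * (snd z * (ip n v (fst z))\<^sup>2))) \<partial>signed_sample D n) =
      (\<integral>\<^sup>+ x. (ennreal (exp (s * (ip n v x)\<^sup>2)) + ennreal (exp (- s * (ip n v x)\<^sup>2))) / 2 \<partial>iid D n)"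
  proof (subst nn_integral_rademacher)
    have "(\<lambda>t. ennreal (exp (s * t))) \<in> borel_measurable borel" by measurable
    from measurable_compose[OF measurable_signed_square[OF sets] this]
    show "(\<lambda>z. ennreal (exp (s * (snd z * (ip n v (fst z))\<^sup>2)))) \<in> borel_measurable (signed_sample D n)" .
  qed simp
  also have "\<dots> \<le> (\<integral>\<^sup>+ x. 1 + ennreal (4 * (s / s1)\<^sup>2) * ennreal (exp (s1 * (ip n v x)\<^sup>2)) \<partial>iid D n)"
  proof (rule nn_integral_mono)
    fix x
    have "(ennreal (exp (s * (ip n v x)\<^sup>2)) + ennreal (exp (- s * (ip n v x)\<^sup>2))) / 2 =
        ennreal ((exp (s * (ip n v x)\<^sup>2) + exp (- s * (ip n v x)\<^sup>2)) / 2)"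
      by (simp add: ennreal_plus[symmetric] divide_ennreal[symmetric] del: ennreal_plus)
    also have "\<dots> \<le> ennreal (1 + 4 * (s / s1)\<^sup>2 * exp (s1 * (ip n v x)\<^sup>2))"
      by (intro ennreal_leI cosh_le_quadratic_exp s1 s) simp
    also have "\<dots> = 1 + ennreal (4 * (s / s1)\<^sup>2) * ennreal (exp (s1 * (ip n v x)\<^sup>2))"
      by (simp add: ennreal_mult[symmetric])
    finally show "(ennreal (exp (s * (ip n v x)\<^sup>2)) + ennreal (exp (- s * (ip n v x)\<^sup>2))) / 2 \<le>
        1 + ennreal (4 * (s / s1)\<^sup>2) * ennreal (exp (s1 * (ip n v x)\<^sup>2))" .
  qed
  also have "\<dots> = 1 + ennreal (4 * (s / s1)\<^sup>2) * (\<integral>\<^sup>+ x. ennreal (exp (s1 * (ip n v x)\<^sup>2)) \<partial>iid D n)"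
    by (subst nn_integral_add) (measurable, simp add: nn_integral_cmult P.emeasure_space_1)
  also have "\<dots> \<le> 1 + ennreal (4 * (s / s1)\<^sup>2) * ennreal C"
    by (intro add_left_mono mult_left_mono sq) auto
  also have "\<dots> = ennreal (1 + 4 * C * (s / s1)\<^sup>2)"
    using C by (simp add: ennreal_mult[symmetric] mult_ac)
  also have "\<dots> \<le> ennreal (exp (4 * C * (s / s1)\<^sup>2))"
    by (intro ennreal_leI exp_ge_add_one_self)
  finally show ?thesis .
qed

lemma nn_integral_iid_exp_sum_le:
  assumes Q: "prob_space Q" and h [measurable]: "h \<in> borel_measurable Q"
    and le: "(\<integral>\<^sup>+ z. ennreal (exp (h z)) \<partial>Q) \<le> ennreal (exp b)"
  shows "(\<integral>\<^sup>+ w. ennreal (exp (\<Sum>i<m. h (w i))) \<partial>iid Q m) \<le> ennreal (exp (real m * b))"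
proof -
  interpret Q: prob_space Q by fact
  interpret product_sigma_finite "\<lambda>_. Q" ..
  have "(\<integral>\<^sup>+ w. ennreal (exp (\<Sum>i<m. h (w i))) \<partial>iid Q m) = (\<integral>\<^sup>+ w. (\<Prod>i<m. ennreal (exp (h (w i)))) \<partial>iid Q m)"
    by (simp add: exp_sum prod_ennreal)
  also have "\<dots> = (\<Prod>i<m. \<integral>\<^sup>+ z. ennreal (exp (h z)) \<partial>Q)"
    by (intro product_nn_integral_prod) auto
  also have "\<dots> = (\<integral>\<^sup>+ z. ennreal (exp (h z)) \<partial>Q) ^ m" by simp
  also have "\<dots> \<le> ennreal (exp b) ^ m" by (intro power_mono le) auto
  also have "\<dots> = ennreal (exp (real m * b))" by (simp add: ennreal_power exp_of_nat_mult)
  finally show ?thesis .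
qed

text \<open>The soft maximum is balanced so that the moment exponent, the logarithm of the net size
  and the offset \<open>L\<close> all have order \<open>n\<close>. With \<open>s\<close> of order
  \<open>sqrt (n / m)\<close>, the value \<open>\<kappa> * L / s\<close> has order
  \<open>\<kappa> * sqrt (n m)\<close>.\<close>

lemma expected_signed_sup:
  assumes D: "entry_distribution D"
  obtains c where "0 < c"
    "\<And>n m \<kappa> F. 0 < n \<Longrightarrow> n \<le> m \<Longrightarrow> 0 \<le> \<kappa> \<Longrightarrow> finite F \<Longrightarrow> F \<noteq> {} \<Longrightarrow> \<forall>H\<in>F. dual_bounded n \<kappa> H \<Longrightarrow>
      (\<integral>w. Max ((\<lambda>H. \<Sum>i<m. 2 * (snd (w i) * ip n (fst (w i)) (mv n H (fst (w i))))) ` F)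
        \<partial>iid (signed_sample D n) m) \<le> c * \<kappa> * sqrt (real n * real m)"
proof -
  obtain s1 C where s1: "0 < s1" and C: "0 < C"
    and sq: "\<And>n u. ip n u u \<le> 1 \<Longrightarrow> (\<integral>\<^sup>+ x. ennreal (exp (s1 * (ip n u x)\<^sup>2)) \<partial>iid D n) \<le> ennreal C"
    using subgaussian_linear_square_mgf[OF D] by blast
  have sets: "sets D = sets borel" and Dp: "prob_space D" using D by (simp_all add: entry_distribution_def)
  define c where "c = 8 * (21 + C) / s1"
  have "(\<integral>w. Max ((\<lambda>H. \<Sum>i<m. 2 * (snd (w i) * ip n (fst (w i)) (mv n H (fst (w i))))) ` F)
        \<partial>iid (signed_sample D n) m) \<le> c * \<kappa> * sqrt (real n * real m)"
    if n: "0 < n" and m: "n \<le> m" and \<kappa>: "0 \<le> \<kappa>" and F: "finite F" "F \<noteq> {}"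
      and dual: "\<forall>H\<in>F. dual_bounded n \<kappa> H" for n m \<kappa> F
  proof -
    note [measurable] = measurable_signed_square[OF sets]
    let ?Q = "signed_sample D n"
    have Q: "prob_space ?Q" by (rule prob_space_signed_sample[OF Dp])
    interpret P: prob_space "iid ?Q m" by (rule prob_space_iid[OF Q])
    have m0: "0 < m" using n m by simp
    \<comment> \<open>For \<open>s\<close> proportional to \<open>\<rho>\<close> the moment exponent
      summed over \<open>m\<close> samples is exactly \<open>C * n\<close>. The assumption
      \<open>n \<le> m\<close> gives \<open>\<rho> \<le> 1\<close>, hence the
      \<open>s \<le> s1 / 2\<close> that the one-sample bound requires.\<close>
    define \<rho> where "\<rho> = sqrt (real n / real m)"
    have \<rho>: "0 < \<rho>" "\<rho> \<le> 1" using n m m0 by (simp_all add: \<rho>_def)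
    have \<rho>2: "real m * \<rho>\<^sup>2 = real n" using m0 by (simp add: \<rho>_def)
    define s where "s = s1 / 2 * \<rho>"
    \<comment> \<open>\<open>18 * n\<close> pays for the net, \<open>C * n\<close> for the moment
      bound, and the last \<open>n\<close> is slack; then \<open>E\<close> has mean at most
      2.\<close>
    define L where "L = (19 + C) * real n"
    have s: "0 < s" using s1 \<rho> by (simp add: s_def)
    have L: "0 < L" using C n by (simp add: L_def)
    define q where "q = (\<lambda>v w. \<Sum>i<m. snd (w i) * (ip n v (fst (w i)))\<^sup>2)"
    have q_meas [measurable]: "q v \<in> borel_measurable (iid ?Q m)" for v
      unfolding q_def by measurable
    have mgf: "(\<integral>\<^sup>+ w. ennreal (exp (t * q v w)) \<partial>iid ?Q m) \<le> ennreal (exp (C * real n))"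
      if v: "v \<in> ball_net n" and t: "\<bar>t\<bar> = s" for t v
    proof -
      have ts: "\<bar>t\<bar> \<le> s1 / 2"
        unfolding t s_def using s1 \<rho> mult_left_mono[of \<rho> 1 "s1 / 2"] by simp
      have "(\<integral>\<^sup>+ w. ennreal (exp (\<Sum>i<m. t * (snd (w i) * (ip n v (fst (w i)))\<^sup>2))) \<partial>iid ?Q m) \<le>
          ennreal (exp (real m * (4 * C * (t / s1)\<^sup>2)))"
        by (intro nn_integral_iid_exp_sum_le Q signed_square_mgf[OF D s1 C sq ts] ball_net_norm[OF n v]) measurable
      moreover have "real m * (4 * C * (t / s1)\<^sup>2) = C * real n"
      proof -
        have "t\<^sup>2 = s\<^sup>2" using t by (metis power2_abs)
        then have "(t / s1)\<^sup>2 = \<rho>\<^sup>2 / 4" using s1 by (simp add: s_def power_divide power_mult_distrib)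
        then have "real m * (4 * C * (t / s1)\<^sup>2) = C * (real m * \<rho>\<^sup>2)" by simp
        then show ?thesis by (simp only: \<rho>2)
      qed
      ultimately show ?thesis by (simp add: q_def sum_distrib_left)
    qed
    have ie: "integrable (iid ?Q m) (\<lambda>w. exp (t * q v w - L))"
      and ib: "(\<integral>w. exp (t * q v w - L) \<partial>iid ?Q m) \<le> exp (C * real n - L)"
      if v: "v \<in> ball_net n" and t: "\<bar>t\<bar> = s" for t v
    proof -
      have "(\<integral>\<^sup>+ w. ennreal (exp (t * q v w - L)) \<partial>iid ?Q m) =
          (\<integral>\<^sup>+ w. ennreal (exp (- L)) * ennreal (exp (t * q v w)) \<partial>iid ?Q m)"
        by (intro nn_integral_cong) (simp add: ennreal_mult[symmetric] exp_add[symmetric])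
      also have "\<dots> = ennreal (exp (- L)) * (\<integral>\<^sup>+ w. ennreal (exp (t * q v w)) \<partial>iid ?Q m)"
        by (intro nn_integral_cmult) measurable
      also have "\<dots> \<le> ennreal (exp (- L)) * ennreal (exp (C * real n))"
        by (intro mult_left_mono mgf[OF v t]) auto
      also have "\<dots> = ennreal (exp (C * real n - L))"
        by (simp add: ennreal_mult[symmetric] exp_add[symmetric])
      finally have nn: "(\<integral>\<^sup>+ w. ennreal (exp (t * q v w - L)) \<partial>iid ?Q m) \<le> ennreal (exp (C * real n - L))" .
      show int: "integrable (iid ?Q m) (\<lambda>w. exp (t * q v w - L))"
        by (rule integrableI_nonneg) (use nn in \<open>auto intro: le_less_trans\<close>)
      have "ennreal (\<integral>w. exp (t * q v w - L) \<partial>iid ?Q m) \<le> ennreal (exp (C * real n - L))"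
        using nn by (subst nn_integral_eq_integral[symmetric]) (use int in auto)
      then show "(\<integral>w. exp (t * q v w - L) \<partial>iid ?Q m) \<le> exp (C * real n - L)"
        by (subst (asm) ennreal_le_iff) auto
    qed
    define E where "E = (\<lambda>w. \<Sum>v\<in>ball_net n. exp (s * q v w - L) + exp (- s * q v w - L))"
    have E0: "0 \<le> E w" for w unfolding E_def by (intro sum_nonneg) (simp add: add_nonneg_nonneg)
    have Ei: "integrable (iid ?Q m) E"
      unfolding E_def using s by (intro Bochner_Integration.integrable_sum Bochner_Integration.integrable_add ie) auto
    have EE: "(\<integral>w. E w \<partial>iid ?Q m) \<le> 2"
    proof -
      have "(\<integral>w. E w \<partial>iid ?Q m) = (\<Sum>v\<in>ball_net n.
          (\<integral>w. exp (s * q v w - L) \<partial>iid ?Q m) + (\<integral>w. exp (- s * q v w - L) \<partial>iid ?Q m))"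
      proof -
        have i1: "integrable (iid ?Q m) (\<lambda>w. exp (s * q v w - L))"
          and i2: "integrable (iid ?Q m) (\<lambda>w. exp (- s * q v w - L))" if "v \<in> ball_net n" for v
          using that s by (intro ie; simp)+
        have "(\<integral>w. E w \<partial>iid ?Q m) =
            (\<Sum>v\<in>ball_net n. (\<integral>w. exp (s * q v w - L) + exp (- s * q v w - L) \<partial>iid ?Q m))"
          unfolding E_def by (intro Bochner_Integration.integral_sum Bochner_Integration.integrable_add i1 i2)
        also have "\<dots> = (\<Sum>v\<in>ball_net n.
          (\<integral>w. exp (s * q v w - L) \<partial>iid ?Q m) + (\<integral>w. exp (- s * q v w - L) \<partial>iid ?Q m))"
          by (intro sum.cong refl Bochner_Integration.integral_add i1 i2)
        finally show ?thesis .
      qed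
      also have "\<dots> \<le> (\<Sum>v\<in>ball_net n. exp (C * real n - L) + exp (C * real n - L))"
        using s by (intro sum_mono add_mono ib) auto
      also have "\<dots> = real (card (ball_net n)) * (2 * exp (C * real n - L))" by simp
      also have "\<dots> \<le> exp (18 * real n) * (2 * exp (C * real n - L))"
        by (intro mult_right_mono card_ball_net) auto
      also have "\<dots> = 2 * exp (- real n)"
        by (simp add: L_def exp_add[symmetric] algebra_simps)
      also have "\<dots> \<le> 2" by simp
      finally show ?thesis .
    qed
    have "(\<integral>w. Max ((\<lambda>H. \<Sum>i<m. 2 * (snd (w i) * ip n (fst (w i)) (mv n H (fst (w i))))) ` F) \<partial>iid ?Q m) \<le>
        (\<integral>w. 2 * (\<kappa> * (2 / s * (L + E w))) \<partial>iid ?Q m)"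
    proof (rule integral_mono')
      show "integrable (iid ?Q m) (\<lambda>w. 2 * (\<kappa> * (2 / s * (L + E w))))" using Ei by auto
      show "0 \<le> 2 * (\<kappa> * (2 / s * (L + E w)))" for w using \<kappa> s L E0 by simp
      fix w
      have "(\<Sum>i<m. 2 * (snd (w i) * ip n (fst (w i)) (mv n H (fst (w i))))) \<le> 2 * (\<kappa> * (2 / s * (L + E w)))"
        if "H \<in> F" for H
        unfolding sum_distrib_left[symmetric] E_def q_def
        by (intro mult_left_mono signed_sum_le_softmax n bspec[OF dual that] \<kappa> s L) simp
      then show "Max ((\<lambda>H. \<Sum>i<m. 2 * (snd (w i) * ip n (fst (w i)) (mv n H (fst (w i))))) ` F) \<le>
          2 * (\<kappa> * (2 / s * (L + E w)))" using F by (subst Max_le_iff) auto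
    qed
    also have "\<dots> = 2 * (\<kappa> * (2 / s * (L + (\<integral>w. E w \<partial>iid ?Q m))))"
      using Ei by (simp add: P.prob_space)
    also have "\<dots> \<le> 2 * (\<kappa> * (2 / s * (L + 2)))"
      using \<kappa> s EE by (intro mult_left_mono add_left_mono) auto
    also have "\<dots> \<le> 2 * (\<kappa> * (2 / s * ((21 + C) * real n)))"
    proof -
      have "1 \<le> real n" using n by simp
      then have "L + 2 \<le> (21 + C) * real n" by (simp add: L_def algebra_simps)
      then show ?thesis using \<kappa> s by (intro mult_left_mono) auto
    qed
    also have "\<dots> = c * \<kappa> * (real n / \<rho>)" using s1 \<rho> by (simp add: s_def c_def field_simps)
    also have "real n / \<rho> = sqrt (real n * real m)"
    proof -
      have "real n = \<rho> * sqrt (real n * real m)"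
        using n m0 by (simp add: \<rho>_def real_sqrt_mult[symmetric])
      then show ?thesis using \<rho> by (simp add: field_simps)
    qed
    finally show ?thesis .
  qed
  moreover have "0 < c" using s1 C by (simp add: c_def)
  ultimately show thesis using that by blast
qed

section \<open>Small-ball estimate for quadratic forms\<close>

lemma power_le_fact_exp:
  fixes z :: real
  assumes "0 \<le> z"
  shows "z ^ k \<le> fact k * exp z"
proof -
  have "(\<Sum>n\<in>{k}. z ^ n /\<^sub>R fact n) \<le> (\<Sum>n. z ^ n /\<^sub>R fact n)"
    using assms by (intro sum_le_suminf summable_exp_generic) auto
  then have "z ^ k / fact k \<le> exp z" by (simp add: exp_def divide_inverse mult.commute)
  then show ?thesis by (simp add: field_simps)
qed

lemma integrable_power_entry:
  assumes D: "entry_distribution D"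
  shows "integrable D (\<lambda>x. x ^ k)"
proof -
  interpret prob_space D using D by (simp add: entry_distribution_def)
  have sets [measurable_cong]: "sets D = sets borel" using D by (simp add: entry_distribution_def)
  obtain K where K: "0 < K" "(\<integral>\<^sup>+ x. ennreal (exp (x\<^sup>2 / K\<^sup>2)) \<partial>D) \<le> 2"
    using D by (auto simp: entry_distribution_def sub_gaussian_def)
  have w: "integrable D (\<lambda>x. exp (x\<^sup>2 / K\<^sup>2))"
  proof (rule integrableI_nonneg)
    show "(\<integral>\<^sup>+ x. ennreal (exp (x\<^sup>2 / K\<^sup>2)) \<partial>D) < \<infinity>" using K by (simp add: le_less_trans)
  qed auto
  show ?thesis
  proof (rule Bochner_Integration.integrable_bound[of _ "\<lambda>x. 1 + K ^ (2 * k) * fact k * exp (x\<^sup>2 / K\<^sup>2)"])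
    show "integrable D (\<lambda>x. 1 + K ^ (2 * k) * fact k * exp (x\<^sup>2 / K\<^sup>2))" using w by auto
    have "\<bar>x ^ k\<bar> \<le> 1 + K ^ (2 * k) * fact k * exp (x\<^sup>2 / K\<^sup>2)" for x
    proof -
      have "(x\<^sup>2 / K\<^sup>2) ^ k \<le> fact k * exp (x\<^sup>2 / K\<^sup>2)" by (intro power_le_fact_exp) simp
      then have "K ^ (2 * k) * (x\<^sup>2 / K\<^sup>2) ^ k \<le> K ^ (2 * k) * (fact k * exp (x\<^sup>2 / K\<^sup>2))"
        using K by (intro mult_left_mono) auto
      moreover have "K ^ (2 * k) * (x\<^sup>2 / K\<^sup>2) ^ k = (x ^ k)\<^sup>2"
        using K by (simp add: power_divide power_mult[symmetric] mult.commute)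
      moreover have "\<bar>x ^ k\<bar> \<le> 1 + (x ^ k)\<^sup>2"
        using sum_squares_bound[of 1 "\<bar>x ^ k\<bar>"] by simp
      ultimately show ?thesis by (simp add: mult.assoc)
    qed
    then show "AE x in D. norm (x ^ k) \<le> norm (1 + K ^ (2 * k) * fact k * exp (x\<^sup>2 / K\<^sup>2))"
      by (intro AE_I2) (smt (verit) real_norm_def)
  qed measurable
qed

lemma (in prob_space) integrable_of_fourth_moment:
  fixes f :: "'a \<Rightarrow> real"
  assumes [measurable]: "f \<in> borel_measurable M" and fin: "(\<integral>\<^sup>+ x. ennreal (f x ^ 4) \<partial>M) \<le> ennreal B"
  shows "integrable M (\<lambda>x. f x ^ 4)" "integrable M (\<lambda>x. (f x)\<^sup>2)" "integrable M f"
proof -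
  have nn4: "0 \<le> f x ^ 4" for x by simp
  show i4: "integrable M (\<lambda>x. f x ^ 4)"
    by (rule integrableI_nonneg) (use fin nn4 in \<open>auto intro: le_less_trans\<close>)
  have sq: "(f x)\<^sup>2 \<le> 1 + f x ^ 4" for x
  proof -
    have "2 * (f x)\<^sup>2 \<le> 1 + ((f x)\<^sup>2)\<^sup>2" using sum_squares_bound[of 1 "(f x)\<^sup>2"] by simp
    moreover have "((f x)\<^sup>2)\<^sup>2 = f x ^ 4" by simp
    moreover have "0 \<le> (f x)\<^sup>2" by simp
    ultimately show ?thesis by linarith
  qed
  show i2: "integrable M (\<lambda>x. (f x)\<^sup>2)"
  proof (rule Bochner_Integration.integrable_bound[of _ "\<lambda>x. 1 + f x ^ 4"])
    show "integrable M (\<lambda>x. 1 + f x ^ 4)" using i4 by auto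
    show "AE x in M. norm ((f x)\<^sup>2) \<le> norm (1 + f x ^ 4)"
      using sq nn4 by (intro AE_I2) (simp add: add_nonneg_nonneg)
  qed measurable
  show "integrable M f"
  proof (rule Bochner_Integration.integrable_bound[of _ "\<lambda>x. 1 + (f x)\<^sup>2"])
    show "integrable M (\<lambda>x. 1 + (f x)\<^sup>2)" using i2 by auto
    have "\<bar>f x\<bar> \<le> 1 + (f x)\<^sup>2" for x
    proof -
      have "2 * \<bar>f x\<bar> \<le> 1 + (f x)\<^sup>2" using sum_squares_bound[of 1 "\<bar>f x\<bar>"] by simp
      then show ?thesis by linarith
    qed
    then show "AE x in M. norm (f x) \<le> norm (1 + (f x)\<^sup>2)"
      by (intro AE_I2) (simp add: add_nonneg_nonneg)
  qed measurable
qed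

lemma linear_form_moments:
  assumes D: "entry_distribution D"
  shows "(\<integral>x. ip n u x \<partial>iid D n) = 0" "(\<integral>x. (ip n u x)\<^sup>2 \<partial>iid D n) = ip n u u"
    "integrable (iid D n) (\<lambda>x. ip n u x)" "integrable (iid D n) (\<lambda>x. (ip n u x)\<^sup>2)"
    "integrable (iid D n) (\<lambda>x. (ip n u x) ^ 4)"
proof -
  have Dp: "prob_space D" and sets: "sets D = sets borel"
    and D1: "integrable D (\<lambda>x. x)" "(\<integral>x. x \<partial>D) = 0" and D2: "integrable D (\<lambda>x. x\<^sup>2)" "(\<integral>x. x\<^sup>2 \<partial>D) = 1"
    using D by (simp_all add: entry_distribution_def)
  interpret D: prob_space D by fact
  obtain C where C: "\<And>n u. (\<integral>\<^sup>+ x. ennreal ((ip n u x) ^ 4) \<partial>iid D n) \<le> ennreal (C * (ip n u u)\<^sup>2)"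
    using subgaussian_linear_fourth_moment[OF D] by blast
  have int: "integrable (iid D n) (\<lambda>x. (ip n u x) ^ 4)" "integrable (iid D n) (\<lambda>x. (ip n u x)\<^sup>2)"
    "integrable (iid D n) (\<lambda>x. ip n u x)" for n
    using prob_space.integrable_of_fourth_moment[OF prob_space_iid[OF Dp] measurable_ip_iid[OF sets] C] by auto
  then show "integrable (iid D n) (\<lambda>x. ip n u x)" "integrable (iid D n) (\<lambda>x. (ip n u x)\<^sup>2)"
    "integrable (iid D n) (\<lambda>x. (ip n u x) ^ 4)" by auto
  have upd: "ip (Suc k) u (x(k := z)) = ip k u x + u k * z" for k x z by (simp add: ip_def)
  have "(\<integral>x. ip n u x \<partial>iid D n) = 0 \<and> (\<integral>x. (ip n u x)\<^sup>2 \<partial>iid D n) = ip n u u"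
  proof (induction n)
    case 0
    then show ?case by (simp add: ip_def)
  next
    case (Suc n)
    interpret P: prob_space "iid D n" by (rule prob_space_iid[OF Dp])
    have "(\<integral>x. ip (Suc n) u x \<partial>iid D (Suc n)) = (\<integral>x. \<integral>z. ip n u x + u n * z \<partial>D \<partial>iid D n)"
      using iid_Suc_integral(3)[OF Dp int(3)] by (simp add: upd)
    also have "\<dots> = 0" using D1 Suc by (simp add: D.prob_space)
    finally have 1: "(\<integral>x. ip (Suc n) u x \<partial>iid D (Suc n)) = 0" .
    have "(\<integral>x. (ip (Suc n) u x)\<^sup>2 \<partial>iid D (Suc n)) = (\<integral>x. \<integral>z. (ip n u x + u n * z)\<^sup>2 \<partial>D \<partial>iid D n)"
      using iid_Suc_integral(3)[OF Dp int(2)] by (simp add: upd)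
    also have "\<dots> = (\<integral>x. (ip n u x)\<^sup>2 + (u n)\<^sup>2 \<partial>iid D n)"
    proof (rule Bochner_Integration.integral_cong[OF refl])
      fix x
      have "(ip n u x + u n * z)\<^sup>2 = (ip n u x)\<^sup>2 + (2 * ip n u x * u n) * z + (u n)\<^sup>2 * z\<^sup>2" for z
        by (simp add: power2_sum power_mult_distrib algebra_simps)
      then show "(\<integral>z. (ip n u x + u n * z)\<^sup>2 \<partial>D) = (ip n u x)\<^sup>2 + (u n)\<^sup>2"
        using D1 D2 by (simp add: D.prob_space)
    qed
    also have "\<dots> = ip (Suc n) u u" using int(2) Suc by (simp add: P.prob_space ip_def power2_eq_square)
    finally show ?case using 1 by simp
  qed
  then show "(\<integral>x. ip n u x \<partial>iid D n) = 0" "(\<integral>x. (ip n u x)\<^sup>2 \<partial>iid D n) = ip n u u" by auto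
qed

text \<open>\<open>centered_qf n \<tau> H x\<close> is \<open>\<tau> - tr H + x\<^sup>T H x\<close> for symmetric \<open>H\<close>, grouped by the largest index so that
  conditioning on the last coordinate exposes a martingale difference.\<close>
definition centered_qf :: "nat \<Rightarrow> real \<Rightarrow> (nat \<Rightarrow> nat \<Rightarrow> real) \<Rightarrow> (nat \<Rightarrow> real) \<Rightarrow> real" where
  "centered_qf n \<tau> H x = \<tau> + (\<Sum>i<n. x i * ip i (\<lambda>j. 2 * H i j) x + ((x i)\<^sup>2 - 1) * H i i)"

text \<open>The exact second moment of \<open>centered_qf\<close>: the increments are orthogonal,
  and each summand is the mean square of one of them. The third moment of the entries is absent
  because it multiplies a linear form of mean 0.\<close>

definition qf_var :: "real measure \<Rightarrow> nat \<Rightarrow> real \<Rightarrow> (nat \<Rightarrow> nat \<Rightarrow> real) \<Rightarrow> real" where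
  "qf_var D n \<tau> H = \<tau>\<^sup>2 +
    (\<Sum>i<n. ip i (\<lambda>j. 2 * H i j) (\<lambda>j. 2 * H i j) + ((\<integral>x. x ^ 4 \<partial>D) - 1) * (H i i)\<^sup>2)"

lemma centered_qf_Suc:
  "centered_qf (Suc n) \<tau> H (x(n := z)) =
    centered_qf n \<tau> H x + (z * ip n (\<lambda>j. 2 * H n j) x + (z\<^sup>2 - 1) * H n n)"
proof -
  have "ip i v (x(n := z)) = ip i v x" if "i \<le> n" for i v
    using that by (intro ip_cong) auto
  then show ?thesis by (simp add: centered_qf_def)
qed

lemma quadratic_form_eq_centered_qf:
  assumes "symm_on n H"
  shows "ip n x (mv n H x) = centered_qf n (\<Sum>i<n. H i i) H x"
  using assms
proof (induction n)
  case 0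
  then show ?case by (simp add: ip_def centered_qf_def)
next
  case (Suc n)
  have sym: "symm_on n H" using Suc.prems by (simp add: symm_on_def)
  have "ip (Suc n) x (mv (Suc n) H x) =
      (\<Sum>i<n. x i * (mv n H x i + H i n * x n)) + x n * (mv n H x n + H n n * x n)"
    by (simp add: ip_def mv_def)
  also have "(\<Sum>i<n. x i * (mv n H x i + H i n * x n)) = ip n x (mv n H x) + (\<Sum>i<n. x n * (H n i * x i))"
    using Suc.prems by (simp add: ip_def distrib_left sum.distrib symm_on_def mult_ac)
  also have "(\<Sum>i<n. x n * (H n i * x i)) = x n * mv n H x n"
    by (simp add: mv_def sum_distrib_left)
  finally have "ip (Suc n) x (mv (Suc n) H x) = ip n x (mv n H x) + 2 * (x n * mv n H x n) + H n n * (x n)\<^sup>2"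
    by (simp add: algebra_simps power2_eq_square)
  moreover have "ip n (\<lambda>j. 2 * H n j) x = 2 * mv n H x n" by (simp add: ip_def mv_def sum_distrib_left mult.assoc)
  ultimately show ?case using Suc.IH[OF sym] by (simp add: centered_qf_def algebra_simps)
qed

text \<open>The off-diagonal part of a new row and column contributes \<open>2 * h\<close> to the
  squared Frobenius norm and \<open>4 * h\<close> to \<open>qf_var\<close>. A diagonal entry has
  weight \<open>\<mu>4 - 1\<close>; this is where a fourth moment above 1 enters.\<close>

lemma frobenius_le_qf_var:
  assumes "symm_on n H" and \<gamma>: "0 \<le> \<gamma>" "\<gamma> \<le> 1" "\<gamma> \<le> (\<integral>x. x ^ 4 \<partial>D) - 1"
  shows "\<gamma> * mip n H H \<le> qf_var D n \<tau> H"
  using assms(1)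
proof (induction n)
  case 0
  then show ?case by (simp add: mip_def qf_var_def)
next
  case (Suc n)
  have sym: "symm_on n H" using Suc.prems by (simp add: symm_on_def)
  define h where "h = (\<Sum>j<n. H n j * H n j)"
  have h0: "0 \<le> h" unfolding h_def by (intro sum_nonneg) auto
  have "mip (Suc n) H H = mip n H H + (\<Sum>i<n. H i n * H i n) + (h + H n n * H n n)"
    by (simp add: mip_def sum.distrib h_def)
  also have "(\<Sum>i<n. H i n * H i n) = h"
    unfolding h_def using Suc.prems by (intro sum.cong) (auto simp: symm_on_def)
  finally have "mip (Suc n) H H = mip n H H + 2 * h + (H n n)\<^sup>2" by (simp add: power2_eq_square)
  then have "\<gamma> * mip (Suc n) H H = \<gamma> * mip n H H + \<gamma> * (2 * h) + \<gamma> * (H n n)\<^sup>2" by (simp add: algebra_simps)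
  also have "\<dots> \<le> qf_var D n \<tau> H + 1 * (4 * h) + ((\<integral>x. x ^ 4 \<partial>D) - 1) * (H n n)\<^sup>2"
    using \<gamma> h0 by (intro add_mono Suc.IH[OF sym] mult_mono mult_right_mono) auto
  also have "\<dots> = qf_var D (Suc n) \<tau> H"
    by (simp add: qf_var_def ip_def h_def sum_distrib_left mult_ac)
  finally show ?case .
qed

lemma measurable_centered_qf:
  assumes "sets D = sets borel"
  shows "centered_qf n \<tau> H \<in> borel_measurable (iid D n)"
proof -
  have [measurable]: "(\<lambda>x. x i) \<in> borel_measurable (iid D n)" if "i < n" for i
    using that measurable_component_singleton[of i "{..<n}" "\<lambda>_. D"] assms
    by (auto cong: measurable_cong_sets)
  have "(\<lambda>x. ip i v x) \<in> borel_measurable (iid D n)" if "i < n" for i v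
    unfolding ip_def using that by (intro borel_measurable_sum borel_measurable_times) auto
  then have "(\<lambda>x. \<tau> + (\<Sum>i<n. x i * ip i (\<lambda>j. 2 * H i j) x + ((x i)\<^sup>2 - 1) * H i i)) \<in> borel_measurable (iid D n)"
    by (intro borel_measurable_add borel_measurable_sum borel_measurable_times borel_measurable_diff
        borel_measurable_power) auto
  then show ?thesis unfolding centered_qf_def[abs_def] .
qed

text \<open>Terms of first order in the increment are kept exactly, because they vanish in
  conditional mean, and the coefficient of \<open>A ^ 4\<close> stays 1, so that the induction over
  coordinates loses no constant. The higher terms may be estimated crudely.\<close>

lemma fourth_power_expansion_le:
  fixes A B c z :: real
  shows "(A + (z * B + (z\<^sup>2 - 1) * c)) ^ 4 \<le>
    A ^ 4 + 4 * A ^ 3 * B * z + 4 * A ^ 3 * c * (z\<^sup>2 - 1) +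
    16 * A\<^sup>2 * B\<^sup>2 * z\<^sup>2 + 16 * A\<^sup>2 * c\<^sup>2 * (z\<^sup>2 - 1)\<^sup>2 + 24 * B ^ 4 * z ^ 4 + 24 * c ^ 4 * (z\<^sup>2 - 1) ^ 4"
proof -
  define p where "p = z * B"
  define q where "q = (z\<^sup>2 - 1) * c"
  define V where "V = p + q"
  have sq: "(x + y)\<^sup>2 \<le> 2 * x\<^sup>2 + 2 * y\<^sup>2" for x y :: real
    using sum_squares_bound[of x y] by (simp add: power2_sum)
  have V2: "V\<^sup>2 \<le> 2 * p\<^sup>2 + 2 * q\<^sup>2" unfolding V_def by (rule sq)
  have "V ^ 4 = (V\<^sup>2)\<^sup>2" by simp
  also have "\<dots> \<le> (2 * p\<^sup>2 + 2 * q\<^sup>2)\<^sup>2" using V2 by (intro power_mono) auto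
  also have "\<dots> \<le> 2 * (2 * p\<^sup>2)\<^sup>2 + 2 * (2 * q\<^sup>2)\<^sup>2" by (rule sq)
  finally have V4: "V ^ 4 \<le> 8 * p ^ 4 + 8 * q ^ 4" by (simp add: power_mult_distrib)
  \<comment> \<open>The cubic term has no sign; this square splits it between the quadratic and
    quartic terms, turning the coefficients 6 and 1 into 8 and 3.\<close>
  have "0 \<le> 2 * (V * (A - V))\<^sup>2" by simp
  then have cross: "4 * A * V ^ 3 \<le> 2 * A\<^sup>2 * V\<^sup>2 + 2 * V ^ 4"
    by (simp add: power2_eq_square power3_eq_cube power4_eq_xxxx algebra_simps)
  have "(A + V) ^ 4 = A ^ 4 + 4 * A ^ 3 * V + 6 * A\<^sup>2 * V\<^sup>2 + 4 * A * V ^ 3 + V ^ 4"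
    by (simp add: power2_eq_square power3_eq_cube power4_eq_xxxx algebra_simps)
  also have "\<dots> \<le> A ^ 4 + 4 * A ^ 3 * V + 8 * A\<^sup>2 * V\<^sup>2 + 3 * V ^ 4" using cross by linarith
  also have "\<dots> \<le> A ^ 4 + 4 * A ^ 3 * V + 8 * A\<^sup>2 * (2 * p\<^sup>2 + 2 * q\<^sup>2) + 3 * (8 * p ^ 4 + 8 * q ^ 4)"
    using V2 V4 by (intro add_mono mult_left_mono order_refl) auto
  also have "\<dots> = A ^ 4 + 4 * A ^ 3 * B * z + 4 * A ^ 3 * c * (z\<^sup>2 - 1) +
    16 * A\<^sup>2 * B\<^sup>2 * z\<^sup>2 + 16 * A\<^sup>2 * c\<^sup>2 * (z\<^sup>2 - 1)\<^sup>2 + 24 * B ^ 4 * z ^ 4 + 24 * c ^ 4 * (z\<^sup>2 - 1) ^ 4"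
    unfolding V_def p_def q_def by (simp add: power_mult_distrib distrib_left mult_ac)
  finally show ?thesis by (simp add: V_def p_def q_def)
qed

lemma integrable_entry_poly:
  assumes D: "entry_distribution D"
  shows "integrable D (\<lambda>z. (z\<^sup>2 - 1) ^ k)" "integrable D (\<lambda>z. z * (z\<^sup>2 - 1))"
proof -
  have "(z\<^sup>2 - 1) ^ k = (\<Sum>j\<le>k. of_nat (k choose j) * (-1) ^ (k - j) * z ^ (2 * j))" for z :: real
    using binomial_ring[of "z\<^sup>2" "-1" k] by (simp add: power_mult[symmetric] mult_ac)
  then show "integrable D (\<lambda>z. (z\<^sup>2 - 1) ^ k)"
    using integrable_power_entry[OF D] by auto
  have "z * (z\<^sup>2 - 1) = z ^ 3 - z ^ 1" for z :: real by (simp add: algebra_simps power2_eq_square power3_eq_cube)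
  then show "integrable D (\<lambda>z. z * (z\<^sup>2 - 1))"
    using integrable_power_entry[OF D, of 3] integrable_power_entry[OF D, of 1] by simp
qed

text \<open>Both \<open>z\<close> and \<open>z\<^sup>2 - 1\<close> are centred, so the first-order
  terms disappear. In the second moment a term linear in \<open>B\<close> survives; it vanishes only
  after averaging over the earlier coordinates.\<close>

lemma conditional_fourth_moment:
  assumes D: "entry_distribution D"
  defines "\<mu>4 \<equiv> (\<integral>x. x ^ 4 \<partial>D)" and "w4 \<equiv> (\<integral>x. (x\<^sup>2 - 1) ^ 4 \<partial>D)"
  shows "(\<integral>\<^sup>+ z. ennreal ((A + (z * B + (z\<^sup>2 - 1) * c)) ^ 4) \<partial>D) \<le>
    ennreal (A ^ 4 + 16 * A\<^sup>2 * B\<^sup>2 + 16 * A\<^sup>2 * c\<^sup>2 * (\<mu>4 - 1) + 24 * B ^ 4 * \<mu>4 + 24 * c ^ 4 * w4)" (is "?L \<le> ennreal ?R")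
    and "(\<integral>z. (A + (z * B + (z\<^sup>2 - 1) * c))\<^sup>2 \<partial>D) =
      A\<^sup>2 + B\<^sup>2 + 2 * c * (\<integral>z. z * (z\<^sup>2 - 1) \<partial>D) * B + (\<mu>4 - 1) * c\<^sup>2"
proof -
  have D1: "integrable D (\<lambda>x. x)" "(\<integral>x. x \<partial>D) = 0" and D2: "integrable D (\<lambda>x. x\<^sup>2)" "(\<integral>x. x\<^sup>2 \<partial>D) = 1"
    using D by (simp_all add: entry_distribution_def)
  interpret D: prob_space D using D by (simp add: entry_distribution_def)
  note pw = integrable_power_entry[OF D] and pl = integrable_entry_poly[OF D]
  have m2: "(\<integral>z. (z\<^sup>2 - 1)\<^sup>2 \<partial>D) = \<mu>4 - 1"
  proof -
    have "(z\<^sup>2 - 1)\<^sup>2 = z ^ 4 - 2 * z\<^sup>2 + 1" for z :: real by (simp add: power2_diff)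
    then show ?thesis using pw[of 4] D2 by (simp add: \<mu>4_def D.prob_space)
  qed
  have m1: "(\<integral>z. z\<^sup>2 - 1 \<partial>D) = 0" using D2 by (simp add: D.prob_space)
  have i1: "integrable D (\<lambda>z. z\<^sup>2 - 1)" using pl(1)[of 1] by simp
  let ?U = "\<lambda>z. A ^ 4 + 4 * A ^ 3 * B * z + 4 * A ^ 3 * c * (z\<^sup>2 - 1) +
    16 * A\<^sup>2 * B\<^sup>2 * z\<^sup>2 + 16 * A\<^sup>2 * c\<^sup>2 * (z\<^sup>2 - 1)\<^sup>2 + 24 * B ^ 4 * z ^ 4 + 24 * c ^ 4 * (z\<^sup>2 - 1) ^ 4"
  have iU: "integrable D ?U"
    using D1 D2 pw[of 4] pl(1)[of 2] pl(1)[of 4] i1 by (intro Bochner_Integration.integrable_add integrable_mult_right) auto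
  have le: "(A + (z * B + (z\<^sup>2 - 1) * c)) ^ 4 \<le> ?U z" for z by (rule fourth_power_expansion_le)
  have "?L \<le> (\<integral>\<^sup>+ z. ennreal (?U z) \<partial>D)" by (intro nn_integral_mono ennreal_leI le)
  also have "\<dots> = ennreal (\<integral>z. ?U z \<partial>D)"
  proof (intro nn_integral_eq_integral iU AE_I2)
    fix z
    have "0 \<le> (A + (z * B + (z\<^sup>2 - 1) * c)) ^ 4" by simp
    with le[of z] show "0 \<le> ?U z" by linarith
  qed
  also have "(\<integral>z. ?U z \<partial>D) = ?R"
    using D1 D2 pw[of 4] pl(1)[of 2] pl(1)[of 4] i1 m1 m2
    by (simp add: D.prob_space \<mu>4_def[symmetric] w4_def[symmetric] del: Bochner_Integration.integral_diff)
  finally show "?L \<le> ennreal ?R" .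
  have "(A + (z * B + (z\<^sup>2 - 1) * c))\<^sup>2 =
      A\<^sup>2 + 2 * A * B * z + 2 * A * c * (z\<^sup>2 - 1) + B\<^sup>2 * z\<^sup>2 + 2 * B * c * (z * (z\<^sup>2 - 1)) + c\<^sup>2 * (z\<^sup>2 - 1)\<^sup>2" for z
    by (simp add: power2_eq_square algebra_simps)
  then show "(\<integral>z. (A + (z * B + (z\<^sup>2 - 1) * c))\<^sup>2 \<partial>D) =
      A\<^sup>2 + B\<^sup>2 + 2 * c * (\<integral>z. z * (z\<^sup>2 - 1) \<partial>D) * B + (\<mu>4 - 1) * c\<^sup>2"
    using D1 D2 pl(1)[of 2] pl(2) i1 m1 m2
    by (simp add: D.prob_space del: Bochner_Integration.integral_diff)
qed

lemma nn_integral_product_le_of_fourth_moments: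
  fixes f g :: "'a \<Rightarrow> real"
  assumes [measurable]: "f \<in> borel_measurable M" "g \<in> borel_measurable M"
    and f: "(\<integral>\<^sup>+ x. ennreal (f x ^ 4) \<partial>M) \<le> ennreal (p\<^sup>2)"
    and g: "(\<integral>\<^sup>+ x. ennreal (g x ^ 4) \<partial>M) \<le> ennreal (q\<^sup>2)"
    and pq: "0 \<le> p" "0 \<le> q"
  shows "(\<integral>\<^sup>+ x. ennreal ((f x)\<^sup>2 * (g x)\<^sup>2) \<partial>M) \<le> ennreal (p * q)"
proof -
  let ?I = "\<integral>\<^sup>+ x. ennreal ((f x)\<^sup>2 * (g x)\<^sup>2) \<partial>M"
  have "?I\<^sup>2 = (\<integral>\<^sup>+ x. ennreal ((f x)\<^sup>2) * ennreal ((g x)\<^sup>2) \<partial>M)\<^sup>2" by (simp add: ennreal_mult)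
  also have "\<dots> \<le> (\<integral>\<^sup>+ x. (ennreal ((f x)\<^sup>2))\<^sup>2 \<partial>M) * (\<integral>\<^sup>+ x. (ennreal ((g x)\<^sup>2))\<^sup>2 \<partial>M)"
    by (rule Cauchy_Schwarz_nn_integral) measurable
  also have "\<dots> = (\<integral>\<^sup>+ x. ennreal (f x ^ 4) \<partial>M) * (\<integral>\<^sup>+ x. ennreal (g x ^ 4) \<partial>M)"
    by (simp add: ennreal_power)
  also have "\<dots> \<le> ennreal (p\<^sup>2) * ennreal (q\<^sup>2)" by (intro mult_mono f g) auto
  also have "\<dots> = ennreal ((p * q)\<^sup>2)" by (simp add: ennreal_mult[symmetric] power_mult_distrib)
  finally have le: "?I\<^sup>2 \<le> ennreal ((p * q)\<^sup>2)" .
  show ?thesis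
  proof (cases ?I)
    case (real r)
    have "r\<^sup>2 \<le> (p * q)\<^sup>2" using le unfolding real(2) by (simp add: ennreal_power real(1))
    then have "r \<le> p * q" by (rule power2_le_imp_le) (use pq in simp)
    then show ?thesis unfolding real(2) by (rule ennreal_leI)
  next
    case top
    then show ?thesis using le by (simp add: power2_eq_square top_unique)
  qed
qed

text \<open>Induction on the number of coordinates, with \<open>\<kappa>\<close> fixed in advance.
  Since \<open>A ^ 4\<close> keeps coefficient 1, every other term has to fit into the expansion of
  \<open>\<kappa> * (v + (b + \<rho> * c\<^sup>2))\<^sup>2\<close> beyond
  \<open>\<kappa> * v\<^sup>2\<close>: mixed terms into its cross products, fourth powers into its
  squares.\<close>

lemma centered_qf_hypercontractive:
  assumes D: "entry_distribution D"
  obtains \<kappa> where "1 \<le> \<kappa>"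
    "\<And>n \<tau> H. (\<integral>\<^sup>+ x. ennreal (centered_qf n \<tau> H x ^ 4) \<partial>iid D n) \<le> ennreal (\<kappa> * (qf_var D n \<tau> H)\<^sup>2)"
    "\<And>n \<tau> H. (\<integral>x. (centered_qf n \<tau> H x)\<^sup>2 \<partial>iid D n) = qf_var D n \<tau> H"
proof -
  define \<mu>4 where "\<mu>4 = (\<integral>x. x ^ 4 \<partial>D)"
  define w4 where "w4 = (\<integral>x. (x\<^sup>2 - 1) ^ 4 \<partial>D)"
  define \<rho> where "\<rho> = \<mu>4 - 1"
  have Dp: "prob_space D" and sets: "sets D = sets borel" and \<rho>: "0 < \<rho>"
    using D by (simp_all add: entry_distribution_def \<rho>_def \<mu>4_def)
  have w4: "0 \<le> w4" unfolding w4_def by (rule integral_nonneg_AE) simp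
  obtain \<kappa>1 where \<kappa>1: "0 < \<kappa>1"
    and lin: "\<And>n u. (\<integral>\<^sup>+ x. ennreal ((ip n u x) ^ 4) \<partial>iid D n) \<le> ennreal (\<kappa>1 * (ip n u u)\<^sup>2)"
    using subgaussian_linear_fourth_moment[OF D] by blast
  \<comment> \<open>One summand for each error term: \<open>64 * \<kappa>1\<close> for the product
    of \<open>A\<^sup>2\<close> and \<open>B\<^sup>2\<close>, where Cauchy-Schwarz costs
    \<open>16 * sqrt \<kappa> * sqrt \<kappa>1 \<le> 2 * \<kappa>\<close>; 8 for
    \<open>A\<^sup>2 * c\<^sup>2\<close>; the last two for \<open>B ^ 4\<close> and
    \<open>c ^ 4\<close>.\<close>
  define \<kappa> where "\<kappa> = 64 * \<kappa>1 + 8 + 24 * \<mu>4 * \<kappa>1 + 24 * w4 / \<rho>\<^sup>2"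
  have \<mu>4: "0 < \<mu>4" using \<rho> by (simp add: \<rho>_def)
  have t: "0 \<le> 64 * \<kappa>1" "0 \<le> 24 * \<mu>4 * \<kappa>1" "0 \<le> 24 * w4 / \<rho>\<^sup>2"
    using \<kappa>1 \<mu>4 w4 by auto
  have k1: "64 * \<kappa>1 \<le> \<kappa>" and k2: "8 \<le> \<kappa>" and k3: "24 * \<mu>4 * \<kappa>1 \<le> \<kappa>" and k4: "24 * w4 / \<rho>\<^sup>2 \<le> \<kappa>"
    using t by (auto simp: \<kappa>_def)
  have k4': "24 * w4 \<le> \<kappa> * \<rho>\<^sup>2" using k4 \<rho> by (simp add: divide_le_eq)
  have k1': "16 * (sqrt \<kappa> * sqrt \<kappa>1) \<le> 2 * \<kappa>"
  proof -
    have "sqrt (64 * \<kappa>1) \<le> sqrt \<kappa>" using k1 by (rule real_sqrt_le_mono)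
    then have "8 * sqrt \<kappa>1 \<le> sqrt \<kappa>" by (simp add: real_sqrt_mult)
    then have "2 * sqrt \<kappa> * (8 * sqrt \<kappa>1) \<le> 2 * sqrt \<kappa> * sqrt \<kappa>" using k2 by (intro mult_left_mono) auto
    moreover have "2 * sqrt \<kappa> * (8 * sqrt \<kappa>1) = 16 * (sqrt \<kappa> * sqrt \<kappa>1)" by simp
    moreover have "2 * sqrt \<kappa> * sqrt \<kappa> = 2 * \<kappa>" using k2 by simp
    ultimately show ?thesis by linarith
  qed
  note [measurable] = measurable_centered_qf[OF sets] measurable_ip_iid[OF sets]
  have main: "(\<integral>\<^sup>+ x. ennreal (centered_qf n \<tau> H x ^ 4) \<partial>iid D n) \<le> ennreal (\<kappa> * (qf_var D n \<tau> H)\<^sup>2) \<and>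
      (\<integral>x. (centered_qf n \<tau> H x)\<^sup>2 \<partial>iid D n) = qf_var D n \<tau> H" for n \<tau> H
  proof (induction n)
    case 0
    interpret P: prob_space "PiM {} (\<lambda>_::nat. D)" using Dp by (intro prob_space_PiM) auto
    have "1 * (\<tau> ^ 4) \<le> \<kappa> * (\<tau> ^ 4)" using k2 by (intro mult_right_mono) auto
    then show ?case
      using P.prob_space by (simp add: centered_qf_def qf_var_def P.emeasure_space_1 ennreal_leI)
  next
    case (Suc n)
    interpret P: prob_space "iid D n" by (rule prob_space_iid[OF Dp])
    interpret P': prob_space "iid D (Suc n)" by (rule prob_space_iid[OF Dp])
    define A where "A = centered_qf n \<tau> H"
    define u where "u = (\<lambda>j. 2 * H n j)"
    define B where "B = (\<lambda>x. ip n u x)"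
    define c where "c = H n n"
    define v where "v = qf_var D n \<tau> H"
    define b where "b = ip n u u"
    have [measurable]: "A \<in> borel_measurable (iid D n)" "B \<in> borel_measurable (iid D n)"
      unfolding A_def B_def by measurable
    have v': "qf_var D (Suc n) \<tau> H = v + (b + \<rho> * c\<^sup>2)"
      by (simp add: qf_var_def v_def b_def u_def c_def \<rho>_def \<mu>4_def)
    have A4: "(\<integral>\<^sup>+ x. ennreal (A x ^ 4) \<partial>iid D n) \<le> ennreal (\<kappa> * v\<^sup>2)" and A2: "(\<integral>x. (A x)\<^sup>2 \<partial>iid D n) = v"
      using Suc by (simp_all add: A_def v_def)
    have v0: "0 \<le> v" unfolding A2[symmetric] by (rule integral_nonneg_AE) simp
    have b0: "0 \<le> b" unfolding b_def by (rule ip_self_nonneg)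
    have Ai: "integrable (iid D n) (\<lambda>x. (A x)\<^sup>2)" using P.integrable_of_fourth_moment(2)[OF _ A4] by simp
    have A2n: "(\<integral>\<^sup>+ x. ennreal ((A x)\<^sup>2) \<partial>iid D n) = ennreal v"
      using Ai A2 by (subst nn_integral_eq_integral) auto
    have B4: "(\<integral>\<^sup>+ x. ennreal (B x ^ 4) \<partial>iid D n) \<le> ennreal (\<kappa>1 * b\<^sup>2)" unfolding B_def b_def by (rule lin)
    have AB: "(\<integral>\<^sup>+ x. ennreal ((A x)\<^sup>2 * (B x)\<^sup>2) \<partial>iid D n) \<le> ennreal ((sqrt \<kappa> * v) * (sqrt \<kappa>1 * b))"
      using A4 B4 v0 b0 \<kappa>1 k2
      by (intro nn_integral_product_le_of_fourth_moments) (simp_all add: power_mult_distrib)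
    have split: "centered_qf (Suc n) \<tau> H (x(n := z)) = A x + (z * B x + (z\<^sup>2 - 1) * c)" for x z
      by (simp add: centered_qf_Suc A_def B_def u_def c_def)
    have "(\<integral>\<^sup>+ x. ennreal (centered_qf (Suc n) \<tau> H x ^ 4) \<partial>iid D (Suc n)) =
        (\<integral>\<^sup>+ x. \<integral>\<^sup>+ z. ennreal ((A x + (z * B x + (z\<^sup>2 - 1) * c)) ^ 4) \<partial>D \<partial>iid D n)"
      by (subst iid_Suc_nn_integral(2)[OF Dp]) (measurable, simp add: split)
    also have "\<dots> \<le> (\<integral>\<^sup>+ x. ennreal (A x ^ 4 + 16 * (A x)\<^sup>2 * (B x)\<^sup>2 + 16 * (A x)\<^sup>2 * c\<^sup>2 * \<rho> +
        24 * B x ^ 4 * \<mu>4 + 24 * c ^ 4 * w4) \<partial>iid D n)"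
      unfolding \<rho>_def \<mu>4_def w4_def by (intro nn_integral_mono conditional_fourth_moment(1)[OF D])
    also have "\<dots> = (\<integral>\<^sup>+ x. (((ennreal (A x ^ 4) + 16 * ennreal ((A x)\<^sup>2 * (B x)\<^sup>2)) +
        ennreal (16 * c\<^sup>2 * \<rho>) * ennreal ((A x)\<^sup>2)) + ennreal (24 * \<mu>4) * ennreal (B x ^ 4)) +
        ennreal (24 * c ^ 4 * w4) \<partial>iid D n)"
    proof (rule nn_integral_cong)
      fix x
      have nn: "0 \<le> A x ^ 4" "0 \<le> 16 * ((A x)\<^sup>2 * (B x)\<^sup>2)" "0 \<le> (16 * c\<^sup>2 * \<rho>) * (A x)\<^sup>2"
        "0 \<le> (24 * \<mu>4) * B x ^ 4" "0 \<le> 24 * c ^ 4 * w4" "0 \<le> 16 * c\<^sup>2 * \<rho>" "0 \<le> 24 * \<mu>4" "0 \<le> B x ^ 4"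
        using \<rho> \<mu>4 w4 by auto
      have "ennreal (A x ^ 4 + 16 * (A x)\<^sup>2 * (B x)\<^sup>2 + 16 * (A x)\<^sup>2 * c\<^sup>2 * \<rho> + 24 * B x ^ 4 * \<mu>4 + 24 * c ^ 4 * w4) =
        ennreal ((((A x ^ 4 + 16 * ((A x)\<^sup>2 * (B x)\<^sup>2)) + (16 * c\<^sup>2 * \<rho>) * (A x)\<^sup>2) + (24 * \<mu>4) * B x ^ 4) + 24 * c ^ 4 * w4)"
        by (simp add: mult_ac)
      also have "\<dots> = (((ennreal (A x ^ 4) + ennreal (16 * ((A x)\<^sup>2 * (B x)\<^sup>2))) +
        ennreal ((16 * c\<^sup>2 * \<rho>) * (A x)\<^sup>2)) + ennreal ((24 * \<mu>4) * B x ^ 4)) + ennreal (24 * c ^ 4 * w4)"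
        using nn by (simp only: ennreal_plus add_nonneg_nonneg)
      also have "\<dots> = (((ennreal (A x ^ 4) + 16 * ennreal ((A x)\<^sup>2 * (B x)\<^sup>2)) +
        ennreal (16 * c\<^sup>2 * \<rho>) * ennreal ((A x)\<^sup>2)) + ennreal (24 * \<mu>4) * ennreal (B x ^ 4)) + ennreal (24 * c ^ 4 * w4)"
        using nn by (simp only: ennreal_mult[of "16 * c\<^sup>2 * \<rho>" "(A x)\<^sup>2"] ennreal_mult[of "24 * \<mu>4" "B x ^ 4"]
            ennreal_mult[of 16 "(A x)\<^sup>2 * (B x)\<^sup>2"] zero_le_power2 mult_nonneg_nonneg ennreal_numeral)
      finally show "ennreal (A x ^ 4 + 16 * (A x)\<^sup>2 * (B x)\<^sup>2 + 16 * (A x)\<^sup>2 * c\<^sup>2 * \<rho> + 24 * B x ^ 4 * \<mu>4 + 24 * c ^ 4 * w4) =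
        (((ennreal (A x ^ 4) + 16 * ennreal ((A x)\<^sup>2 * (B x)\<^sup>2)) +
        ennreal (16 * c\<^sup>2 * \<rho>) * ennreal ((A x)\<^sup>2)) + ennreal (24 * \<mu>4) * ennreal (B x ^ 4)) + ennreal (24 * c ^ 4 * w4)" .
    qed
    also have "\<dots> = ((((\<integral>\<^sup>+ x. ennreal (A x ^ 4) \<partial>iid D n) + 16 * (\<integral>\<^sup>+ x. ennreal ((A x)\<^sup>2 * (B x)\<^sup>2) \<partial>iid D n)) +
        ennreal (16 * c\<^sup>2 * \<rho>) * (\<integral>\<^sup>+ x. ennreal ((A x)\<^sup>2) \<partial>iid D n)) +
        ennreal (24 * \<mu>4) * (\<integral>\<^sup>+ x. ennreal (B x ^ 4) \<partial>iid D n)) + ennreal (24 * c ^ 4 * w4)"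
      by (simp add: nn_integral_add nn_integral_cmult P.emeasure_space_1)
    also have "\<dots> \<le> (((ennreal (\<kappa> * v\<^sup>2) + 16 * ennreal ((sqrt \<kappa> * v) * (sqrt \<kappa>1 * b))) +
        ennreal (16 * c\<^sup>2 * \<rho>) * ennreal v) + ennreal (24 * \<mu>4) * ennreal (\<kappa>1 * b\<^sup>2)) + ennreal (24 * c ^ 4 * w4)"
      unfolding A2n by (intro add_mono mult_left_mono A4 AB B4 order_refl) auto
    also have "\<dots> = ennreal (\<kappa> * v\<^sup>2 + 16 * ((sqrt \<kappa> * v) * (sqrt \<kappa>1 * b)) + (16 * c\<^sup>2 * \<rho>) * v +
        (24 * \<mu>4) * (\<kappa>1 * b\<^sup>2) + 24 * c ^ 4 * w4)"
    proof -
      have nn: "0 \<le> \<kappa> * v\<^sup>2" "0 \<le> 16 * ((sqrt \<kappa> * v) * (sqrt \<kappa>1 * b))" "0 \<le> (16 * c\<^sup>2 * \<rho>) * v"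
        "0 \<le> (24 * \<mu>4) * (\<kappa>1 * b\<^sup>2)" "0 \<le> 24 * c ^ 4 * w4" "0 \<le> (sqrt \<kappa> * v) * (sqrt \<kappa>1 * b)"
        "0 \<le> 16 * c\<^sup>2 * \<rho>" "0 \<le> 24 * \<mu>4" "0 \<le> \<kappa>1 * b\<^sup>2"
        using \<rho> \<mu>4 w4 v0 b0 \<kappa>1 k2 by auto
      have "16 * ennreal ((sqrt \<kappa> * v) * (sqrt \<kappa>1 * b)) = ennreal (16 * ((sqrt \<kappa> * v) * (sqrt \<kappa>1 * b)))"
        using nn by (subst ennreal_mult) auto
      moreover have "ennreal (16 * c\<^sup>2 * \<rho>) * ennreal v = ennreal ((16 * c\<^sup>2 * \<rho>) * v)"
        using nn v0 by (intro ennreal_mult[symmetric])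
      moreover have "ennreal (24 * \<mu>4) * ennreal (\<kappa>1 * b\<^sup>2) = ennreal ((24 * \<mu>4) * (\<kappa>1 * b\<^sup>2))"
        using nn by (intro ennreal_mult[symmetric])
      ultimately show ?thesis using nn by (simp only: ennreal_plus add_nonneg_nonneg)
    qed
    also have "\<dots> \<le> ennreal (\<kappa> * (v + (b + \<rho> * c\<^sup>2))\<^sup>2)"
    proof (rule ennreal_leI)
      have "16 * ((sqrt \<kappa> * v) * (sqrt \<kappa>1 * b)) = 16 * (sqrt \<kappa> * sqrt \<kappa>1) * (v * b)" by (simp add: mult_ac)
      also have "\<dots> \<le> 2 * \<kappa> * (v * b)" using k1' v0 b0 by (intro mult_right_mono) auto
      finally have 1: "16 * ((sqrt \<kappa> * v) * (sqrt \<kappa>1 * b)) \<le> 2 * \<kappa> * (v * b)" .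
      have "(16 * c\<^sup>2 * \<rho>) * v = 2 * 8 * (v * (\<rho> * c\<^sup>2))" by (simp add: mult_ac)
      also have "\<dots> \<le> 2 * \<kappa> * (v * (\<rho> * c\<^sup>2))" using k2 v0 \<rho> by (intro mult_right_mono) auto
      finally have 2: "(16 * c\<^sup>2 * \<rho>) * v \<le> 2 * \<kappa> * (v * (\<rho> * c\<^sup>2))" .
      have "(24 * \<mu>4) * (\<kappa>1 * b\<^sup>2) = (24 * \<mu>4 * \<kappa>1) * b\<^sup>2" by (simp add: mult_ac)
      also have "\<dots> \<le> \<kappa> * b\<^sup>2" using k3 by (intro mult_right_mono) auto
      finally have 3: "(24 * \<mu>4) * (\<kappa>1 * b\<^sup>2) \<le> \<kappa> * b\<^sup>2" .
      have "24 * c ^ 4 * w4 = 24 * w4 * c ^ 4" by (simp add: mult_ac)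
      also have "\<dots> \<le> \<kappa> * \<rho>\<^sup>2 * c ^ 4" using k4' by (intro mult_right_mono) auto
      finally have 4: "24 * c ^ 4 * w4 \<le> \<kappa> * (\<rho> * c\<^sup>2)\<^sup>2" by (simp add: power_mult_distrib mult.assoc)
      have 5: "0 \<le> 2 * \<kappa> * (b * (\<rho> * c\<^sup>2))" using k2 b0 \<rho> by auto
      have "\<kappa> * (v + (b + \<rho> * c\<^sup>2))\<^sup>2 = \<kappa> * v\<^sup>2 + 2 * \<kappa> * (v * b) + 2 * \<kappa> * (v * (\<rho> * c\<^sup>2)) + \<kappa> * b\<^sup>2 +
          \<kappa> * (\<rho> * c\<^sup>2)\<^sup>2 + 2 * \<kappa> * (b * (\<rho> * c\<^sup>2))"
        by (simp add: power2_eq_square algebra_simps)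
      then show "\<kappa> * v\<^sup>2 + 16 * ((sqrt \<kappa> * v) * (sqrt \<kappa>1 * b)) + (16 * c\<^sup>2 * \<rho>) * v + (24 * \<mu>4) * (\<kappa>1 * b\<^sup>2) +
          24 * c ^ 4 * w4 \<le> \<kappa> * (v + (b + \<rho> * c\<^sup>2))\<^sup>2"
        using 1 2 3 4 5 by linarith
    qed
    finally have fourth: "(\<integral>\<^sup>+ x. ennreal (centered_qf (Suc n) \<tau> H x ^ 4) \<partial>iid D (Suc n)) \<le>
        ennreal (\<kappa> * (qf_var D (Suc n) \<tau> H)\<^sup>2)" unfolding v' .
    have int2: "integrable (iid D (Suc n)) (\<lambda>x. (centered_qf (Suc n) \<tau> H x)\<^sup>2)"
      using P'.integrable_of_fourth_moment(2)[OF _ fourth] by simp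
    define e where "e = (\<integral>z. z * (z\<^sup>2 - 1) \<partial>D)"
    have "(\<integral>x. (centered_qf (Suc n) \<tau> H x)\<^sup>2 \<partial>iid D (Suc n)) =
        (\<integral>x. \<integral>z. (A x + (z * B x + (z\<^sup>2 - 1) * c))\<^sup>2 \<partial>D \<partial>iid D n)"
      using iid_Suc_integral(3)[OF Dp int2] by (simp only: split)
    also have "\<dots> = (\<integral>x. (A x)\<^sup>2 + (B x)\<^sup>2 + 2 * c * e * B x + \<rho> * c\<^sup>2 \<partial>iid D n)"
      unfolding conditional_fourth_moment(2)[OF D] by (simp add: \<rho>_def \<mu>4_def e_def)
    also have "\<dots> = v + b + \<rho> * c\<^sup>2"
      using Ai A2 linear_form_moments[OF D, of n u] by (simp add: B_def b_def P.prob_space)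
    finally show ?case using fourth by (simp add: v' add.assoc)
  qed
  show thesis using that[of \<kappa>] k2 main by auto
qed

text \<open>A Paley-Zygmund argument for the truncated modulus: the part of the second moment beyond
  the truncation is paid for by half of the normalised fourth moment, so at least \<open>1/2\<close>
  of the unit second moment remains.\<close>

lemma qf_small_ball:
  assumes D: "entry_distribution D"
  obtains b where "1 \<le> b"
    "\<And>n H. symm_on n H \<Longrightarrow> qf_var D n (\<Sum>i<n. H i i) H = 1 \<Longrightarrow>
      1 / (2 * b) \<le> (\<integral>x. min \<bar>ip n x (mv n H x)\<bar> b \<partial>iid D n)"
    "\<And>n H. symm_on n H \<Longrightarrow> integrable (iid D n) (\<lambda>x. ip n x (mv n H x))"
proof -
  have Dp: "prob_space D" and sets: "sets D = sets borel" using D by (simp_all add: entry_distribution_def)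
  obtain \<kappa> where \<kappa>: "1 \<le> \<kappa>"
    and m4: "\<And>n \<tau> H. (\<integral>\<^sup>+ x. ennreal (centered_qf n \<tau> H x ^ 4) \<partial>iid D n) \<le> ennreal (\<kappa> * (qf_var D n \<tau> H)\<^sup>2)"
    and m2: "\<And>n \<tau> H. (\<integral>x. (centered_qf n \<tau> H x)\<^sup>2 \<partial>iid D n) = qf_var D n \<tau> H"
    using centered_qf_hypercontractive[OF D] by blast
  define b where "b = sqrt \<kappa>"
  have b: "1 \<le> b" and bb: "b * b = \<kappa>" using \<kappa> by (simp_all add: b_def)
  have sb: "1 / (2 * b) \<le> (\<integral>x. min \<bar>centered_qf n \<tau> H x\<bar> b \<partial>iid D n)"
    if v: "qf_var D n \<tau> H = 1" for n \<tau> H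
  proof -
    interpret P: prob_space "iid D n" by (rule prob_space_iid[OF Dp])
    define X where "X = centered_qf n \<tau> H"
    have Xm [measurable]: "X \<in> borel_measurable (iid D n)" unfolding X_def by (rule measurable_centered_qf[OF sets])
    have X4: "(\<integral>\<^sup>+ x. ennreal (X x ^ 4) \<partial>iid D n) \<le> ennreal \<kappa>" using m4[of n \<tau> H] by (simp add: v X_def)
    have X2: "(\<integral>x. (X x)\<^sup>2 \<partial>iid D n) = 1" using m2[of n \<tau> H] by (simp add: v X_def)
    note i4 = P.integrable_of_fourth_moment(1,2)[OF Xm X4]
    have im: "integrable (iid D n) (\<lambda>x. min \<bar>X x\<bar> b)"
      using b by (intro P.integrable_const_bound[of _ b]) auto
    have I4: "(\<integral>x. X x ^ 4 \<partial>iid D n) \<le> \<kappa>"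
    proof -
      have "ennreal (\<integral>x. X x ^ 4 \<partial>iid D n) \<le> ennreal \<kappa>"
        using X4 i4 by (subst nn_integral_eq_integral[symmetric]) auto
      then show ?thesis using \<kappa> by (subst (asm) ennreal_le_iff) auto
    qed
    have pt: "(X x)\<^sup>2 \<le> b * min \<bar>X x\<bar> b + X x ^ 4 / (2 * \<kappa>)" for x
    proof (cases "\<bar>X x\<bar> \<le> b")
      case True
      have "(X x)\<^sup>2 = \<bar>X x\<bar> * \<bar>X x\<bar>" by (simp add: power2_eq_square)
      also have "\<dots> \<le> b * \<bar>X x\<bar>" using True by (intro mult_right_mono) auto
      finally have "(X x)\<^sup>2 \<le> b * min \<bar>X x\<bar> b" using True by simp
      moreover have "0 \<le> X x ^ 4 / (2 * \<kappa>)" using \<kappa> by simp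
      ultimately show ?thesis by linarith
    next
      case False
      \<comment> \<open>Beyond the level \<open>b = sqrt \<kappa>\<close> the truncated term equals
        \<open>\<kappa>\<close>, while this square needs only \<open>\<kappa> / 2\<close>.\<close>
      have "0 \<le> ((X x)\<^sup>2 - \<kappa>)\<^sup>2 / (2 * \<kappa>)" using \<kappa> by simp
      also have "\<dots> = X x ^ 4 / (2 * \<kappa>) - (X x)\<^sup>2 + \<kappa> / 2"
        using \<kappa> by (simp add: power2_diff field_simps) (simp add: power2_eq_square power4_eq_xxxx)
      finally show ?thesis using False bb \<kappa> by simp
    qed
    have "1 \<le> (\<integral>x. b * min \<bar>X x\<bar> b + X x ^ 4 / (2 * \<kappa>) \<partial>iid D n)"
      unfolding X2[symmetric] using i4 im by (intro integral_mono pt) auto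
    also have "\<dots> = b * (\<integral>x. min \<bar>X x\<bar> b \<partial>iid D n) + (\<integral>x. X x ^ 4 \<partial>iid D n) / (2 * \<kappa>)"
      using i4 im by simp
    also have "\<dots> \<le> b * (\<integral>x. min \<bar>X x\<bar> b \<partial>iid D n) + 1 / 2"
      using I4 \<kappa> by (simp add: divide_le_eq)
    finally have "1 / 2 \<le> b * (\<integral>x. min \<bar>X x\<bar> b \<partial>iid D n)" by simp
    then show ?thesis using b by (simp add: X_def field_simps)
  qed
  have "integrable (iid D n) (centered_qf n \<tau> H)" for n \<tau> H
    using prob_space.integrable_of_fourth_moment(3)[OF prob_space_iid[OF Dp] measurable_centered_qf[OF sets] m4] .
  then show thesis
    using that[OF b] sb by (simp add: quadratic_form_eq_centered_qf)
qed

section \<open>The uniform lower bound\<close>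

text \<open>Applied to the normalised matrices, it reduces an uncountable family of inequalities to
  a countable one and so secures measurability.\<close>

lemma countable_dense_subset:
  fixes S :: "'a :: second_countable_topology set"
  obtains T where "countable T" "T \<subseteq> S" "S \<subseteq> closure T"
proof -
  obtain B :: "'a set set" where B: "countable B" "topological_basis B"
    using ex_countable_basis by blast
  define pick where "pick = (\<lambda>b. SOME x. x \<in> b \<inter> S)"
  have pick: "pick b \<in> b \<inter> S" if "b \<inter> S \<noteq> {}" for b
  proof -
    have "\<exists>x. x \<in> b \<inter> S" using that by blast
    then show ?thesis unfolding pick_def by (rule someI_ex)
  qed
  define T where "T = pick ` {b \<in> B. b \<inter> S \<noteq> {}}"
  have "countable T" using B by (simp add: T_def)
  moreover have "T \<subseteq> S" using pick by (auto simp: T_def)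
  moreover have "S \<subseteq> closure T"
  proof
    fix x assume x: "x \<in> S"
    show "x \<in> closure T"
      unfolding closure_iff_nhds_not_empty
    proof (intro allI impI)
      fix A U assume U: "U \<subseteq> A" "open U" "x \<in> U"
      obtain b where b: "b \<in> B" "x \<in> b" "b \<subseteq> U"
        using topological_basisE[OF B(2) U(2,3)] by blast
      then have "b \<inter> S \<noteq> {}" using x by blast
      then have "pick b \<in> T" "pick b \<in> A" using pick[of b] b U by (auto simp: T_def)
      then show "T \<inter> A \<noteq> {}" by blast
    qed
  qed
  ultimately show thesis by (rule that)
qed

lemma measurable_quadratic_form_iid:
  assumes "sets D = sets borel"
  shows "(\<lambda>x. ip n x (mv n H x)) \<in> borel_measurable (iid D n)"
proof -
  have "(\<lambda>x. x i) \<in> borel_measurable (iid D n)" if "i < n" for i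
    using that measurable_component_singleton[of i "{..<n}" "\<lambda>_. D"] assms
    by (auto cong: measurable_cong_sets)
  then show ?thesis
    unfolding ip_def mv_def by (intro borel_measurable_sum borel_measurable_times) auto
qed

abbreviation trunc_qf :: "nat \<Rightarrow> real \<Rightarrow> (nat \<Rightarrow> nat \<Rightarrow> real) \<Rightarrow> (nat \<Rightarrow> real) \<Rightarrow> real" where
  "trunc_qf n b H x \<equiv> min \<bar>ip n x (mv n H x)\<bar> b"

text \<open>\<open>Z\<close> is the largest shortfall of a truncated sum below its mean.
  Symmetrisation and the hypothesis on the signed process bound its mean, and bounded differences of
  size \<open>b\<close> control its fluctuation.\<close>

lemma finite_class_concentration:
  assumes D: "entry_distribution D" and b: "1 \<le> b"
    and int: "\<And>H. H \<in> F \<Longrightarrow> integrable (iid D n) (\<lambda>x. ip n x (mv n H x))"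
    and F: "finite F" "F \<noteq> {}"
    and mean: "\<And>H. H \<in> F \<Longrightarrow> 1 / (2 * b) \<le> (\<integral>x. trunc_qf n b H x \<partial>iid D n)"
    and m: "0 < m"
    and sup: "(\<integral>w. Max ((\<lambda>H. \<Sum>i<m. 2 * (snd (w i) * ip n (fst (w i)) (mv n H (fst (w i))))) ` F)
        \<partial>iid (signed_sample D n) m) \<le> real m / (8 * b)"
  shows "measure (iid (signed_sample D n) m)
    {w \<in> space (iid (signed_sample D n) m). \<forall>H\<in>F. real m / (4 * b) \<le> (\<Sum>i<m. trunc_qf n b H (fst (w i)))}
    \<ge> 1 - exp (- real m / (32 * b ^ 4))"
proof -
  let ?Q = "signed_sample D n"
  have Dp: "prob_space D" and sets: "sets D = sets borel" using D by (simp_all add: entry_distribution_def)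
  have Q: "prob_space ?Q" by (rule prob_space_signed_sample[OF Dp])
  interpret M: prob_space "iid D n" by (rule prob_space_iid[OF Dp])
  interpret Q: prob_space ?Q by (rule Q)
  interpret P: prob_space "iid ?Q m" by (rule prob_space_iid[OF Q])
  define f where "f = (\<lambda>H x. ip n x (mv n H x))"
  define \<psi> where "\<psi> = (\<lambda>t::real. min \<bar>t\<bar> b)"
  have \<psi>0: "0 \<le> \<psi> t" and \<psi>b: "\<psi> t \<le> b" for t using b by (auto simp: \<psi>_def)
  have lip: "\<bar>\<psi> s - \<psi> t\<bar> \<le> \<bar>s - t\<bar>" for s t unfolding \<psi>_def by linarith
  have fm [measurable]: "f H \<in> borel_measurable (iid D n)" for H
    unfolding f_def by (rule measurable_quadratic_form_iid[OF sets])
  have fi: "integrable (iid D n) (f H)" if "H \<in> F" for H using int[OF that] by (simp add: f_def)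
  have \<psi>i: "integrable (iid D n) (\<lambda>x. \<psi> (f H x))" for H
    using \<psi>0 \<psi>b by (intro M.integrable_const_bound[of _ b]) (auto simp: \<psi>_def)
  define e where "e = (\<lambda>H. \<integral>x. \<psi> (f H x) \<partial>iid D n)"
  define a1 where "a1 = (\<lambda>H x. e H - \<psi> (f H x))"
  define a where "a = (\<lambda>H (z :: (nat \<Rightarrow> real) \<times> real). a1 H (fst z))"
  \<comment> \<open>\<open>a\<close> ignores the sign, and averaging \<open>c\<close> over it gives
    exactly the right side of \<open>Max_symmetrize_contract\<close>, whose factor 2 appears
    here.\<close>
  define c where "c = (\<lambda>H (z :: (nat \<Rightarrow> real) \<times> real). 2 * (snd z * f H (fst z)))"
  have e0: "0 \<le> e H" for H unfolding e_def using \<psi>0 by (intro integral_nonneg_AE) simp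
  have eb: "e H \<le> b" for H
  proof -
    have "e H \<le> (\<integral>x. b \<partial>iid D n)" unfolding e_def using \<psi>i \<psi>b by (intro integral_mono) auto
    then show ?thesis by (simp add: M.prob_space)
  qed
  have a1m: "a1 H \<in> borel_measurable (iid D n)" for H unfolding a1_def \<psi>_def by measurable
  have am: "a H \<in> borel_measurable ?Q" for H
    unfolding a_def by (rule measurable_compose[OF measurable_fst a1m])
  have a1i: "integrable (iid D n) (a1 H)" for H unfolding a1_def using \<psi>i by auto
  have ai: "integrable ?Q (a H)" for H
    using a1i by (intro integrable_rademacher am) (auto simp: a_def)
  have cm: "c H \<in> borel_measurable ?Q" for H
    unfolding c_def
    by (intro borel_measurable_times borel_measurable_const measurable_snd_rademacher
        measurable_compose[OF measurable_fst fm])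
  have ci: "integrable ?Q (c H)" if "H \<in> F" for H
    using fi[OF that] by (intro integrable_rademacher cm) (auto simp: c_def)
  have step: "(\<integral>z. Max ((\<lambda>H. g H + a H z) ` F) \<partial>?Q) \<le> (\<integral>z. Max ((\<lambda>H. g H + c H z) ` F) \<partial>?Q)" for g
  proof -
    have ga: "integrable ?Q (\<lambda>z. Max ((\<lambda>H. g H + a H z) ` F))"
      and gc: "integrable ?Q (\<lambda>z. Max ((\<lambda>H. g H + c H z) ` F))"
      by (intro integrable_Max F Bochner_Integration.integrable_add Q.integrable_const ai ci; assumption)+
    have "(\<integral>z. Max ((\<lambda>H. g H + a H z) ` F) \<partial>?Q) = (\<integral>x. Max ((\<lambda>H. g H + a1 H x) ` F) \<partial>iid D n)"
      by (subst integral_rademacher[OF M.prob_space_axioms ga]) (simp add: a_def)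
    also have "\<dots> \<le> (\<integral>x. (Max ((\<lambda>H. g H + 2 * f H x) ` F) + Max ((\<lambda>H. g H - 2 * f H x) ` F)) / 2 \<partial>iid D n)"
      unfolding a1_def e_def by (intro M.Max_symmetrize_contract F fi \<psi>i lip)
    also have "\<dots> = (\<integral>z. Max ((\<lambda>H. g H + c H z) ` F) \<partial>?Q)"
      by (subst integral_rademacher[OF M.prob_space_axioms gc]) (simp add: c_def)
    finally show ?thesis .
  qed
  define Z where "Z = (\<lambda>w. Max ((\<lambda>H. \<Sum>i<m. a H (w i)) ` F))"
  have Zi: "integrable (iid ?Q m) Z"
    unfolding Z_def using F ai
    by (intro integrable_Max Bochner_Integration.integrable_sum integrable_iid_component[OF Q]) auto
  have "(\<integral>w. Z w \<partial>iid ?Q m) \<le> (\<integral>w. Max ((\<lambda>H. \<Sum>i<m. c H (w i)) ` F) \<partial>iid ?Q m)"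
    using integral_Max_sum_mono[OF Q F ai ci step, where g = "\<lambda>_. 0" and m = m] by (simp add: Z_def)
  also have "\<dots> \<le> real m / (8 * b)" using sup by (simp add: c_def f_def)
  finally have EZ: "(\<integral>w. Z w \<partial>iid ?Q m) \<le> real m / (8 * b)" .
  have ge: "(\<Sum>i<m. a H (w i)) \<le> Z w" if "H \<in> F" for H w
    unfolding Z_def using F that by (intro Max_ge) auto
  have Zin: "\<exists>H\<in>F. Z w = (\<Sum>i<m. a H (w i))" for w
  proof -
    have "Z w \<in> (\<lambda>H. \<Sum>i<m. a H (w i)) ` F" unfolding Z_def using F by (intro Max_in) auto
    then show ?thesis by blast
  qed
  have abnd: "\<bar>a H z\<bar> \<le> b" for H z
    using \<psi>0[of "f H (fst z)"] \<psi>b[of "f H (fst z)"] e0[of H] eb[of H] by (simp add: a_def a1_def abs_le_iff)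
  have adiff: "a H y - a H z \<le> b" for H y z
    using \<psi>0[of "f H (fst y)"] \<psi>b[of "f H (fst z)"] by (simp add: a_def a1_def)
  have bdd: "\<bar>Z w\<bar> \<le> real m * b" for w
  proof -
    obtain H where "Z w = (\<Sum>i<m. a H (w i))" using Zin by blast
    moreover have "\<bar>\<Sum>i<m. a H (w i)\<bar> \<le> (\<Sum>i<m. b)"
      by (rule order_trans[OF sum_abs sum_mono]) (rule abnd)
    ultimately show ?thesis by simp
  qed
  have diff: "Z (w(i := y)) - Z (w(i := z)) \<le> b" if "i < m" for w i y z
  proof -
    \<comment> \<open>The maximiser at one point is tested at the other, so the two values differ in
      its \<open>i\<close>-th term alone.\<close>
    obtain H where H: "H \<in> F" "Z (w(i := y)) = (\<Sum>j<m. a H ((w(i := y)) j))" using Zin by blast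
    have upd: "(\<Sum>j<m. a H ((w(i := u)) j)) = a H u + (\<Sum>j\<in>{..<m} - {i}. a H (w j))" for u
    proof -
      have "(\<Sum>j<m. a H ((w(i := u)) j)) = a H ((w(i := u)) i) + (\<Sum>j\<in>{..<m} - {i}. a H ((w(i := u)) j))"
        using that by (intro sum.remove) auto
      also have "(\<Sum>j\<in>{..<m} - {i}. a H ((w(i := u)) j)) = (\<Sum>j\<in>{..<m} - {i}. a H (w j))"
        by (intro sum.cong) auto
      finally show ?thesis by simp
    qed
    show ?thesis using H(2) ge[OF H(1), of "w(i := z)"] adiff[of H y z] unfolding upd by linarith
  qed
  \<comment> \<open>The mean \<open>m / (2 * b)\<close> is divided into \<open>m / (8 * b)\<close>
    for the expected supremum, the same for its fluctuation, and \<open>m / (4 * b)\<close> for the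
    conclusion.\<close>
  let ?t = "1 / (8 * b)"
  let ?bad = "{w \<in> space (iid ?Q m). Z w \<ge> (\<integral>w. Z w \<partial>iid ?Q m) + ?t * real m}"
  let ?good = "{w \<in> space (iid ?Q m). \<forall>H\<in>F. real m / (4 * b) \<le> (\<Sum>i<m. trunc_qf n b H (fst (w i)))}"
  have "measure (iid ?Q m) ?bad \<le> exp (- 2 * ?t\<^sup>2 * real m / b\<^sup>2)"
    using b m Zi bdd diff by (intro McDiarmid[OF Q, of b m ?t Z "real m * b"]) auto
  also have "- 2 * ?t\<^sup>2 * real m / b\<^sup>2 = - real m / (32 * b ^ 4)"
    using b by (simp add: field_simps power2_eq_square power4_eq_xxxx)
  finally have bad: "measure (iid ?Q m) ?bad \<le> exp (- real m / (32 * b ^ 4))" .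
  have badm: "?bad \<in> P.events"
    using borel_measurable_integrable[OF Zi] by measurable
  have trm: "(\<lambda>w. \<Sum>i<m. trunc_qf n b H (fst (w i))) \<in> borel_measurable (iid ?Q m)" for H
  proof -
    have "(\<lambda>x. \<psi> (f H x)) \<in> borel_measurable (iid D n)" using \<psi>i by auto
    then have "(\<lambda>z. \<psi> (f H (fst z))) \<in> borel_measurable ?Q" by (rule measurable_compose[OF measurable_fst])
    then have "(\<lambda>w. \<psi> (f H (fst (w i)))) \<in> borel_measurable (iid ?Q m)" if "i < m" for i
      using that by (intro measurable_compose[OF measurable_component_singleton[of i]]) auto
    then show ?thesis unfolding \<psi>_def f_def by (intro borel_measurable_sum) auto
  qed
  have goodm: "?good \<in> P.events"
    using F trm by (intro sets.sets_Collect_finite_All borel_measurable_le) auto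
  have "space (iid ?Q m) - ?bad \<subseteq> ?good"
  proof
    fix w assume w: "w \<in> space (iid ?Q m) - ?bad"
    have "real m / (4 * b) \<le> (\<Sum>i<m. trunc_qf n b H (fst (w i)))" if H: "H \<in> F" for H
    proof -
      have "Z w < (\<integral>w. Z w \<partial>iid ?Q m) + ?t * real m" using w by auto
      then have "(\<Sum>i<m. a H (w i)) < real m / (8 * b) + ?t * real m" using ge[OF H, of w] EZ by linarith
      moreover have "(\<Sum>i<m. a H (w i)) = real m * e H - (\<Sum>i<m. trunc_qf n b H (fst (w i)))"
        by (simp add: a_def a1_def sum_subtractf \<psi>_def f_def)
      moreover have "real m * (1 / (2 * b)) \<le> real m * e H"
        using mean[OF H] by (intro mult_left_mono) (simp_all add: e_def \<psi>_def f_def)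
      moreover have "real m * (1 / (2 * b)) = real m / (8 * b) + ?t * real m + real m / (4 * b)"
        using b by (simp add: field_simps)
      ultimately show ?thesis by linarith
    qed
    then show "w \<in> ?good" using w by blast
  qed
  then have "measure (iid ?Q m) (space (iid ?Q m) - ?bad) \<le> measure (iid ?Q m) ?good"
    using goodm by (rule P.finite_measure_mono)
  then show ?thesis using bad P.prob_compl[OF badm] by linarith
qed

text \<open>Forgetting the signs and uncurrying the indices. Product measures are determined by
  boxes, and the preimage of a box is a box whose sign components are unrestricted.\<close>

lemma distr_signed_sample_sample_space:
  fixes D :: "real measure" and m n :: nat
  assumes Dp: "prob_space D"
  defines "g \<equiv> (\<lambda>w :: nat \<Rightarrow> (nat \<Rightarrow> real) \<times> real. \<lambda>p\<in>{..<m} \<times> {..<n}. fst (w (fst p)) (snd p))"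
  shows "g \<in> iid (signed_sample D n) m \<rightarrow>\<^sub>M sample_space D m n"
    and "distr (iid (signed_sample D n) m) (sample_space D m n) g = sample_space D m n"
proof -
  let ?Q = "signed_sample D n"
  interpret D: prob_space D by fact
  interpret R: prob_space rademacher by (rule prob_space_rademacher)
  have Q: "prob_space ?Q" by (rule prob_space_signed_sample[OF Dp])
  interpret Q: prob_space ?Q by (rule Q)
  interpret PD: product_sigma_finite "\<lambda>_::nat \<times> nat. D" ..
  interpret PDn: product_sigma_finite "\<lambda>_::nat. D" ..
  interpret PQ: product_sigma_finite "\<lambda>_::nat. ?Q" ..
  show g: "g \<in> iid ?Q m \<rightarrow>\<^sub>M sample_space D m n"
    unfolding g_def sample_space_def
  proof (rule measurable_restrict)
    fix p :: "nat \<times> nat" assume p: "p \<in> {..<m} \<times> {..<n}"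
    have 1: "(\<lambda>w. w (fst p)) \<in> iid ?Q m \<rightarrow>\<^sub>M ?Q"
      using p by (intro measurable_component_singleton) auto
    have 2: "(\<lambda>x. x (snd p)) \<in> iid D n \<rightarrow>\<^sub>M D"
      using p by (intro measurable_component_singleton) auto
    show "(\<lambda>w. fst (w (fst p)) (snd p)) \<in> iid ?Q m \<rightarrow>\<^sub>M D"
      using measurable_compose[OF 1 measurable_compose[OF measurable_fst 2]] .
  qed
  show "distr (iid ?Q m) (sample_space D m n) g = sample_space D m n"
    unfolding sample_space_def
  proof (rule PD.PiM_eqI)
    show "finite ({..<m} \<times> {..<n})" by simp
    fix A assume A: "\<And>i. i \<in> {..<m} \<times> {..<n} \<Longrightarrow> A i \<in> sets D"
    let ?B = "\<lambda>i. PiE {..<n} (\<lambda>j. A (i, j))"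
    have Bm: "?B i \<in> sets (iid D n)" if "i < m" for i
      using A that by (intro sets_PiM_I_finite) auto
    have pre: "g -` PiE ({..<m} \<times> {..<n}) A \<inter> space (iid ?Q m) = PiE {..<m} (\<lambda>i. ?B i \<times> (UNIV :: real set))"
    proof (rule equalityI; rule subsetI)
      fix w assume w: "w \<in> g -` PiE ({..<m} \<times> {..<n}) A \<inter> space (iid ?Q m)"
      then have ext: "w \<in> extensional {..<m}" and wi: "\<And>i. i < m \<Longrightarrow> w i \<in> space ?Q"
        by (auto simp: space_PiM PiE_def)
      have "fst (w i) \<in> ?B i" if "i < m" for i
      proof (rule PiE_I)
        fix j assume j: "j \<in> {..<n}"
        have "g w (i, j) \<in> A (i, j)" using w that j by auto
        then show "fst (w i) j \<in> A (i, j)" using that j by (simp add: g_def)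
      next
        fix j assume "j \<notin> {..<n}"
        then show "fst (w i) j = undefined"
          using wi[OF that] by (auto simp: space_pair_measure space_PiM PiE_def extensional_def)
      qed
      then show "w \<in> PiE {..<m} (\<lambda>i. ?B i \<times> (UNIV :: real set))"
        using ext by (auto simp: PiE_def mem_Times_iff)
    next
      fix w assume w: "w \<in> PiE {..<m} (\<lambda>i. ?B i \<times> (UNIV :: real set))"
      have "w i \<in> space ?Q" if "i < m" for i
      proof -
        have "fst (w i) \<in> ?B i" using PiE_mem[OF w] that by (auto simp: mem_Times_iff)
        then have "fst (w i) \<in> space (iid D n)" using sets.sets_into_space[OF Bm[OF that]] by blast
        then show ?thesis by (simp add: space_pair_measure rademacher_def mem_Times_iff)
      qed
      then have "w \<in> space (iid ?Q m)" using w by (auto simp: space_PiM PiE_def)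
      moreover have "g w \<in> PiE ({..<m} \<times> {..<n}) A"
        using w by (auto simp: g_def PiE_iff mem_Times_iff)
      ultimately show "w \<in> g -` PiE ({..<m} \<times> {..<n}) A \<inter> space (iid ?Q m)" by blast
    qed
    have "emeasure (distr (iid ?Q m) (PiM ({..<m} \<times> {..<n}) (\<lambda>_. D)) g) (PiE ({..<m} \<times> {..<n}) A) =
        emeasure (iid ?Q m) (PiE {..<m} (\<lambda>i. ?B i \<times> (UNIV :: real set)))"
      using g A by (subst emeasure_distr) (auto simp: pre sample_space_def intro!: sets_PiM_I_finite)
    also have "\<dots> = (\<Prod>i<m. emeasure ?Q (?B i \<times> (UNIV :: real set)))"
      using Bm by (intro PQ.emeasure_PiM) (auto simp: rademacher_def)
    also have "\<dots> = (\<Prod>i<m. \<Prod>j<n. emeasure D (A (i, j)))"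
    proof (rule prod.cong[OF refl])
      fix i assume i: "i \<in> {..<m}"
      have "emeasure ?Q (?B i \<times> (UNIV :: real set)) = emeasure (iid D n) (?B i) * emeasure rademacher UNIV"
        using Bm i by (intro R.emeasure_pair_measure_Times) (auto simp: rademacher_def)
      also have "emeasure rademacher UNIV = 1" using R.emeasure_space_1 by (simp add: rademacher_def)
      also have "emeasure (iid D n) (?B i) = (\<Prod>j<n. emeasure D (A (i, j)))"
        using A i by (intro PDn.emeasure_PiM) auto
      finally show "emeasure ?Q (?B i \<times> (UNIV :: real set)) = (\<Prod>j<n. emeasure D (A (i, j)))" by simp
    qed
    also have "\<dots> = (\<Prod>p\<in>{..<m} \<times> {..<n}. emeasure D (A p))" by (simp add: prod.cartesian_product)
    finally show "emeasure (distr (iid ?Q m) (PiM ({..<m} \<times> {..<n}) (\<lambda>_. D)) g) (PiE ({..<m} \<times> {..<n}) A) =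
        (\<Prod>i\<in>{..<m} \<times> {..<n}. emeasure D (A i))" .
  qed simp
qed

text \<open>Continuity from above along the initial segments of an enumeration; the bound
  \<open>q\<close> is the same for all finite subfamilies.\<close>

lemma (in prob_space) countable_intersection_measure_ge:
  assumes T: "countable T" and A: "\<And>H. H \<in> T \<Longrightarrow> A H \<in> events"
    and fin: "\<And>F. finite F \<Longrightarrow> F \<noteq> {} \<Longrightarrow> F \<subseteq> T \<Longrightarrow> q \<le> prob {w \<in> space M. \<forall>H\<in>F. w \<in> A H}"
    and q: "q \<le> 1"
  shows "{w \<in> space M. \<forall>H\<in>T. w \<in> A H} \<in> events" "q \<le> prob {w \<in> space M. \<forall>H\<in>T. w \<in> A H}"
proof -
  show "{w \<in> space M. \<forall>H\<in>T. w \<in> A H} \<in> events"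
  proof -
    have "{w \<in> space M. \<forall>H\<in>T. w \<in> A H} = space M - (\<Union>H\<in>T. space M - A H)" by blast
    also have "\<dots> \<in> events" using A T by (intro sets.Diff sets.top sets.countable_UN') auto
    finally show ?thesis .
  qed
  show "q \<le> prob {w \<in> space M. \<forall>H\<in>T. w \<in> A H}"
  \<comment> \<open>This happens for \<open>n = 0\<close>, where no matrix has second moment 1; an
    enumeration of \<open>T\<close> requires a nonempty set.\<close>
  proof (cases "T = {}")
    case True
    then show ?thesis using q by (simp add: prob_space)
  next
    case False
    define B where "B = (\<lambda>k. {w \<in> space M. \<forall>H\<in>from_nat_into T ` {..k::nat}. w \<in> A H})"
    have inT: "from_nat_into T k \<in> T" for k using False by (rule from_nat_into)
    have "B k \<in> events" for k
      unfolding B_def using A inT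
      by (intro sets.sets_Collect_finite_All) (auto simp: Int_def[symmetric] intro!: sets.Int)
    moreover have "decseq B" unfolding B_def decseq_def by auto
    ultimately have lim: "(\<lambda>k. prob (B k)) \<longlonglongrightarrow> prob (\<Inter>k. B k)"
      by (intro finite_Lim_measure_decseq) auto
    have "q \<le> prob (B k)" for k
      unfolding B_def using inT by (intro fin) auto
    then have "q \<le> prob (\<Inter>k. B k)" by (intro LIMSEQ_le_const[OF lim]) auto
    also have "(\<Inter>k. B k) = {w \<in> space M. \<forall>H\<in>T. w \<in> A H}"
    proof -
      have "\<forall>H\<in>T. \<exists>k. H = from_nat_into T k" using from_nat_into_surj[OF T] by metis
      then show ?thesis using inT unfolding B_def by blast
    qed
    finally show ?thesis .
  qed
qed

section \<open>Recovery\<close>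

text \<open>Normalised by the second moment of the quadratic form, with the trace as
  \<open>\<tau>\<close>, since \<open>qf_small_ball\<close> is stated at that scale. The dual bound
  keeps the class small enough for the supremum estimate.\<close>

definition normalized_class :: "real measure \<Rightarrow> nat \<Rightarrow> real \<Rightarrow> (nat \<Rightarrow> nat \<Rightarrow> real) set" where
  "normalized_class D n \<kappa> =
    {H. symm_on n H \<and> qf_var D n (\<Sum>i<n. H i i) H = 1 \<and> dual_bounded n \<kappa> H}"

definition trunc_sum :: "nat \<Rightarrow> nat \<Rightarrow> real \<Rightarrow> (nat \<Rightarrow> nat \<Rightarrow> real) \<Rightarrow> (nat \<times> nat \<Rightarrow> real) \<Rightarrow> real" where
  "trunc_sum m n b H a = (\<Sum>i<m. min \<bar>ip n (\<lambda>j. a (i, j)) (mv n H (\<lambda>j. a (i, j)))\<bar> b)"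

lemma qf_var_scale: "qf_var D n (c * \<tau>) (\<lambda>i j. c * H i j) = c\<^sup>2 * qf_var D n \<tau> H"
proof -
  have "ip i (\<lambda>j. 2 * (c * H i j)) (\<lambda>j. 2 * (c * H i j)) = c\<^sup>2 * ip i (\<lambda>j. 2 * H i j) (\<lambda>j. 2 * H i j)" for i
    unfolding ip_def sum_distrib_left by (intro sum.cong refl) (simp add: power2_eq_square)
  then show ?thesis
    by (simp add: qf_var_def power_mult_distrib sum_distrib_left distrib_left mult_ac)
qed

lemma quadratic_form_scale: "ip n x (mv n (\<lambda>i j. c * H i j) x) = c * ip n x (mv n H x)"
proof -
  have "mv n (\<lambda>i j. c * H i j) x = (\<lambda>i. c * mv n H x i)"
    by (simp add: mv_def sum_distrib_left mult.assoc)
  then show ?thesis by (simp add: ip_scale_right)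
qed

lemma mip_scale: "mip n W (\<lambda>i j. c * H i j) = c * mip n W H"
  by (simp add: mip_def sum_distrib_left mult_ac)

lemma sens_op_index:
  assumes "M \<in> carrier_mat n n" "i < m"
  shows "sens_op a m n M $ i = ip n (\<lambda>j. a (i, j)) (mv n (entries M) (\<lambda>j. a (i, j)))"
  using assms by (simp add: sens_op_def sens_vec_def scalar_prod_mult_mat_vec)

text \<open>Both \<open>Sh\<close> and \<open>Sig\<close> fit the data up to \<open>eps\<close>, so
  the triangle inequality gives twice that.\<close>

lemma minimizer_residual:
  assumes c: "Sig \<in> carrier_mat n n" "Sh \<in> carrier_mat n n" and eta: "eta \<in> carrier_vec m" "l1_norm eta \<le> eps"
    and res: "l1_norm (sens_op a m n Sig + eta - sens_op a m n Sh) \<le> eps"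
  shows "(\<Sum>i<m. \<bar>ip n (\<lambda>j. a (i, j)) (mv n (entries (Sh - Sig)) (\<lambda>j. a (i, j)))\<bar>) \<le> 2 * eps"
proof -
  have dims: "dim_vec (sens_op a m n M) = m" for M by (simp add: sens_op_def)
  have "(\<Sum>i<m. \<bar>ip n (\<lambda>j. a (i, j)) (mv n (entries (Sh - Sig)) (\<lambda>j. a (i, j)))\<bar>) \<le>
      (\<Sum>i<m. \<bar>sens_op a m n Sig $ i + eta $ i - sens_op a m n Sh $ i\<bar> + \<bar>eta $ i\<bar>)"
  proof (rule sum_mono)
    fix i assume i: "i \<in> {..<m}"
    let ?x = "\<lambda>j. a (i, j)"
    have "ip n ?x (mv n (entries (Sh - Sig)) ?x) = ip n ?x (\<lambda>k. mv n (entries Sh) ?x k - mv n (entries Sig) ?x k)"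
      using c by (intro ip_cong) (auto simp: mv_def left_diff_distrib sum_subtractf)
    also have "\<dots> = sens_op a m n Sh $ i - sens_op a m n Sig $ i"
      using c i by (simp add: ip_diff_right sens_op_index)
    finally show "\<bar>ip n ?x (mv n (entries (Sh - Sig)) ?x)\<bar> \<le>
        \<bar>sens_op a m n Sig $ i + eta $ i - sens_op a m n Sh $ i\<bar> + \<bar>eta $ i\<bar>" by linarith
  qed
  also have "\<dots> = l1_norm (sens_op a m n Sig + eta - sens_op a m n Sh) + l1_norm eta"
    using eta dims by (simp add: l1_norm_def sum.distrib)
  finally show ?thesis using res eta by linarith
qed

text \<open>Either the tail dominates, which yields the constant 2, or the rescaled error lies in
  the normalised class and the lower bound meets the residual bound \<open>2 * eps\<close>. Solving
  \<open>m / (4 * b) * (sqrt \<gamma> * h) \<le> 2 * eps\<close> for \<open>h\<close> gives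
  \<open>8 * b / sqrt \<gamma>\<close>.\<close>

lemma recovery_from_lower_bound:
  assumes \<gamma>: "0 < \<gamma>" "\<gamma> \<le> 1" "\<gamma> \<le> (\<integral>x. x ^ 4 \<partial>D) - 1" and b: "1 \<le> b" and r: "1 \<le> r" and m: "0 < m"
    and lower: "\<And>H. H \<in> normalized_class D n (4 / sqrt \<gamma> * sqrt (real r)) \<Longrightarrow> real m / (4 * b) \<le> trunc_sum m n b H a"
  shows "a \<in> recovery_event m n r 2 (8 * b / sqrt \<gamma>)"
  unfolding recovery_event_def
proof (intro CollectI allI impI)
  fix Sig eps eta Sh Sr
  assume Sig: "psd_mat n Sig" and eps: "0 \<le> eps" and eta: "eta \<in> carrier_vec m" "l1_norm eta \<le> eps"
    and min: "is_minimizer a m n (sens_op a m n Sig + eta) eps Sh" and Sr: "best_rank_approx r Sig Sr"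
  define y where "y = sens_op a m n Sig + eta"
  have Sh: "psd_mat n Sh" and res: "l1_norm (y - sens_op a m n Sh) \<le> eps"
    using min by (auto simp: is_minimizer_def y_def)
  have c: "Sig \<in> carrier_mat n n" "Sh \<in> carrier_mat n n" using Sig Sh by (auto simp: psd_mat_def)
  have Src: "Sr \<in> carrier_mat n n" "mat_rank Sr \<le> r" using Sr c by (auto simp: best_rank_approx_def)
  have dims: "dim_vec (sens_op a m n M) = m" for M by (simp add: sens_op_def)
  have "y - sens_op a m n Sig = eta"
    using eta dims by (intro eq_vecI) (auto simp: y_def)
  then have tr: "mtrace Sh \<le> mtrace Sig"
    using min eta Sig by (auto simp: is_minimizer_def y_def)
  define h where "h = frob_norm (Sh - Sig)"
  define N where "N = nuc_norm (Sig - Sr)"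
  define H where "H = entries (Sh - Sig)"
  have hh: "h\<^sup>2 = mip n H H" and h0: "0 \<le> h"
    using c by (simp_all add: h_def frob_norm_def mip_def H_def power2_eq_square sum_nonneg)
  have N0: "0 \<le> N" unfolding N_def using c Src by (intro nuc_norm_nonneg) auto
  have rp: "0 < sqrt (real r)" and gp: "0 < sqrt \<gamma>" using r \<gamma> by auto
  have C2: "0 \<le> 8 * b / sqrt \<gamma> * eps / real m" using b gp eps by simp
  show "frob_norm (Sh - Sig) \<le> 2 * nuc_norm (Sig - Sr) / sqrt (real r) + 8 * b / sqrt \<gamma> * eps / real m"
    unfolding h_def[symmetric] N_def[symmetric]
  proof (cases "h \<le> 2 * N / sqrt (real r)")
    case True
    then show "h \<le> 2 * N / sqrt (real r) + 8 * b / sqrt \<gamma> * eps / real m" using C2 by linarith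
  next
    \<comment> \<open>Now \<open>2 * N\<close> is below \<open>sqrt r * h\<close>, so the dual bound
      \<open>3 * sqrt r * h + 2 * N\<close> becomes \<open>4 * sqrt r * h\<close>; dividing by
      \<open>sqrt v \<ge> sqrt \<gamma> * h\<close> gives the level
      \<open>4 / sqrt \<gamma> * sqrt r\<close>.\<close>
    case False
    then have "2 * N / sqrt (real r) < h" by simp
    then have big: "2 * N < sqrt (real r) * h" using rp by (simp add: pos_divide_less_eq mult.commute)
    then have "0 < sqrt (real r) * h" using N0 by linarith
    then have hpos: "0 < h" using rp by (simp add: zero_less_mult_iff)
    have symH: "symm_on n H"
      using Sig Sh c by (auto simp: psd_mat_entries symm_on_def H_def)
    define v where "v = qf_var D n (\<Sum>i<n. H i i) H"
    have "\<gamma> * h\<^sup>2 \<le> v" unfolding hh v_def using \<gamma> by (intro frobenius_le_qf_var symH) auto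
    then have sv: "sqrt \<gamma> * h \<le> sqrt v" using real_sqrt_le_mono[of "\<gamma> * h\<^sup>2" v] h0 by (simp add: real_sqrt_mult)
    have "0 < sqrt \<gamma> * h" using gp hpos by simp
    then have svp: "0 < sqrt v" using sv by linarith
    define d where "d = 1 / sqrt v"
    have d: "0 < d" using svp by (simp add: d_def)
    define H' where "H' = (\<lambda>i j. d * H i j)"
    have "H' \<in> normalized_class D n (4 / sqrt \<gamma> * sqrt (real r))"
      unfolding normalized_class_def
    proof (intro CollectI conjI)
      show "symm_on n H'" using symH by (auto simp: symm_on_def H'_def)
      have "qf_var D n (\<Sum>i<n. H' i i) H' = d\<^sup>2 * v"
        unfolding H'_def sum_distrib_left[symmetric] v_def by (rule qf_var_scale)
      then show "qf_var D n (\<Sum>i<n. H' i i) H' = 1" using svp by (simp add: d_def power_divide)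
      show "dual_bounded n (4 / sqrt \<gamma> * sqrt (real r)) H'"
        unfolding dual_bounded_def
      proof (intro allI impI)
        fix W assume W: "symm_on n W" "\<forall>x. \<bar>ip n x (mv n W x)\<bar> \<le> ip n x x"
        have "mip n W H \<le> 3 * sqrt (real r) * h + 2 * N"
          unfolding H_def h_def N_def using W by (intro minimizer_error_dual_bound[OF Sig Sh tr Src]) auto
        also have "\<dots> \<le> 4 * sqrt (real r) * h" using big by linarith
        finally have "d * mip n W H \<le> d * (4 * sqrt (real r) * h)" using d by (intro mult_left_mono) auto
        also have "\<dots> = 4 * sqrt (real r) * (h / sqrt v)" by (simp add: d_def)
        also have "\<dots> \<le> 4 * sqrt (real r) * (1 / sqrt \<gamma>)"
          using sv svp gp by (intro mult_left_mono) (simp_all add: field_simps)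
        finally show "mip n W H' \<le> 4 / sqrt \<gamma> * sqrt (real r)" by (simp add: H'_def mip_scale)
      qed
    qed
    then have "real m / (4 * b) \<le> trunc_sum m n b H' a" by (rule lower)
    also have "\<dots> \<le> (\<Sum>i<m. d * \<bar>ip n (\<lambda>j. a (i, j)) (mv n H (\<lambda>j. a (i, j)))\<bar>)"
      unfolding trunc_sum_def H'_def quadratic_form_scale using d by (intro sum_mono) (simp add: abs_mult)
    also have "\<dots> = d * (\<Sum>i<m. \<bar>ip n (\<lambda>j. a (i, j)) (mv n H (\<lambda>j. a (i, j)))\<bar>)" by (simp add: sum_distrib_left)
    also have "\<dots> \<le> d * (2 * eps)"
      unfolding H_def using d res eta c by (intro mult_left_mono minimizer_residual) (auto simp: y_def)
    finally have "real m / (4 * b) * sqrt v \<le> 2 * eps" using svp by (simp add: d_def field_simps)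
    moreover have "real m / (4 * b) * (sqrt \<gamma> * h) \<le> real m / (4 * b) * sqrt v"
      using sv b by (intro mult_left_mono) auto
    ultimately have "real m / (4 * b) * (sqrt \<gamma> * h) \<le> 2 * eps" by linarith
    then have "h \<le> 8 * b / sqrt \<gamma> * eps / real m" using m b gp by (simp add: field_simps)
    moreover have "0 \<le> 2 * N / sqrt (real r)" using N0 rp by simp
    ultimately show "h \<le> 2 * N / sqrt (real r) + 8 * b / sqrt \<gamma> * eps / real m" by linarith
  qed
qed

text \<open>For a fixed sample the lower bound is a closed condition on \<open>H\<close>, so it
  extends from a dense subset to its closure.\<close>

lemma continuous_on_trunc_sum: "continuous_on UNIV (\<lambda>H. trunc_sum m n b H a)"
proof -
  have "continuous_on UNIV (\<lambda>H :: nat \<Rightarrow> nat \<Rightarrow> real. H i j)" for i j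
    by (rule continuous_on_product_then_coordinatewise, rule continuous_on_product_coordinates)
  then show ?thesis unfolding trunc_sum_def ip_def mv_def by (intro continuous_intros)
qed

lemma measurable_trunc_sum:
  assumes "sets D = sets borel"
  shows "trunc_sum m n b H \<in> borel_measurable (sample_space D m n)"
proof -
  have "(\<lambda>a. a (i, j)) \<in> borel_measurable (sample_space D m n)" if "i < m" "j < n" for i j
    unfolding sample_space_def
    using that measurable_component_singleton[of "(i, j)" "{..<m} \<times> {..<n}" "\<lambda>_. D"] assms
    by (auto cong: measurable_cong_sets)
  then have "(\<lambda>a. ip n (\<lambda>j. a (i, j)) (mv n H (\<lambda>j. a (i, j)))) \<in> borel_measurable (sample_space D m n)" if "i < m" for i
    unfolding ip_def mv_def using that by (intro borel_measurable_sum borel_measurable_times) auto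
  then show ?thesis
    unfolding trunc_sum_def[abs_def] by (intro borel_measurable_sum borel_measurable_min) auto
qed

text \<open>The signs belong to an auxiliary space. The event does not mention them, so its
  probability transfers to \<open>sample_space\<close> along the map that forgets them.\<close>

lemma finite_class_event:
  assumes D: "entry_distribution D"
  obtains b c where "1 \<le> b" "0 < c"
    "\<And>n m \<kappa> F. finite F \<Longrightarrow> F \<noteq> {} \<Longrightarrow> F \<subseteq> normalized_class D n \<kappa> \<Longrightarrow> n \<le> m \<Longrightarrow> 0 < m \<Longrightarrow> 0 \<le> \<kappa> \<Longrightarrow>
      c * \<kappa> * sqrt (real n * real m) \<le> real m / (8 * b) \<Longrightarrow>
      1 - exp (- real m / (32 * b ^ 4)) \<le>
        measure (sample_space D m n) {a \<in> space (sample_space D m n). \<forall>H\<in>F. real m / (4 * b) \<le> trunc_sum m n b H a}"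
proof -
  have Dp: "prob_space D" and sets: "sets D = sets borel" using D by (simp_all add: entry_distribution_def)
  obtain b where b: "1 \<le> b"
    and mean: "\<And>n H. symm_on n H \<Longrightarrow> qf_var D n (\<Sum>i<n. H i i) H = 1 \<Longrightarrow>
      1 / (2 * b) \<le> (\<integral>x. min \<bar>ip n x (mv n H x)\<bar> b \<partial>iid D n)"
    and int: "\<And>n H. symm_on n H \<Longrightarrow> integrable (iid D n) (\<lambda>x. ip n x (mv n H x))"
    using qf_small_ball[OF D] by blast
  obtain c where c: "0 < c"
    and sup: "\<And>n m \<kappa> F. 0 < n \<Longrightarrow> n \<le> m \<Longrightarrow> 0 \<le> \<kappa> \<Longrightarrow> finite F \<Longrightarrow> F \<noteq> {} \<Longrightarrow> \<forall>H\<in>F. dual_bounded n \<kappa> H \<Longrightarrow>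
      (\<integral>w. Max ((\<lambda>H. \<Sum>i<m. 2 * (snd (w i) * ip n (fst (w i)) (mv n H (fst (w i))))) ` F)
        \<partial>iid (signed_sample D n) m) \<le> c * \<kappa> * sqrt (real n * real m)"
    by (rule expected_signed_sup[OF D], rule that)
  show thesis
  proof (rule that[OF b c])
    fix n m \<kappa> F
    assume F: "finite F" "F \<noteq> {}" "F \<subseteq> normalized_class D n \<kappa>" and nm: "n \<le> m" and m: "0 < m" and \<kappa>: "0 \<le> \<kappa>"
      and small: "c * \<kappa> * sqrt (real n * real m) \<le> real m / (8 * b)"
    have FH: "symm_on n H" "qf_var D n (\<Sum>i<n. H i i) H = 1" "dual_bounded n \<kappa> H" if "H \<in> F" for H
      using F(3) that by (auto simp: normalized_class_def)
    \<comment> \<open>For \<open>n = 0\<close> the second moment is 0, so a nonempty class excludes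
      this case.\<close>
    have n: "0 < n"
    proof (rule ccontr)
      assume "\<not> 0 < n"
      then have "n = 0" by simp
      obtain H where "H \<in> F" using F by blast
      then show False using FH(2)[of H] \<open>n = 0\<close> by (simp add: qf_var_def)
    qed
    let ?Q = "signed_sample D n"
    define g where "g = (\<lambda>w :: nat \<Rightarrow> (nat \<Rightarrow> real) \<times> real. \<lambda>p\<in>{..<m} \<times> {..<n}. fst (w (fst p)) (snd p))"
    have gm: "g \<in> iid ?Q m \<rightarrow>\<^sub>M sample_space D m n"
      and gd: "distr (iid ?Q m) (sample_space D m n) g = sample_space D m n"
      unfolding g_def using distr_signed_sample_sample_space[OF Dp, of m n] by blast+
    have S: "trunc_sum m n b H (g w) = (\<Sum>i<m. trunc_qf n b H (fst (w i)))" for H w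
      unfolding trunc_sum_def
    proof (rule sum.cong[OF refl])
      fix i assume i: "i \<in> {..<m}"
      have "g w (i, j) = fst (w i) j" if "j < n" for j using i that by (simp add: g_def)
      then have "ip n (\<lambda>j. g w (i, j)) (mv n H (\<lambda>j. g w (i, j))) = ip n (fst (w i)) (mv n H (fst (w i)))"
        by (intro ip_cong) (auto simp: mv_def)
      then show "min \<bar>ip n (\<lambda>j. g w (i, j)) (mv n H (\<lambda>j. g w (i, j)))\<bar> b = trunc_qf n b H (fst (w i))" by simp
    qed
    let ?X = "{a \<in> space (sample_space D m n). \<forall>H\<in>F. real m / (4 * b) \<le> trunc_sum m n b H a}"
    have Xm: "?X \<in> sets (sample_space D m n)"
      using F(1) measurable_trunc_sum[OF sets] by (intro sets.sets_Collect_finite_All borel_measurable_le) auto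
    have pre: "g -` ?X \<inter> space (iid ?Q m) =
        {w \<in> space (iid ?Q m). \<forall>H\<in>F. real m / (4 * b) \<le> (\<Sum>i<m. trunc_qf n b H (fst (w i)))}"
      using measurable_space[OF gm] by (auto simp: S)
    have "1 - exp (- real m / (32 * b ^ 4)) \<le> measure (iid ?Q m) (g -` ?X \<inter> space (iid ?Q m))"
      unfolding pre
    proof (rule finite_class_concentration[OF D b])
      show "(\<integral>w. Max ((\<lambda>H. \<Sum>i<m. 2 * (snd (w i) * ip n (fst (w i)) (mv n H (fst (w i))))) ` F) \<partial>iid ?Q m) \<le> real m / (8 * b)"
        using sup[OF n nm \<kappa> F(1,2)] FH(3) small by fastforce
    qed (use F FH int mean m in auto)
    also have "\<dots> = measure (distr (iid ?Q m) (sample_space D m n) g) ?X"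
      using gm Xm by (simp add: measure_distr)
    finally show "1 - exp (- real m / (32 * b ^ 4)) \<le> measure (sample_space D m n) ?X" unfolding gd .
  qed
qed

theorem theorem1:
  fixes D :: "real measure"
  assumes "entry_distribution D"
  shows "\<exists>c0>0. \<exists>c1>0. \<exists>C0>0. \<exists>C1>0. \<exists>C2>0.
    \<forall>n m r :: nat. 1 \<le> r \<longrightarrow> real m > c1 * real n * real r \<longrightarrow>
      (\<exists>E \<in> sets (sample_space D m n). E \<subseteq> recovery_event m n r C1 C2 \<and>
         measure (sample_space D m n) E \<ge> 1 - C0 * exp (- c0 * real m))"
proof -
  have D: "entry_distribution D" by fact
  have Dp: "prob_space D" and sets: "sets D = sets borel" and \<mu>: "(\<integral>x. x ^ 4 \<partial>D) > 1"
    using D by (simp_all add: entry_distribution_def)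
  define \<gamma> where "\<gamma> = min 1 ((\<integral>x. x ^ 4 \<partial>D) - 1)"
  have \<gamma>: "0 < \<gamma>" "\<gamma> \<le> 1" "\<gamma> \<le> (\<integral>x. x ^ 4 \<partial>D) - 1" using \<mu> by (auto simp: \<gamma>_def)
  obtain b c where b: "1 \<le> b" and c: "0 < c" and event:
    "\<And>n m \<kappa> F. finite F \<Longrightarrow> F \<noteq> {} \<Longrightarrow> F \<subseteq> normalized_class D n \<kappa> \<Longrightarrow> n \<le> m \<Longrightarrow> 0 < m \<Longrightarrow> 0 \<le> \<kappa> \<Longrightarrow>
      c * \<kappa> * sqrt (real n * real m) \<le> real m / (8 * b) \<Longrightarrow>
      1 - exp (- real m / (32 * b ^ 4)) \<le>
        measure (sample_space D m n) {a \<in> space (sample_space D m n). \<forall>H\<in>F. real m / (4 * b) \<le> trunc_sum m n b H a}"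
    by (rule finite_class_event[OF D], rule that)
  define K where "K = 4 / sqrt \<gamma>"
  define q where "q = 8 * b * c * K"
  \<comment> \<open>The 1 ensures \<open>n \<le> m\<close>; the square of \<open>q\<close> makes the
    expected supremum at level \<open>\<kappa> = K * sqrt r\<close> at most
    \<open>m / (8 * b)\<close>, as \<open>small\<close> shows.\<close>
  define c1 where "c1 = max 1 (q\<^sup>2)"
  have K: "0 < K" using \<gamma> by (simp add: K_def)
  have q: "0 < q" using b c K by (simp add: q_def)
  have main: "\<exists>E \<in> sets (sample_space D m n). E \<subseteq> recovery_event m n r 2 (8 * b / sqrt \<gamma>) \<and>
         measure (sample_space D m n) E \<ge> 1 - 1 * exp (- (1 / (32 * b ^ 4)) * real m)"
    if r: "1 \<le> r" and mr: "real m > c1 * real n * real r" for n m r :: nat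
  proof -
    let ?S = "sample_space D m n"
    interpret S: prob_space ?S unfolding sample_space_def using Dp by (intro prob_space_PiM)
    define \<kappa> where "\<kappa> = K * sqrt (real r)"
    have \<kappa>: "0 \<le> \<kappa>" using K by (simp add: \<kappa>_def)
    have c1: "1 \<le> c1" "q\<^sup>2 \<le> c1" by (auto simp: c1_def)
    have nr0: "0 \<le> real n * real r" by simp
    have "0 \<le> c1 * real n * real r" using c1 by simp
    then have m: "0 < m" using mr by linarith
    have "real n * 1 \<le> real n * real r" using r by (intro mult_left_mono) auto
    moreover have "1 * (real n * real r) \<le> c1 * (real n * real r)" using c1 nr0 by (intro mult_right_mono) auto
    ultimately have "real n \<le> real m" using mr by (simp add: mult.assoc)
    then have nm: "n \<le> m" by simp
    have small: "c * \<kappa> * sqrt (real n * real m) \<le> real m / (8 * b)"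
    proof -
      have "q\<^sup>2 * (real n * real r) \<le> c1 * (real n * real r)" using c1 nr0 by (intro mult_right_mono) auto
      then have "q\<^sup>2 * (real n * real r) \<le> real m" using mr by (simp add: mult.assoc)
      then have "sqrt (q\<^sup>2 * (real n * real r)) \<le> sqrt (real m)" by (rule real_sqrt_le_mono)
      then have le: "q * sqrt (real n * real r) \<le> sqrt (real m)" using q by (simp add: real_sqrt_mult)
      have "8 * b * (c * \<kappa> * sqrt (real n * real m)) = (q * sqrt (real n * real r)) * sqrt (real m)"
        by (simp add: q_def \<kappa>_def real_sqrt_mult mult_ac)
      also have "\<dots> \<le> sqrt (real m) * sqrt (real m)" using le by (intro mult_right_mono) auto
      also have "\<dots> = real m" by simp
      finally show ?thesis using b by (simp add: pos_le_divide_eq mult_ac)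
    qed
    obtain T where T: "countable T" "T \<subseteq> normalized_class D n \<kappa>" "normalized_class D n \<kappa> \<subseteq> closure T"
      using countable_dense_subset[of "normalized_class D n \<kappa>"] by blast
    define A where "A = (\<lambda>H. {a \<in> space ?S. real m / (4 * b) \<le> trunc_sum m n b H a})"
    have Am: "A H \<in> S.events" for H
      unfolding A_def using measurable_trunc_sum[OF sets] by (intro borel_measurable_le) auto
    have fin: "1 - exp (- real m / (32 * b ^ 4)) \<le> S.prob {a \<in> space ?S. \<forall>H\<in>F. a \<in> A H}"
      if F: "finite F" "F \<noteq> {}" "F \<subseteq> T" for F
    proof -
      have "{a \<in> space ?S. \<forall>H\<in>F. a \<in> A H} = {a \<in> space ?S. \<forall>H\<in>F. real m / (4 * b) \<le> trunc_sum m n b H a}"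
        by (auto simp: A_def)
      then show ?thesis using event[OF F(1,2) _ nm m \<kappa> small] F(3) T(2) by (metis subset_trans)
    qed
    \<comment> \<open>Only countably many matrices are tested, so \<open>E\<close> is measurable;
      the closure step below extends the bound to the whole normalised class for each sample in
      \<open>E\<close>.\<close>
    define E where "E = {a \<in> space ?S. \<forall>H\<in>T. a \<in> A H}"
    have Em: "E \<in> sets ?S" and Ep: "1 - exp (- real m / (32 * b ^ 4)) \<le> S.prob E"
      unfolding E_def using S.countable_intersection_measure_ge[OF T(1) Am fin] by auto
    have "E \<subseteq> recovery_event m n r 2 (8 * b / sqrt \<gamma>)"
    proof
      fix a assume a: "a \<in> E"
      have "T \<subseteq> {H. real m / (4 * b) \<le> trunc_sum m n b H a}" using a by (auto simp: E_def A_def)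
      moreover have "closed {H. real m / (4 * b) \<le> trunc_sum m n b H a}"
        by (intro closed_Collect_le continuous_on_const continuous_on_trunc_sum)
      ultimately have "closure T \<subseteq> {H. real m / (4 * b) \<le> trunc_sum m n b H a}" by (rule closure_minimal)
      then show "a \<in> recovery_event m n r 2 (8 * b / sqrt \<gamma>)"
        using T(3) by (intro recovery_from_lower_bound[OF \<gamma> b r m]) (auto simp: \<kappa>_def K_def)
    qed
    then show ?thesis using Em Ep by (intro bexI[of _ E]) auto
  qed
  have c1p: "0 < c1" by (simp add: c1_def)
  have C2: "0 < 8 * b / sqrt \<gamma>" using b \<gamma> by simp
  have c0: "0 < 1 / (32 * b ^ 4)" using b by simp
  show ?thesis
  proof (rule exI[of _ "1 / (32 * b ^ 4)"], intro conjI c0, rule exI[of _ c1], intro conjI c1p,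
      rule exI[of _ 1], intro conjI, simp, rule exI[of _ 2], intro conjI, simp,
      rule exI[of _ "8 * b / sqrt \<gamma>"], intro conjI C2)
    show "\<forall>n m r :: nat. 1 \<le> r \<longrightarrow> real m > c1 * real n * real r \<longrightarrow>
      (\<exists>E \<in> sets (sample_space D m n). E \<subseteq> recovery_event m n r 2 (8 * b / sqrt \<gamma>) \<and>
         measure (sample_space D m n) E \<ge> 1 - 1 * exp (- (1 / (32 * b ^ 4)) * real m))"
      using main by blast
  qed
qed

end
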